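(* Let $d$ and $n$ be non-negative integers, let $F_n$ be the free group of rank $n$, let $\tau:F_n\to \mathrm{GL}_d(\mathbb{Z})$ be a homomorphism, and let $G=\mathbb{Z}^d\rtimes_\tau F_n$. If $G$ has subexponential Dehn function, then $G$ has decidable Conjugacy Problem.
   Context: $\mathrm{GL}_d(\mathbb{Z})=\mathrm{Aut}(\mathbb{Z}^d)$ acts on $\mathbb{Z}^d$ on the right (multiplication of row vectors by matrices on the right), written $u\mapsto u^{c}$. For groups $A$, $B$ and a homomorphism $\tau:B\to\mathrm{Aut}(A)$, the semidirect product $A\rtimes_\tau B$ is the set of all pairs $(b,a)$ with $b\in B$, $a\in A$, with product $(b_1,a_1)(b_2,a_2)=(b_1b_2,\,a_1^{\tau(b_2)}a_2)$. The Dehn function of a finitely presented group $G=\langle S\mid R\rangle$ is the function $\delta:\mathbb{N}\to\mathbb{N}$ where $\delta(m)$ is the maximum, over all words $w$ over $S\cup S^{-1}$ of length at most $m$ that represent the identity of $G$, of the least number $N$ such that $w$ equals, in the free group on $S$, a product of $N$ conjugates of elements of $R\cup R^{-1}$. Up to the usual equivalence of functions it does not depend on the finite presentation. It is subexponential if it grows strictly slower than exponentially, i.e., $\log(1+\delta(m))/m\to 0$ as $m\to\infty$. The Conjugacy Problem for a group $G$ with finite generating set $S$ is the problem of deciding, given two words over $S\cup S^{-1}$, whether the elements of $G$ they represent are conjugate in $G$; it is decidable if some algorithm solves it for all inputs. *)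

theory Defs
  imports
    Complex_Main
    "HOL-Library.Nat_Bijection"
    "HOL-Algebra.Coset"
    "HOL-Algebra.Generated_Groups"
    "Jordan_Normal_Form.Matrix"
begin

section \<open>Words and free groups\<close>

text \<open>A letter \<open>(x, True)\<close> stands for the generator \<open>x\<close>, and \<open>(x, False)\<close> for its formal inverse.\<close>

type_synonym 'a gword = "('a \<times> bool) list"

definition words_over :: "'a set \<Rightarrow> 'a gword set" where
  "words_over X = lists (X \<times> UNIV)"

fun inv_letter :: "'a \<times> bool \<Rightarrow> 'a \<times> bool" where
  "inv_letter (x, e) = (x, \<not> e)"

definition reduced :: "'a gword \<Rightarrow> bool" where
  "reduced w \<longleftrightarrow> successively (\<lambda>a b. b \<noteq> inv_letter a) w"

fun cancel_cons :: "'a \<times> bool \<Rightarrow> 'a gword \<Rightarrow> 'a gword" where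
  "cancel_cons a [] = [a]"
| "cancel_cons a (b # w) = (if b = inv_letter a then w else a # b # w)"

definition reduce :: "'a gword \<Rightarrow> 'a gword" where
  "reduce w = foldr cancel_cons w []"

text \<open>The free group on \<open>X\<close>; its elements are represented by the freely reduced words.\<close>

definition free_group :: "'a set \<Rightarrow> 'a gword monoid" where
  "free_group X = \<lparr>
     carrier = {w \<in> words_over X. reduced w},
     monoid.mult = (\<lambda>u v. reduce (u @ v)),
     one = []\<rparr>"

lemma inv_letter_inv_letter [simp]: "inv_letter (inv_letter a) = a"
  by (cases a) simp

lemma inv_letter_neq [simp]: "inv_letter a \<noteq> a" "a \<noteq> inv_letter a"
  by (cases a; simp)+

lemma reduced_Nil [simp]: "reduced []"
  by (simp add: reduced_def)

lemma reduced_Cons: "reduced (a # w) \<longleftrightarrow> (w = [] \<or> hd w \<noteq> inv_letter a) \<and> reduced w"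
  by (auto simp: reduced_def successively_Cons)

lemma reduced_cancel_cons: "reduced w \<Longrightarrow> reduced (cancel_cons a w)"
  by (cases w) (auto simp: reduced_Cons)

lemma cancel_cons_inverse: "reduced w \<Longrightarrow> cancel_cons a (cancel_cons (inv_letter a) w) = w"
  by (cases w rule: remdups_adj.cases) (auto simp: reduced_Cons)

lemma reduced_foldr: "reduced z \<Longrightarrow> reduced (foldr cancel_cons w z)"
  by (induction w) (auto intro: reduced_cancel_cons)

lemma reduced_reduce [simp]: "reduced (reduce w)"
  by (simp add: reduce_def reduced_foldr)

lemma reduce_reduced: "reduced w \<Longrightarrow> reduce w = w"
proof (induction w)
  case (Cons a w)
  then show ?case by (cases w) (auto simp: reduce_def reduced_Cons)
qed (simp add: reduce_def)

lemma foldr_cancel_cons: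
  assumes "reduced z"
  shows "foldr cancel_cons (cancel_cons a u) z = cancel_cons a (foldr cancel_cons u z)"
  using assms by (cases u) (auto simp: cancel_cons_inverse reduced_foldr)

lemma foldr_reduce: "reduced z \<Longrightarrow> foldr cancel_cons (reduce u) z = foldr cancel_cons u z"
  by (induction u) (auto simp: reduce_def foldr_cancel_cons)

lemma reduce_append: "reduce (u @ v) = foldr cancel_cons u (reduce v)"
  by (simp add: reduce_def)

lemma reduce_append_reduce [simp]:
  "reduce (reduce u @ v) = reduce (u @ v)" "reduce (u @ reduce v) = reduce (u @ v)"
  by (simp_all add: reduce_append foldr_reduce reduce_reduced)

lemma reduce_inverse: "reduce (rev (map inv_letter w) @ w) = []"
proof -
  have "foldr cancel_cons (rev (map inv_letter w)) (foldr cancel_cons w z) = z"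
    if "reduced z" for z
    using that
  proof (induction w)
    case (Cons a w)
    then show ?case
      using cancel_cons_inverse[of "foldr cancel_cons w z" "inv_letter a"]
      by (simp add: reduced_foldr)
  qed simp
  from this[of "[]"] show ?thesis by (simp add: reduce_def)
qed

lemma cancel_cons_words_over:
  "a \<in> X \<times> UNIV \<Longrightarrow> w \<in> words_over X \<Longrightarrow> cancel_cons a w \<in> words_over X"
  by (cases w) (auto simp: words_over_def)

lemma reduce_words_over: "w \<in> words_over X \<Longrightarrow> reduce w \<in> words_over X"
proof (induction w)
  case (Cons a w)
  then have "cancel_cons a (reduce w) \<in> words_over X"
    by (intro cancel_cons_words_over) (auto simp: words_over_def)
  then show ?case by (simp add: reduce_def)
qed (simp add: reduce_def)

lemma group_free_group: "group (free_group X)"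
proof (rule groupI)
  fix w assume w: "w \<in> carrier (free_group X)"
  have "rev (map inv_letter w) \<in> words_over X"
    using w by (force simp: free_group_def words_over_def elim: inv_letter.elims)
  then have "reduce (rev (map inv_letter w)) \<in> carrier (free_group X)"
    by (simp add: free_group_def reduce_words_over)
  moreover have "reduce (rev (map inv_letter w)) \<otimes>\<^bsub>free_group X\<^esub> w = \<one>\<^bsub>free_group X\<^esub>"
    by (simp add: free_group_def reduce_inverse)
  ultimately show "\<exists>y\<in>carrier (free_group X). y \<otimes>\<^bsub>free_group X\<^esub> w = \<one>\<^bsub>free_group X\<^esub>"
    by blast
next
  fix u v
  assume "u \<in> carrier (free_group X)" "v \<in> carrier (free_group X)"
  then have "u @ v \<in> words_over X"
    by (auto simp: free_group_def words_over_def)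
  then show "u \<otimes>\<^bsub>free_group X\<^esub> v \<in> carrier (free_group X)"
    by (simp add: free_group_def reduce_words_over)
qed (auto simp: free_group_def words_over_def reduce_reduced)


section \<open>Semidirect products\<close>

text \<open>Here \<open>act b a\<close> is the value at \<open>a\<close> of the automorphism attached to \<open>b\<close>.\<close>

definition semidirect ::
  "('a, 'x) monoid_scheme \<Rightarrow> ('b, 'y) monoid_scheme \<Rightarrow> ('b \<Rightarrow> 'a \<Rightarrow> 'a) \<Rightarrow> ('b \<times> 'a) monoid" where
  "semidirect A B act = \<lparr>
     carrier = carrier B \<times> carrier A,
     monoid.mult = (\<lambda>(b1, a1) (b2, a2). (b1 \<otimes>\<^bsub>B\<^esub> b2, act b2 a1 \<otimes>\<^bsub>A\<^esub> a2)),
     one = (\<one>\<^bsub>B\<^esub>, \<one>\<^bsub>A\<^esub>)\<rparr>"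

abbreviation int_lattice :: "nat \<Rightarrow> int vec monoid" where
  "int_lattice d \<equiv> monoid_vec TYPE(int) d"

definition GL_int :: "nat \<Rightarrow> int mat monoid" where
  "GL_int d = units_of (ring_mat TYPE(int) d ())"

text \<open>The product of the row vector \<open>u\<close> with the matrix \<open>c\<close> on its right.\<close>

definition row_mult :: "int vec \<Rightarrow> int mat \<Rightarrow> int vec" where
  "row_mult u c = vec (dim_col c) (\<lambda>j. u \<bullet> col c j)"

definition lattice_by_free ::
  "nat \<Rightarrow> nat \<Rightarrow> (nat gword \<Rightarrow> int mat) \<Rightarrow> (nat gword \<times> int vec) monoid" where
  "lattice_by_free d n \<tau> =
     semidirect (int_lattice d) (free_group {..<n}) (\<lambda>b u. row_mult u (\<tau> b))"

lemma row_mult_eq_transpose: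
  assumes "u \<in> carrier_vec (dim_row c)"
  shows "row_mult u c = transpose_mat c *\<^sub>v u"
  using assms by (intro eq_vecI) (auto simp: row_mult_def comm_scalar_prod[of u "dim_row c"])

lemma group_GL_int: "group (GL_int d)"
  unfolding GL_int_def by (intro monoid.units_group ring.is_monoid ring_mat)

lemma group_lattice_by_free:
  assumes "\<tau> \<in> hom (free_group {..<n}) (GL_int d)"
  shows "group (lattice_by_free d n \<tau>)"
proof -
  let ?F = "free_group {..<n}"
  interpret F: group ?F by (rule group_free_group)
  interpret GL: group "GL_int d" by (rule group_GL_int)
  interpret hom: group_hom ?F "GL_int d" \<tau>
    using assms by unfold_locales
  note hom.hom_mult [simp del] hom.hom_inv [simp del] hom.hom_one [simp del]
  have car: "\<tau> b \<in> carrier_mat d d" if "b \<in> carrier ?F" for b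
    using hom.hom_closed[OF that]
    by (simp add: GL_int_def units_of_def Units_def ring_mat_simps)
  have mult: "\<tau> (b \<otimes>\<^bsub>?F\<^esub> c) = \<tau> b * \<tau> c" if "b \<in> carrier ?F" "c \<in> carrier ?F" for b c
    using hom.hom_mult[OF that] by (simp add: GL_int_def units_of_def ring_mat_simps)
  have one: "\<tau> \<one>\<^bsub>?F\<^esub> = 1\<^sub>m d"
    using hom.hom_one by (simp add: GL_int_def units_of_def ring_mat_simps)
  have row: "row_mult u (\<tau> b) = transpose_mat (\<tau> b) *\<^sub>v u"
    if "b \<in> carrier ?F" "u \<in> carrier_vec d" for b u
    using that car[OF that(1)] by (intro row_mult_eq_transpose) auto
  have row_car: "row_mult u (\<tau> b) \<in> carrier_vec d" if "b \<in> carrier ?F" for b u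
    using car[OF that] by (auto simp: row_mult_def)
  have row_add: "row_mult (u + v) (\<tau> b) = row_mult u (\<tau> b) + row_mult v (\<tau> b)"
    if "b \<in> carrier ?F" "u \<in> carrier_vec d" "v \<in> carrier_vec d" for b u v
    using that car[OF that(1)] by (simp add: row mult_add_distrib_mat_vec[of _ d d])
  have row_row: "row_mult u (\<tau> (b \<otimes>\<^bsub>?F\<^esub> c)) = row_mult (row_mult u (\<tau> b)) (\<tau> c)"
    if "b \<in> carrier ?F" "c \<in> carrier ?F" "u \<in> carrier_vec d" for b c u
  proof -
    have "row_mult u (\<tau> (b \<otimes>\<^bsub>?F\<^esub> c)) = transpose_mat (\<tau> b * \<tau> c) *\<^sub>v u"
      using row[of "b \<otimes>\<^bsub>?F\<^esub> c" u] mult[of b c] that by simp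
    also have "\<dots> = transpose_mat (\<tau> c) *\<^sub>v (transpose_mat (\<tau> b) *\<^sub>v u)"
      using that car[of b] car[of c]
      by (simp add: transpose_mult[of _ d d _ d] assoc_mult_mat_vec[of _ d d _ d])
    also have "\<dots> = row_mult (row_mult u (\<tau> b)) (\<tau> c)"
      using that row_car[of b u] row[of b u] row[of c "row_mult u (\<tau> b)"] by simp
    finally show ?thesis .
  qed
  have row_one: "row_mult u (\<tau> \<one>\<^bsub>?F\<^esub>) = u" if "u \<in> carrier_vec d" for u
    using that row[of "\<one>\<^bsub>?F\<^esub>" u] one by simp
  have row_zero: "row_mult (0\<^sub>v d) (\<tau> b) = 0\<^sub>v d" if "b \<in> carrier ?F" for b
    using car[OF that] by (intro eq_vecI) (auto simp: row_mult_def)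
  show ?thesis
  proof (rule groupI)
    fix p assume "p \<in> carrier (lattice_by_free d n \<tau>)"
    then obtain b u where p: "p = (b, u)" "b \<in> carrier ?F" "u \<in> carrier_vec d"
      by (auto simp: lattice_by_free_def semidirect_def monoid_vec_simps)
    let ?q = "(inv\<^bsub>?F\<^esub> b, row_mult (- u) (\<tau> (inv\<^bsub>?F\<^esub> b)))"
    have "?q \<in> carrier (lattice_by_free d n \<tau>)"
      using p row_car
      by (simp add: lattice_by_free_def semidirect_def monoid_vec_simps)
    moreover have "?q \<otimes>\<^bsub>lattice_by_free d n \<tau>\<^esub> p = \<one>\<^bsub>lattice_by_free d n \<tau>\<^esub>"
      using p row_row[of "inv\<^bsub>?F\<^esub> b" b "- u"] row_one[of "- u"]
      by (simp add: lattice_by_free_def semidirect_def monoid_vec_simps uminus_l_inv_vec)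
    ultimately show "\<exists>q\<in>carrier (lattice_by_free d n \<tau>).
        q \<otimes>\<^bsub>lattice_by_free d n \<tau>\<^esub> p = \<one>\<^bsub>lattice_by_free d n \<tau>\<^esub>"
      by blast
  qed (auto simp: lattice_by_free_def semidirect_def monoid_vec_simps F.m_assoc
      row_car row_add row_row row_one row_zero assoc_add_vec[of _ d])
qed


section \<open>Presentations and Dehn functions\<close>

definition conjugate_set :: "('g, 'x) monoid_scheme \<Rightarrow> 'g set \<Rightarrow> 'g set" where
  "conjugate_set G R = {inv\<^bsub>G\<^esub> g \<otimes>\<^bsub>G\<^esub> r \<otimes>\<^bsub>G\<^esub> g | g r. g \<in> carrier G \<and> r \<in> R}"

definition normal_closure :: "('g, 'x) monoid_scheme \<Rightarrow> 'g set \<Rightarrow> 'g set" where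
  "normal_closure G R = generate G (conjugate_set G R)"

lemma (in group) normal_normal_closure:
  assumes "R \<subseteq> carrier G"
  shows "normal_closure G R \<lhd> G"
  unfolding normal_closure_def
proof (rule normal_generateI)
  show "conjugate_set G R \<subseteq> carrier G"
    using assms by (auto simp: conjugate_set_def)
next
  fix h x assume "h \<in> conjugate_set G R" and x: "x \<in> carrier G"
  then obtain g r where h: "h = inv g \<otimes> r \<otimes> g" "g \<in> carrier G" "r \<in> R"
    by (auto simp: conjugate_set_def)
  with assms x have "x \<otimes> h \<otimes> inv x = inv (g \<otimes> inv x) \<otimes> r \<otimes> (g \<otimes> inv x)"
    by (auto simp: inv_mult_group m_assoc subset_iff)
  with h x show "x \<otimes> h \<otimes> inv x \<in> conjugate_set G R"
    by (auto simp: conjugate_set_def)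
qed

text \<open>\<open>G\<close> is presented by \<open>\<langle>X | R\<rangle>\<close>, where both \<open>X\<close> and \<open>R\<close> are finite.\<close>

definition finite_presentation ::
  "('g, 'x) monoid_scheme \<Rightarrow> 'a set \<Rightarrow> 'a gword set \<Rightarrow> bool" where
  "finite_presentation G X R \<longleftrightarrow>
     finite X \<and> finite R \<and> R \<subseteq> carrier (free_group X) \<and>
     (free_group X Mod normal_closure (free_group X) R) \<cong> G"

definition null_word :: "'a set \<Rightarrow> 'a gword set \<Rightarrow> 'a gword \<Rightarrow> bool" where
  "null_word X R w \<longleftrightarrow>
     w \<in> words_over X \<and> reduce w \<in> normal_closure (free_group X) R"

definition word_area :: "'a set \<Rightarrow> 'a gword set \<Rightarrow> 'a gword \<Rightarrow> nat" where
  "word_area X R w = (LEAST N. \<exists>cs. length cs = N \<and>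
     set cs \<subseteq> conjugate_set (free_group X) (R \<union> m_inv (free_group X) ` R) \<and>
     reduce w = foldr (monoid.mult (free_group X)) cs \<one>\<^bsub>free_group X\<^esub>)"

definition Dehn_function :: "'a set \<Rightarrow> 'a gword set \<Rightarrow> nat \<Rightarrow> nat" where
  "Dehn_function X R m = Max {word_area X R w | w. null_word X R w \<and> length w \<le> m}"

definition subexponential :: "(nat \<Rightarrow> nat) \<Rightarrow> bool" where
  "subexponential \<delta> \<longleftrightarrow> (\<lambda>m. ln (1 + real (\<delta> m)) / real m) \<longlonglongrightarrow> 0"

text \<open>
  Dehn functions of different finite presentations of a group are equivalent, so requiring one
  of them to be subexponential is the same as requiring all of them to be. The generators may
  be taken to be natural numbers, since every finite set is in bijection with a set of these.
\<close>

definition has_subexponential_Dehn_function :: "('g, 'x) monoid_scheme \<Rightarrow> bool" where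
  "has_subexponential_Dehn_function G \<longleftrightarrow>
     (\<exists>(X :: nat set) R. finite_presentation G X R \<and> subexponential (Dehn_function X R))"


section \<open>Recursive functions\<close>

text \<open>
  Kleene's general recursive functions. A \<open>k\<close>-ary function is represented by a function on lists
  of which only the values at lists of length \<open>k\<close> matter. Minimisation is restricted to regular
  functions, so that all functions are total; by Kleene's normal form theorem this gives exactly
  the total computable functions.
\<close>

inductive recursive :: "nat \<Rightarrow> (nat list \<Rightarrow> nat) \<Rightarrow> bool" where
  rec_zero: "recursive k (\<lambda>_. 0)"
| rec_succ: "recursive 1 (\<lambda>xs. Suc (hd xs))"
| rec_proj: "i < k \<Longrightarrow> recursive k (\<lambda>xs. xs ! i)"
| rec_comp: "recursive (length gs) f \<Longrightarrow> \<forall>g\<in>set gs. recursive k g \<Longrightarrow>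
    recursive k (\<lambda>xs. f (map (\<lambda>g. g xs) gs))"
| rec_prim: "recursive k f \<Longrightarrow> recursive (Suc (Suc k)) g \<Longrightarrow>
    recursive (Suc k) (\<lambda>xs. rec_nat (f (tl xs)) (\<lambda>n r. g (n # r # tl xs)) (hd xs))"
| rec_mu: "recursive (Suc k) f \<Longrightarrow> (\<And>xs. length xs = k \<Longrightarrow> \<exists>n. f (n # xs) = 0) \<Longrightarrow>
    recursive k (\<lambda>xs. LEAST n. f (n # xs) = 0)"


section \<open>The conjugacy problem\<close>

definition conjugate_in :: "('g, 'x) monoid_scheme \<Rightarrow> 'g \<Rightarrow> 'g \<Rightarrow> bool" where
  "conjugate_in G x y \<longleftrightarrow> (\<exists>g\<in>carrier G. inv\<^bsub>G\<^esub> g \<otimes>\<^bsub>G\<^esub> x \<otimes>\<^bsub>G\<^esub> g = y)"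

text \<open>
  A finite generating set is given by a list enumerating it, so that words over it become words
  over the indices \<open>0, \<dots>, length gs - 1\<close>, which are coded by natural numbers.
\<close>

definition generating_list :: "('g, 'x) monoid_scheme \<Rightarrow> 'g list \<Rightarrow> bool" where
  "generating_list G gs \<longleftrightarrow> set gs \<subseteq> carrier G \<and> generate G (set gs) = carrier G"

definition word_value :: "('g, 'x) monoid_scheme \<Rightarrow> 'g list \<Rightarrow> nat gword \<Rightarrow> 'g" where
  "word_value G gs w =
     foldr (\<lambda>(i, e) g. (if e then gs ! i else inv\<^bsub>G\<^esub> (gs ! i)) \<otimes>\<^bsub>G\<^esub> g) w \<one>\<^bsub>G\<^esub>"

definition word_code :: "nat gword \<Rightarrow> nat" where
  "word_code w = list_encode (map (\<lambda>(i, e). prod_encode (i, of_bool e)) w)"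

definition decidable_conjugacy_problem_wrt :: "('g, 'x) monoid_scheme \<Rightarrow> 'g list \<Rightarrow> bool" where
  "decidable_conjugacy_problem_wrt G gs \<longleftrightarrow>
     (\<exists>f. recursive 2 f \<and>
       (\<forall>u\<in>words_over {..<length gs}. \<forall>v\<in>words_over {..<length gs}.
          f [word_code u, word_code v] =
            of_bool (conjugate_in G (word_value G gs u) (word_value G gs v))))"

definition decidable_conjugacy_problem :: "('g, 'x) monoid_scheme \<Rightarrow> bool" where
  "decidable_conjugacy_problem G \<longleftrightarrow>
     (\<exists>gs. generating_list G gs) \<and>
     (\<forall>gs. generating_list G gs \<longrightarrow> decidable_conjugacy_problem_wrt G gs)"

end

theory Submission
  imports
    Defs
    "HOL-Library.Function_Algebras"
    "Jordan_Normal_Form.Determinant"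
begin

text \<open>Write \<open>a\<^sup>h\<close> for the action of \<open>h\<close> through \<open>\<tau>\<close>.
  The elements \<open>(b, a)\<close> and \<open>(b', a')\<close> are conjugate iff some
  \<open>h\<close> and \<open>z\<close> satisfy \<open>b h = h b'\<close> and \<open>a\<^sup>h + z
  = z\<^sup>b\<^sup>' + a'\<close>. If \<open>b\<close> is not trivial, then the solutions
  \<open>h\<close> of the first equation are the products of powers of \<open>b\<close> with
  finitely many short words (\<open>short_conjugator\<close>); the powers of \<open>b\<close> do
  not matter, because \<open>(b, a)\<close> commutes with itself, and finitely many systems of
  linear equations over \<open>\<int>\<close> remain. If \<open>b\<close> is trivial, the question
  is whether \<open>a\<close> and \<open>a'\<close> lie in one orbit of the free group. This can
  be undecidable for a general \<open>\<tau>\<close>, and it is here that the Dehn function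
  enters.

  A subexponential Dehn function makes the matrices of \<open>\<tau>\<close> grow subexponentially
  in the length of the word (\<open>opnorm_subexponential\<close>). Geometrically, let
  \<open>p\<close> and \<open>q\<close> be vertices of the Cayley tree of the free group on
  different sides of an edge at the root, and take the commutator of a unit vector at
  \<open>p\<close> and a unit vector at \<open>q\<close>. Seen from the root these are vectors
  \<open>\<alpha>\<close> and \<open>\<beta>\<close>, the images of the unit vectors under the
  inverses of \<open>p\<close> and \<open>q\<close>. A van Kampen diagram for this word contains
  corridors dual to the edge, and these connect the corners of a parallelogram with sides
  \<open>\<alpha>\<close> and \<open>\<beta>\<close>, so that the area is at least about the
  length of the shorter one. In place of diagrams, the proof uses an antisymmetric function on the
  edges of the Cayley graph that is bounded on relators, wherever they are read, and large on the
  commutator (\<open>cost_le_area\<close>, \<open>parallelogram_bound\<close>).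

  Subexponential growth forces unipotence. If \<open>s\<^sub>1, \<dots>, s\<^sub>k\<close> act
  trivially modulo 3, then the product of the \<open>\<tau> s\<^sub>i - 1\<close> is divisible by
  \<open>3\<^sup>k\<close>; up to signs it is a sum of \<open>2\<^sup>k\<close> matrices of words,
  so for \<open>s\<^sub>i\<close> from a finite set its entries are smaller than
  \<open>3\<^sup>k\<close> once \<open>k\<close> is large, and it vanishes
  (\<open>differences_vanish\<close>). Thus the subgroup that acts trivially modulo 3, which has
  finite index and is finitely generated, preserves a filtration of the lattice and acts trivially
  on its factors.

  Orbits of such a group are closed in the congruence topology: a vector that is congruent to
  elements of an orbit for every modulus belongs to it (\<open>orbit_separable\<close>, by descent
  along the filtration). Hence elements that are conjugate modulo all \<open>m\<close> are
  conjugate (\<open>all_conj_mod_imp_conjugate\<close>). Conjugacy modulo \<open>m\<close> can be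
  decided by a bounded search (\<open>conjugate_imp_bounded_conj_mod\<close>). So a conjugator
  certifies conjugacy, a modulus certifies its failure, and the algorithm searches for either of
  them.\<close>

section \<open>Computable functions\<close>

text \<open>Only the values at lists of the right length are prescribed. This closes the class under all
  rewriting that is valid for such lists, which \<open>recursive\<close> itself is not.\<close>

definition computable :: "nat \<Rightarrow> (nat list \<Rightarrow> nat) \<Rightarrow> bool" where
  "computable k f \<longleftrightarrow> (\<exists>g. recursive k g \<and> (\<forall>xs. length xs = k \<longrightarrow> g xs = f xs))"

lemma computable_cong:
  assumes "computable k f" "\<And>xs. length xs = k \<Longrightarrow> f xs = g xs"
  shows "computable k g"
  using assms unfolding computable_def by metis

lemma recursive_computable: "recursive k f \<Longrightarrow> computable k f"
  unfolding computable_def by blast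

lemma computable_compose:
  assumes "computable (length gs) f" "\<And>g. g \<in> set gs \<Longrightarrow> computable k g"
  shows "computable k (\<lambda>xs. f (map (\<lambda>g. g xs) gs))"
proof -
  obtain f' where f': "recursive (length gs) f'" "\<And>xs. length xs = length gs \<Longrightarrow> f' xs = f xs"
    using assms(1) unfolding computable_def by blast
  have "\<forall>g\<in>set gs. \<exists>h. recursive k h \<and> (\<forall>xs. length xs = k \<longrightarrow> h xs = g xs)"
    using assms(2) unfolding computable_def by blast
  then obtain c where c: "\<And>g. g \<in> set gs \<Longrightarrow> recursive k (c g)"
    "\<And>g xs. g \<in> set gs \<Longrightarrow> length xs = k \<Longrightarrow> c g xs = g xs"
    by metis
  have "recursive k (\<lambda>xs. f' (map (\<lambda>g. g xs) (map c gs)))"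
    using f'(1) c(1) by (intro rec_comp) auto
  moreover have "f' (map (\<lambda>g. g xs) (map c gs)) = f (map (\<lambda>g. g xs) gs)" if "length xs = k" for xs
  proof -
    have "map (\<lambda>g. g xs) (map c gs) = map (\<lambda>g. g xs) gs"
      using c(2) that by simp
    then show ?thesis by (simp only: f'(2) length_map)
  qed
  ultimately show ?thesis unfolding computable_def by blast
qed

lemma computable_nth: "i < k \<Longrightarrow> computable k (\<lambda>xs. xs ! i)"
  by (intro recursive_computable rec_proj)

lemma computable_tl:
  assumes "computable k f"
  shows "computable (Suc k) (\<lambda>ys. f (tl ys))"
proof -
  let ?gs = "map (\<lambda>i ys. ys ! Suc i) [0..<k]"
  have "computable (Suc k) (\<lambda>ys. f (map (\<lambda>g. g ys) ?gs))"
    using assms by (intro computable_compose) (auto intro: computable_nth)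
  then show ?thesis
  proof (rule computable_cong)
    fix ys :: "nat list" assume "length ys = Suc k"
    then have "map (\<lambda>g. g ys) ?gs = tl ys"
      by (intro nth_equalityI) (auto simp: nth_tl)
    then show "f (map (\<lambda>g. g ys) ?gs) = f (tl ys)" by simp
  qed
qed

lemma computable_nth_tl: "Suc i < k \<Longrightarrow> computable k (\<lambda>ys. tl ys ! i)"
  using computable_tl[OF computable_nth, of i "k - 1"] by simp

lemma computable_nth_tl_tl: "Suc (Suc i) < k \<Longrightarrow> computable k (\<lambda>ys. tl (tl ys) ! i)"
  using computable_tl[OF computable_nth_tl, of i "k - 1"] by simp

lemma computable_Cons:
  assumes "computable (Suc k) f" "computable k g"
  shows "computable k (\<lambda>xs. f (g xs # xs))"
proof -
  let ?gs = "g # map (\<lambda>i ys. ys ! i) [0..<k]"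
  have "computable k (\<lambda>ys. f (map (\<lambda>g. g ys) ?gs))"
    using assms by (intro computable_compose) (auto intro: computable_nth)
  then show ?thesis
  proof (rule computable_cong)
    fix ys :: "nat list" assume "length ys = k"
    then have "map (\<lambda>g. g ys) ?gs = g ys # ys"
      by (auto intro!: nth_equalityI)
    then show "f (map (\<lambda>g. g ys) ?gs) = f (g ys # ys)" by (metis (no_types))
  qed
qed

lemma computable_zero: "computable k (\<lambda>_. 0)"
  by (intro recursive_computable rec_zero)

lemma computable_Suc: "computable k f \<Longrightarrow> computable k (\<lambda>xs. Suc (f xs))"
  using computable_compose[of "[f]" "\<lambda>xs. Suc (hd xs)" k] recursive_computable[OF rec_succ]
  by simp

lemma computable_const: "computable k (\<lambda>_. c)"
  by (induction c) (auto intro: computable_zero computable_Suc)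

text \<open>The parameters of the recursion come last in the argument list, after the counter and the
  previous value, whence the double tail.\<close>

lemma computable_rec:
  assumes N: "computable k N" and f: "computable k f"
    and g: "computable (Suc (Suc k)) (\<lambda>ys. g (ys ! 0) (ys ! 1) (tl (tl ys)))"
  shows "computable k (\<lambda>xs. rec_nat (f xs) (\<lambda>i r. g i r xs) (N xs))"
proof -
  obtain f' where f': "recursive k f'" "\<And>xs. length xs = k \<Longrightarrow> f' xs = f xs"
    using f unfolding computable_def by blast
  obtain g' where g': "recursive (Suc (Suc k)) g'"
    "\<And>i r xs. length xs = k \<Longrightarrow> g' (i # r # xs) = g i r xs"
    using g unfolding computable_def by force
  have "computable (Suc k) (\<lambda>xs. rec_nat (f' (tl xs)) (\<lambda>n r. g' (n # r # tl xs)) (hd xs))"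
    by (intro recursive_computable rec_prim f' g')
  then have "computable (Suc k) (\<lambda>xs. rec_nat (f (tl xs)) (\<lambda>n r. g n r (tl xs)) (hd xs))"
    by (rule computable_cong) (simp add: f' g')
  from computable_Cons[OF this N] show ?thesis by simp
qed

lemma computable_mu:
  assumes f: "computable (Suc k) (\<lambda>ys. f (ys ! 0) (tl ys))"
    and ex: "\<And>xs. length xs = k \<Longrightarrow> \<exists>n. f n xs = 0"
  shows "computable k (\<lambda>xs. LEAST n. f n xs = 0)"
proof -
  obtain f' where f': "recursive (Suc k) f'" "\<And>n xs. length xs = k \<Longrightarrow> f' (n # xs) = f n xs"
    using f unfolding computable_def by force
  have "computable k (\<lambda>xs. LEAST n. f' (n # xs) = 0)"
    by (intro recursive_computable rec_mu f') (simp add: f' ex)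
  then show ?thesis
    by (rule computable_cong) (simp add: f')
qed

subsection \<open>Arithmetic\<close>

lemma computable_add:
  assumes "computable k f" "computable k g"
  shows "computable k (\<lambda>xs. f xs + g xs)"
proof -
  have "rec_nat m (\<lambda>i r. Suc r) n = m + n" for m n :: nat by (induction n) auto
  then show ?thesis
    using computable_rec[OF assms(2,1), of "\<lambda>i r xs. Suc r"]
    by (simp add: computable_Suc computable_nth)
qed

lemma computable_mult:
  assumes "computable k f" "computable k g"
  shows "computable k (\<lambda>xs. f xs * g xs)"
proof -
  have "rec_nat 0 (\<lambda>i r. r + m) n = m * n" for m n :: nat by (induction n) auto
  moreover have "computable k (\<lambda>xs. rec_nat 0 (\<lambda>i r. r + f xs) (g xs))"
    by (intro computable_rec assms computable_zero computable_add computable_nth computable_tl) auto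
  ultimately show ?thesis by simp
qed

lemma computable_power:
  assumes "computable k f" "computable k g"
  shows "computable k (\<lambda>xs. f xs ^ g xs)"
proof -
  have "rec_nat 1 (\<lambda>i r. r * m) n = m ^ n" for m n :: nat by (induction n) auto
  moreover have "computable k (\<lambda>xs. rec_nat 1 (\<lambda>i r. r * f xs) (g xs))"
    by (intro computable_rec assms computable_const computable_mult computable_nth computable_tl) auto
  ultimately show ?thesis by simp
qed

lemma computable_pred:
  assumes "computable k f"
  shows "computable k (\<lambda>xs. f xs - 1)"
proof -
  have "rec_nat 0 (\<lambda>i r. i) n = n - 1" for n :: nat by (induction n) auto
  moreover have "computable k (\<lambda>xs. rec_nat 0 (\<lambda>i r. i) (f xs))"
    by (intro computable_rec assms computable_zero computable_nth) auto
  ultimately show ?thesis by simp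
qed

lemma computable_diff:
  assumes "computable k f" "computable k g"
  shows "computable k (\<lambda>xs. f xs - g xs)"
proof -
  have "rec_nat m (\<lambda>i r. r - 1) n = m - n" for m n :: nat by (induction n) auto
  moreover have "computable k (\<lambda>xs. rec_nat (f xs) (\<lambda>i r. r - 1) (g xs))"
    by (intro computable_rec assms computable_pred computable_nth) auto
  ultimately show ?thesis by simp
qed

lemma computable_if:
  assumes "computable k (\<lambda>xs. of_bool (P xs))" "computable k f" "computable k g"
  shows "computable k (\<lambda>xs. if P xs then f xs else g xs)"
proof -
  have "computable k (\<lambda>xs. of_bool (P xs) * f xs + (1 - of_bool (P xs)) * g xs)"
    by (intro computable_add computable_mult computable_diff computable_const assms)
  then show ?thesis by (rule computable_cong) simp
qed

abbreviation decidable :: "nat \<Rightarrow> (nat list \<Rightarrow> bool) \<Rightarrow> bool" where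
  "decidable k P \<equiv> computable k (\<lambda>xs. of_bool (P xs))"

lemma decidable_cong:
  assumes "decidable k P" "\<And>xs. length xs = k \<Longrightarrow> P xs = Q xs"
  shows "decidable k Q"
  using assms(1) by (rule computable_cong) (simp add: assms(2))

lemma decidable_not: "decidable k P \<Longrightarrow> decidable k (\<lambda>xs. \<not> P xs)"
  by (rule computable_cong[OF computable_diff[OF computable_const[of k 1]]]) auto

lemma decidable_conj: "decidable k P \<Longrightarrow> decidable k Q \<Longrightarrow> decidable k (\<lambda>xs. P xs \<and> Q xs)"
  using computable_mult[of k "\<lambda>xs. of_bool (P xs)" "\<lambda>xs. of_bool (Q xs)"]
  by (simp only: of_bool_conj)

lemma decidable_disj: "decidable k P \<Longrightarrow> decidable k Q \<Longrightarrow> decidable k (\<lambda>xs. P xs \<or> Q xs)"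
  using decidable_not[OF decidable_conj[OF decidable_not decidable_not]] by simp

lemma decidable_le:
  assumes "computable k f" "computable k g"
  shows "decidable k (\<lambda>xs. f xs \<le> g xs)"
  by (rule computable_cong[OF computable_diff[OF computable_const[of k 1]
      computable_diff[OF assms]]]) auto

lemma decidable_less:
  "computable k f \<Longrightarrow> computable k g \<Longrightarrow> decidable k (\<lambda>xs. f xs < g xs)"
  using decidable_le[OF computable_Suc] by (simp add: Suc_le_eq)

lemma decidable_eq:
  "computable k f \<Longrightarrow> computable k g \<Longrightarrow> decidable k (\<lambda>xs. f xs = g xs)"
  using decidable_conj[OF decidable_le decidable_le, of k f g g f] by (simp add: eq_iff)

lemma decidable_ball:
  assumes N: "computable k N" and P: "decidable (Suc k) (\<lambda>ys. P (ys ! 0) (tl ys))"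
  shows "decidable k (\<lambda>xs. \<forall>i<N xs. P i xs)"
proof -
  have *: "rec_nat 1 (\<lambda>i r. r * of_bool (Q i)) n = (of_bool (\<forall>i<n. Q i) :: nat)" for Q n
    by (induction n) (auto simp: less_Suc_eq)
  have "computable (Suc (Suc k)) (\<lambda>ys. of_bool (P (ys ! 0) (tl (tl ys))))"
  proof -
    let ?gs = "(\<lambda>ys. ys ! 0) # map (\<lambda>i ys. ys ! Suc (Suc i)) [0..<k]"
    have "computable (Suc (Suc k)) (\<lambda>ys. (\<lambda>zs. of_bool (P (zs ! 0) (tl zs))) (map (\<lambda>g. g ys) ?gs))"
      using P by (intro computable_compose) (auto intro: computable_nth)
    then show ?thesis
    proof (rule computable_cong)
      fix ys :: "nat list" assume "length ys = Suc (Suc k)"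
      then have "map (\<lambda>g. g ys) ?gs = ys ! 0 # tl (tl ys)"
        by (auto intro!: nth_equalityI simp: nth_tl)
      then have "(\<lambda>zs. of_bool (P (zs ! 0) (tl zs)) :: nat) (map (\<lambda>g. g ys) ?gs) =
        (\<lambda>zs. of_bool (P (zs ! 0) (tl zs))) (ys ! 0 # tl (tl ys))" by (rule arg_cong)
      then show "(\<lambda>zs. of_bool (P (zs ! 0) (tl zs)) :: nat) (map (\<lambda>g. g ys) ?gs) =
        of_bool (P (ys ! 0) (tl (tl ys)))" by simp
    qed
  qed
  then have "computable k (\<lambda>xs. rec_nat 1 (\<lambda>i r. r * of_bool (P i xs)) (N xs))"
    by (intro computable_rec N computable_const computable_mult computable_nth) auto
  then show ?thesis by (simp only: *)
qed

lemma decidable_bex: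
  assumes N: "computable k N" and P: "decidable (Suc k) (\<lambda>ys. P (ys ! 0) (tl ys))"
  shows "decidable k (\<lambda>xs. \<exists>i<N xs. P i xs)"
  using decidable_not[OF decidable_ball[OF N decidable_not[OF P]]] by simp

lemma computable_Least:
  assumes P: "decidable (Suc k) (\<lambda>ys. P (ys ! 0) (tl ys))"
    and ex: "\<And>xs. length xs = k \<Longrightarrow> \<exists>n. P n xs"
  shows "computable k (\<lambda>xs. LEAST n. P n xs)"
  using computable_mu[of k "\<lambda>n xs. of_bool (\<not> P n xs)", OF decidable_not[OF P]] ex by simp

lemma decidable_dvd:
  assumes "computable k f" "computable k g"
  shows "decidable k (\<lambda>xs. f xs dvd g xs)"
proof -
  have "decidable k (\<lambda>xs. \<exists>i<Suc (g xs). i * f xs = g xs)"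
    by (intro decidable_bex computable_Suc assms decidable_eq computable_mult computable_nth
        computable_tl) auto
  then show ?thesis
  proof (rule decidable_cong)
    fix xs :: "nat list"
    show "(\<exists>i<Suc (g xs). i * f xs = g xs) \<longleftrightarrow> f xs dvd g xs"
    proof
      assume dvd: "f xs dvd g xs"
      then have "(g xs div f xs) * f xs = g xs" by simp
      moreover have "g xs div f xs < Suc (g xs)" by (simp add: less_Suc_eq_le)
      ultimately show "\<exists>i<Suc (g xs). i * f xs = g xs" by blast
    qed (metis dvd_triv_right)
  qed
qed

subsection \<open>Pairs and lists\<close>

lemma computable_triangle:
  assumes "computable k f"
  shows "computable k (\<lambda>xs. triangle (f xs))"
proof -
  have "rec_nat 0 (\<lambda>i r. r + Suc i) n = triangle n" for n :: nat by (induction n) auto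
  moreover have "computable k (\<lambda>xs. rec_nat 0 (\<lambda>i r. r + Suc i) (f xs))"
    by (intro computable_rec assms computable_zero computable_add computable_Suc computable_nth) auto
  ultimately show ?thesis by simp
qed

lemma computable_prod_encode:
  "computable k f \<Longrightarrow> computable k g \<Longrightarrow> computable k (\<lambda>xs. prod_encode (f xs, g xs))"
  unfolding prod_encode_def by (simp add: computable_add computable_triangle)

lemma computable_fst:
  assumes "computable k f"
  shows "computable k (\<lambda>xs. fst (prod_decode (f xs)))"
proof -
  have "computable k (\<lambda>xs. LEAST m. \<exists>n<Suc (f xs). prod_encode (m, n) = f xs)"
  proof (rule computable_Least)
    show "decidable (Suc k) (\<lambda>ys. \<exists>n<Suc (f (tl ys)). prod_encode (ys ! 0, n) = f (tl ys))"
      by (intro decidable_bex computable_Suc computable_tl assms decidable_eq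
          computable_prod_encode computable_nth computable_nth_tl) auto
    fix xs :: "nat list"
    obtain m n where "prod_encode (m, n) = f xs" by (metis prod_decode_inverse surj_pair)
    then show "\<exists>m. \<exists>n<Suc (f xs). prod_encode (m, n) = f xs"
      by (metis le_imp_less_Suc le_prod_encode_2)
  qed
  then show ?thesis
  proof (rule computable_cong)
    fix xs :: "nat list"
    obtain m n where mn: "f xs = prod_encode (m, n)" by (metis prod_decode_inverse surj_pair)
    have "n < Suc (prod_encode (m, n))" by (metis le_imp_less_Suc le_prod_encode_2)
    then have "(LEAST m'. \<exists>n'<Suc (prod_encode (m, n)). prod_encode (m', n') = prod_encode (m, n)) = m"
      by (intro Least_equality) auto
    then show "(LEAST m. \<exists>n<Suc (f xs). prod_encode (m, n) = f xs) = fst (prod_decode (f xs))"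
      unfolding mn by simp
  qed
qed

lemma computable_snd:
  assumes "computable k f"
  shows "computable k (\<lambda>xs. snd (prod_decode (f xs)))"
proof -
  have "computable k (\<lambda>xs. LEAST n. prod_encode (fst (prod_decode (f xs)), n) = f xs)"
  proof (rule computable_Least)
    show "decidable (Suc k) (\<lambda>ys. prod_encode (fst (prod_decode (f (tl ys))), ys ! 0) = f (tl ys))"
      by (intro decidable_eq computable_prod_encode computable_fst computable_nth
          computable_tl assms) auto
    fix xs :: "nat list"
    show "\<exists>n. prod_encode (fst (prod_decode (f xs)), n) = f xs"
      by (metis prod.collapse prod_decode_inverse)
  qed
  then show ?thesis
  proof (rule computable_cong)
    fix xs :: "nat list"
    have "prod_encode (fst (prod_decode (f xs)), n) = f xs \<longleftrightarrow> n = snd (prod_decode (f xs))" for n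
      by (metis prod.collapse prod_decode_inverse prod_encode_eq prod.inject)
    then show "(LEAST n. prod_encode (fst (prod_decode (f xs)), n) = f xs) = snd (prod_decode (f xs))"
      by (intro Least_equality) auto
  qed
qed

definition code_head :: "nat \<Rightarrow> nat" where
  "code_head c = fst (prod_decode (c - 1))"

text \<open>The tail of the code of the empty list is that code again, so that iterated tails stay at the
  end of a list.\<close>

definition code_tail :: "nat \<Rightarrow> nat" where
  "code_tail c = (if c = 0 then 0 else snd (prod_decode (c - 1)))"

lemma code_head_list_encode [simp]: "code_head (list_encode (x # xs)) = x"
  by (simp add: code_head_def)

lemma code_tail_list_encode [simp]: "code_tail (list_encode xs) = list_encode (tl xs)"
  by (cases xs) (simp_all add: code_tail_def)

lemma computable_code_head: "computable k f \<Longrightarrow> computable k (\<lambda>xs. code_head (f xs))"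
  unfolding code_head_def by (intro computable_fst computable_pred)

lemma computable_code_tail: "computable k f \<Longrightarrow> computable k (\<lambda>xs. code_tail (f xs))"
  unfolding code_tail_def
  by (intro computable_if computable_snd computable_pred decidable_eq computable_const)

lemma length_le_list_encode: "length xs \<le> list_encode xs"
proof (induction xs)
  case (Cons x xs)
  then show ?case using le_prod_encode_2[of "list_encode xs" x] by simp
qed simp

lemma computable_code_nth:
  assumes "computable k f"
  shows "computable k (\<lambda>xs. code_head ((code_tail ^^ i) (f xs)))"
proof (rule computable_code_head)
  show "computable k (\<lambda>xs. (code_tail ^^ i) (f xs))"
    by (induction i) (auto intro: assms computable_code_tail)
qed

lemma code_nth_list_encode:
  "i < length xs \<Longrightarrow> code_head ((code_tail ^^ i) (list_encode xs)) = xs ! i"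
proof -
  have "(code_tail ^^ i) (list_encode xs) = list_encode (drop i xs)" for i
    by (induction i) (auto simp: drop_Suc tl_drop)
  then show "i < length xs \<Longrightarrow> ?thesis"
    by (metis Cons_nth_drop_Suc code_head_list_encode)
qed

lemma computable_list_encode:
  assumes "\<And>f. f \<in> set fs \<Longrightarrow> computable k f"
  shows "computable k (\<lambda>xs. list_encode (map (\<lambda>f. f xs) fs))"
  using assms
  by (induction fs) (simp_all add: computable_const computable_Suc computable_prod_encode)

lemma computable_apply:
  assumes "computable 1 (\<lambda>xs. F (xs ! 0))" "computable k f"
  shows "computable k (\<lambda>xs. F (f xs))"
  using computable_compose[of "[f]" "\<lambda>xs. F (xs ! 0)" k] assms by simp

lemma computable_apply2:
  assumes "computable 2 (\<lambda>xs. F (xs ! 0) (xs ! 1))" "computable k f" "computable k g"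
  shows "computable k (\<lambda>xs. F (f xs) (g xs))"
proof -
  have "computable k (\<lambda>xs. (\<lambda>ys. F (ys ! 0) (ys ! 1)) (map (\<lambda>g. g xs) [f, g]))"
    using assms by (intro computable_compose) (auto simp: numeral_2_eq_2)
  then show ?thesis by simp
qed

text \<open>A fold over a coded list is an iteration on the pair of the unread part of the list and the
  accumulator. The code bounds the length, hence serves as the number of steps.\<close>

lemma computable_foldl:
  assumes F: "computable 2 (\<lambda>xs. F (xs ! 0) (xs ! 1))"
  shows "computable 2 (\<lambda>xs. foldl F (xs ! 0) (list_decode (xs ! 1)))"
proof -
  define st where "st z = (let r = fst (prod_decode z); s = snd (prod_decode z) in
    if r = 0 then z else prod_encode (code_tail r, F s (code_head r)))" for z
  have st: "computable 1 (\<lambda>xs. st (xs ! 0))"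
    unfolding st_def Let_def
    by (intro computable_if decidable_eq computable_prod_encode computable_code_tail
        computable_code_head computable_fst computable_snd computable_nth computable_zero
        computable_apply2[OF F]) auto
  have it: "rec_nat (prod_encode (list_encode l, s)) (\<lambda>_. st) i =
      prod_encode (list_encode (drop i l), foldl F s (take i l))" for l s i
  proof (induction i arbitrary: l s)
    case (Suc i)
    have *: "rec_nat (prod_encode (list_encode [], s)) (\<lambda>_. st) i = prod_encode (0, s)" for i s
      by (induction i) (simp_all add: st_def)
    have sh: "rec_nat z (\<lambda>_. st) (Suc i) = rec_nat (st z) (\<lambda>_. st) i" for z
      by (induction i) simp_all
    show ?case
    proof (cases l)
      case Nil
      then show ?thesis using *[of s "Suc i"] by simp
    next
      case (Cons x l')
      have "st (prod_encode (list_encode l, s)) = prod_encode (list_encode l', F s x)"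
        by (simp only: st_def Cons prod_encode_inverse Let_def fst_conv snd_conv
            code_tail_list_encode code_head_list_encode list.sel) simp
      then show ?thesis unfolding sh using Suc[of l' "F s x"] Cons by simp
    qed
  qed simp
  have "computable 2 (\<lambda>xs. snd (prod_decode
      (rec_nat (prod_encode (xs ! 1, xs ! 0)) (\<lambda>_ r. st r) (xs ! 1))))"
    by (intro computable_snd computable_rec computable_prod_encode computable_nth
        computable_apply[OF st]) auto
  then show ?thesis
  proof (rule computable_cong)
    fix xs :: "nat list"
    have "length (list_decode (xs ! 1)) \<le> xs ! 1"
      by (metis length_le_list_encode list_decode_inverse)
    then show "snd (prod_decode (rec_nat (prod_encode (xs ! 1, xs ! 0)) (\<lambda>_. st) (xs ! 1))) =
        foldl F (xs ! 0) (list_decode (xs ! 1))"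
      using it[of "list_decode (xs ! 1)" "xs ! 0" "xs ! 1"] by simp
  qed
qed

text \<open>The least upper bound for the codes of the lists of length at most \<open>l\<close> with entries
  at most \<open>c\<close>.\<close>

definition code_bound :: "nat \<Rightarrow> nat \<Rightarrow> nat" where
  "code_bound c l = rec_nat 0 (\<lambda>_ r. Suc (prod_encode (c, r))) l"

lemma computable_code_bound: "computable k f \<Longrightarrow> computable k (\<lambda>xs. code_bound c (f xs))"
  unfolding code_bound_def
  by (intro computable_rec computable_zero computable_Suc computable_prod_encode computable_const
      computable_nth) auto

lemma prod_encode_mono: "m \<le> m' \<Longrightarrow> n \<le> n' \<Longrightarrow> prod_encode (m, n) \<le> prod_encode (m', n')"
proof -
  have "mono triangle"
    unfolding triangle_def by (intro monoI div_le_mono mult_le_mono) auto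
  then show "m \<le> m' \<Longrightarrow> n \<le> n' \<Longrightarrow> ?thesis"
    unfolding prod_encode_def by (simp add: add_mono monoD)
qed

lemma list_encode_le_code_bound:
  "length xs \<le> l \<Longrightarrow> set xs \<subseteq> {..c} \<Longrightarrow> list_encode xs \<le> code_bound c l"
proof (induction xs arbitrary: l)
  case (Cons x xs)
  then obtain l' where "l = Suc l'" by (cases l) auto
  with Cons show ?case
    by (auto simp: code_bound_def intro!: prod_encode_mono)
qed simp

subsection \<open>Integers\<close>

text \<open>Differences of computable functions, so that integer arithmetic needs no case distinction on
  signs; the coding of integers by natural numbers enters only at the interfaces.\<close>

definition int_computable :: "nat \<Rightarrow> (nat list \<Rightarrow> int) \<Rightarrow> bool" where
  "int_computable k F \<longleftrightarrow>
     (\<exists>p q. computable k p \<and> computable k q \<and> (\<forall>xs. F xs = int (p xs) - int (q xs)))"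

lemma int_computableI:
  "computable k p \<Longrightarrow> computable k q \<Longrightarrow> (\<And>xs. F xs = int (p xs) - int (q xs)) \<Longrightarrow> int_computable k F"
  unfolding int_computable_def by blast

lemma int_computable_const: "int_computable k (\<lambda>_. c)"
  by (rule int_computableI[OF computable_const[of k "nat c"] computable_const[of k "nat (- c)"]]) auto

lemma int_computable_add:
  assumes "int_computable k F" "int_computable k G"
  shows "int_computable k (\<lambda>xs. F xs + G xs)"
proof -
  obtain p q p' q' where "computable k p" "computable k q" "\<And>xs. F xs = int (p xs) - int (q xs)"
    "computable k p'" "computable k q'" "\<And>xs. G xs = int (p' xs) - int (q' xs)"
    using assms unfolding int_computable_def by metis
  then show ?thesis
    by (intro int_computableI[of k "\<lambda>xs. p xs + p' xs" "\<lambda>xs. q xs + q' xs"]) (auto intro: computable_add)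
qed

lemma int_computable_minus:
  assumes "int_computable k F"
  shows "int_computable k (\<lambda>xs. - F xs)"
  using assms unfolding int_computable_def by (metis minus_diff_eq)

lemma int_computable_diff:
  "int_computable k F \<Longrightarrow> int_computable k G \<Longrightarrow> int_computable k (\<lambda>xs. F xs - G xs)"
  using int_computable_add[OF _ int_computable_minus, of k F G] by simp

lemma int_computable_mult:
  assumes "int_computable k F" "int_computable k G"
  shows "int_computable k (\<lambda>xs. F xs * G xs)"
proof -
  obtain p q p' q' where "computable k p" "computable k q" "\<And>xs. F xs = int (p xs) - int (q xs)"
    "computable k p'" "computable k q'" "\<And>xs. G xs = int (p' xs) - int (q' xs)"
    using assms unfolding int_computable_def by metis
  note pq = this
  have "F xs * G xs = int (p xs * p' xs + q xs * q' xs) - int (p xs * q' xs + q xs * p' xs)" for xs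
    unfolding pq by (simp add: left_diff_distrib right_diff_distrib)
  then show ?thesis
    by (intro int_computableI[of k "\<lambda>xs. p xs * p' xs + q xs * q' xs"
          "\<lambda>xs. p xs * q' xs + q xs * p' xs"])
      (auto intro!: computable_add computable_mult pq)
qed

lemma int_computable_sum:
  "finite A \<Longrightarrow> (\<And>i. i \<in> A \<Longrightarrow> int_computable k (F i)) \<Longrightarrow> int_computable k (\<lambda>xs. \<Sum>i\<in>A. F i xs)"
  by (induction A rule: finite_induct) (auto intro: int_computable_const int_computable_add)

lemma int_computable_int: "computable k f \<Longrightarrow> int_computable k (\<lambda>xs. int (f xs))"
  by (rule int_computableI[OF _ computable_const[of k 0]]) auto

lemma computable_nat_abs:
  assumes "int_computable k F"
  shows "computable k (\<lambda>xs. nat \<bar>F xs\<bar>)"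
proof -
  obtain p q where pq: "computable k p" "computable k q" "\<And>xs. F xs = int (p xs) - int (q xs)"
    using assms unfolding int_computable_def by metis
  have "computable k (\<lambda>xs. (p xs - q xs) + (q xs - p xs))"
    by (intro computable_add computable_diff pq)
  then show ?thesis by (rule computable_cong) (auto simp: pq)
qed

lemma decidable_nonneg:
  assumes "int_computable k F"
  shows "decidable k (\<lambda>xs. 0 \<le> F xs)"
proof -
  obtain p q where pq: "computable k p" "computable k q" "\<And>xs. F xs = int (p xs) - int (q xs)"
    using assms unfolding int_computable_def by metis
  from decidable_le[OF pq(2,1)] show ?thesis by (rule decidable_cong) (auto simp: pq)
qed

lemma decidable_int_dvd:
  assumes "computable k f" "int_computable k F"
  shows "decidable k (\<lambda>xs. int (f xs) dvd F xs)"
  using decidable_dvd[OF assms(1) computable_nat_abs[OF assms(2)]]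
  by (simp add: nat_abs_dvd_iff[symmetric] int_dvd_int_iff[symmetric])

lemma computable_int_encode:
  assumes "int_computable k F"
  shows "computable k (\<lambda>xs. int_encode (F xs))"
proof -
  have "computable k (\<lambda>xs. if 0 \<le> F xs then 2 * nat \<bar>F xs\<bar> else 2 * (nat \<bar>F xs\<bar> - 1) + 1)"
    by (intro computable_if decidable_nonneg computable_mult computable_const computable_add
        computable_diff computable_nat_abs assms)
  then show ?thesis
    by (rule computable_cong) (auto simp: int_encode_def sum_encode_def nat_diff_distrib)
qed

lemma int_computable_int_decode:
  assumes f: "computable k f"
  shows "int_computable k (\<lambda>xs. int_decode (f xs))"
proof -
  define h where "h = (\<lambda>xs. LEAST i. f xs < 2 * Suc i)"
  have h: "computable k h" unfolding h_def
  proof (rule computable_Least)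
    show "decidable (Suc k) (\<lambda>ys. f (tl ys) < 2 * Suc (ys ! 0))"
      by (intro decidable_less computable_mult computable_const computable_Suc computable_nth
          computable_tl f) auto
    show "\<exists>n. f xs < 2 * Suc n" for xs by (rule exI[of _ "f xs"]) simp
  qed
  have h_eq: "h xs = f xs div 2" for xs
    unfolding h_def by (rule Least_equality) auto
  have "decidable k (\<lambda>xs. 2 dvd f xs)" by (intro decidable_dvd computable_const f)
  then have "int_computable k (\<lambda>xs. int (if 2 dvd f xs then h xs else 0) -
      int (if 2 dvd f xs then 0 else Suc (h xs)))"
    by (intro int_computable_diff int_computable_int computable_if computable_const
        computable_Suc h)
  moreover have "int_decode (f xs) = int (if 2 dvd f xs then h xs else 0) -
      int (if 2 dvd f xs then 0 else Suc (h xs))" for xs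
    by (simp add: int_decode_def sum_decode_def h_eq)
  ultimately show ?thesis by simp
qed

section \<open>Congruences in the lattice\<close>

text \<open>Vectors are functions that vanish beyond the dimension rather than elements of the type
  \<open>vec\<close>: these form a group as a type, and rules of algebra apply without side
  conditions.\<close>

definition integer_vectors :: "nat \<Rightarrow> (nat \<Rightarrow> int) set" where
  "integer_vectors d = {v. \<forall>i\<ge>d. v i = 0}"

definition vcong :: "int \<Rightarrow> (nat \<Rightarrow> int) \<Rightarrow> (nat \<Rightarrow> int) \<Rightarrow> bool" where
  "vcong m u v \<longleftrightarrow> (\<forall>i. m dvd u i - v i)"

definition additive_subgroup :: "(nat \<Rightarrow> int) set \<Rightarrow> bool" where
  "additive_subgroup H \<longleftrightarrow> 0 \<in> H \<and> (\<forall>u\<in>H. \<forall>v\<in>H. u - v \<in> H)"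

lemma vcong_refl [simp]: "vcong m u u"
  by (simp add: vcong_def)

lemma vcong_sym: "vcong m u v \<Longrightarrow> vcong m v u"
  unfolding vcong_def by (metis dvd_minus_iff minus_diff_eq)

lemma vcong_trans: "vcong m u v \<Longrightarrow> vcong m v w \<Longrightarrow> vcong m u w"
  unfolding vcong_def by (metis diff_add_cancel add_diff_eq dvd_add)

lemma vcong_add: "vcong m u v \<Longrightarrow> vcong m u' v' \<Longrightarrow> vcong m (u + u') (v + v')"
  unfolding vcong_def by (simp add: add_diff_add)

lemma vcong_diff: "vcong m u v \<Longrightarrow> vcong m u' v' \<Longrightarrow> vcong m (u - u') (v - v')"
proof -
  assume *: "vcong m u v" "vcong m u' v'"
  have "(u - u') i - (v - v') i = (u i - v i) - (u' i - v' i)" for i by simp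
  then show ?thesis using * unfolding vcong_def by (metis dvd_diff)
qed

lemma vcong_dvd: "m dvd m' \<Longrightarrow> vcong m' u v \<Longrightarrow> vcong m u v"
  unfolding vcong_def using dvd_trans by blast

lemma vcong_diff_0: "vcong m (u - v) 0 \<longleftrightarrow> vcong m u v"
  by (simp add: vcong_def)

lemma additive_subgroup_integer_vectors: "additive_subgroup (integer_vectors d)"
  by (auto simp: additive_subgroup_def integer_vectors_def)

lemma additive_subgroup_zero: "additive_subgroup H \<Longrightarrow> 0 \<in> H"
  and additive_subgroup_diff: "additive_subgroup H \<Longrightarrow> u \<in> H \<Longrightarrow> v \<in> H \<Longrightarrow> u - v \<in> H"
  by (auto simp: additive_subgroup_def)

lemma additive_subgroup_minus: "additive_subgroup H \<Longrightarrow> v \<in> H \<Longrightarrow> - v \<in> H"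
  using additive_subgroup_diff[of H 0 v] additive_subgroup_zero[of H] by simp

lemma additive_subgroup_add: "additive_subgroup H \<Longrightarrow> u \<in> H \<Longrightarrow> v \<in> H \<Longrightarrow> u + v \<in> H"
  using additive_subgroup_diff[of H u "- v"] additive_subgroup_minus[of H v] by simp

lemma additive_subgroup_scale:
  assumes H: "additive_subgroup H" "v \<in> H"
  shows "(\<lambda>i. c * v i) \<in> H"
proof (induction c rule: int_induct[where k = 0])
  case base
  then show ?case using additive_subgroup_zero[OF H(1)] by (simp add: zero_fun_def)
next
  case (step1 c)
  have "(\<lambda>i. (c + 1) * v i) = (\<lambda>i. c * v i) + v" by (simp add: fun_eq_iff algebra_simps)
  with step1 H show ?case by (simp add: additive_subgroup_add)
next
  case (step2 c)
  have "(\<lambda>i. (c - 1) * v i) = (\<lambda>i. c * v i) - v" by (simp add: fun_eq_iff algebra_simps)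
  with step2 H show ?case by (simp add: additive_subgroup_diff)
qed

text \<open>Induction on the number of leading coordinates that vanish on the subgroup. The values of the
  first other coordinate form an ideal \<open>e\<int>\<close>: either this coordinate separates
  the vector from the subgroup, or a multiple of an element of the subgroup clears it.\<close>

lemma separate_from_subgroup_aux:
  assumes H: "additive_subgroup H" and z: "z \<in> integer_vectors d" "z \<notin> H"
    and Hd: "H \<subseteq> integer_vectors d"
    and r: "\<And>h i. h \<in> H \<Longrightarrow> i < r \<Longrightarrow> h i = 0" "\<And>i. i < r \<Longrightarrow> z i = 0"
  shows "\<exists>M>0. \<forall>h\<in>H. \<not> vcong M z h"
  using assms
proof (induction "d - r" arbitrary: r H z)
  case 0
  then have "z i = 0" for i by (cases "i < r") (auto simp: integer_vectors_def)
  then have "z = 0" by auto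
  then show ?case using 0 additive_subgroup_zero by blast
next
  case (Suc k)
  note H = Suc.prems(1) and zr = Suc.prems(6) and hr = Suc.prems(5)
  from Suc.hyps(2) have k: "k = d - Suc r" by simp
  show ?case
  proof (cases "\<forall>h\<in>H. h r = 0")
    case True
    show ?thesis
    proof (cases "z r = 0")
      case z0: True
      show ?thesis
        using Suc.hyps(1)[OF k H Suc.prems(2,3,4)] True z0 hr zr by (metis less_Suc_eq)
    next
      case False
      have "\<not> vcong (\<bar>z r\<bar> + 1) z h" if "h \<in> H" for h
      proof
        assume "vcong (\<bar>z r\<bar> + 1) z h"
        then have "\<bar>z r\<bar> + 1 dvd z r - h r" unfolding vcong_def by blast
        moreover have "h r = 0" using True that by blast
        ultimately have "\<bar>z r\<bar> + 1 dvd z r" by simp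
        with False show False using dvd_imp_le_int[of "z r" "\<bar>z r\<bar> + 1"] by simp
      qed
      then show ?thesis by (intro exI[of _ "\<bar>z r\<bar> + 1"]) auto
    qed
  next
    case False
    then obtain h where h: "h \<in> H" "h r \<noteq> 0" by blast
    define E where "E e \<longleftrightarrow> 0 < e \<and> (\<exists>h\<in>H. h r = int e)" for e
    \<comment> \<open>The least positive value generates the ideal of values of the coordinate \<open>r\<close>.\<close>
    have "E (nat \<bar>h r\<bar>)"
    proof (cases "h r > 0")
      case True then show ?thesis using h by (auto simp: E_def)
    next
      case False
      then have "(- h) r = int (nat \<bar>h r\<bar>)" by simp
      moreover have "- h \<in> H" using H h(1) by (rule additive_subgroup_minus)
      moreover have "0 < nat \<bar>h r\<bar>" using h(2) by linarith
      ultimately show ?thesis unfolding E_def by blast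
    qed
    define e where "e = (LEAST e. E e)"
    have "E e" unfolding e_def using \<open>E (nat \<bar>h r\<bar>)\<close> by (rule LeastI)
    then obtain g where g: "g \<in> H" "g r = int e" "0 < e" by (auto simp: E_def)
    have e_dvd: "int e dvd h r" if "h \<in> H" for h
    proof (rule ccontr)
      assume nd: "\<not> int e dvd h r"
      let ?w = "h - (\<lambda>i. (h r div int e) * g i)"
      have w: "?w \<in> H" using H that g by (intro additive_subgroup_diff additive_subgroup_scale)
      have w': "?w r = h r mod int e" using g by (simp add: minus_div_mult_eq_mod)
      have "h r mod int e \<noteq> 0" using nd by (simp add: dvd_eq_mod_eq_0)
      moreover have "0 \<le> h r mod int e" using g(3) by (intro pos_mod_sign) auto
      ultimately have pos: "0 < h r mod int e" by linarith
      from pos have "int (nat (h r mod int e)) = h r mod int e" by simp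
      moreover from pos have "0 < nat (h r mod int e)" by linarith
      ultimately have "E (nat (h r mod int e))" unfolding E_def using w w' by metis
      then have "e \<le> nat (h r mod int e)" unfolding e_def by (rule Least_le)
      then show False using pos_mod_bound[of "int e" "h r"] g(3) by linarith
    qed
    show ?thesis
    proof (cases "int e dvd z r")
      case False
      have "\<not> vcong (int e) z h" if "h \<in> H" for h
        using False e_dvd[OF that] unfolding vcong_def by (metis zdvd_zdiffD)
      then show ?thesis using g(3) by (intro exI[of _ "int e"]) auto
    next
      case True
      then obtain k where k': "z r = int e * k" by (elim dvdE)
      let ?z = "z - (\<lambda>i. k * g i)" and ?H = "{h \<in> H. h r = 0}"
      have kg: "(\<lambda>i. k * g i) \<in> H" using H g by (intro additive_subgroup_scale)
      have "?z \<notin> ?H"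
      proof
        assume "?z \<in> ?H"
        then have "?z + (\<lambda>i. k * g i) \<in> H" using H kg by (intro additive_subgroup_add) auto
        with Suc.prems(3) show False by simp
      qed
      moreover have "?z \<in> integer_vectors d" using Suc.prems(2,4) kg
        by (intro additive_subgroup_diff[OF additive_subgroup_integer_vectors]) auto
      moreover have "additive_subgroup ?H" using H by (auto simp: additive_subgroup_def)
      moreover have "?H \<subseteq> integer_vectors d" using Suc.prems(4) by blast
      moreover have "h i = 0" if "h \<in> ?H" "i < Suc r" for h i
        using that hr by (cases "i = r") auto
      moreover have "?z i = 0" if "i < Suc r" for i
        using that zr hr[OF g(1)] g(2) k' by (cases "i = r") (auto simp: mult.commute)
      ultimately have "\<exists>M>0. \<forall>h\<in>?H. \<not> vcong M ?z h"
        using Suc.hyps(1)[OF k, of ?H ?z] by blast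
      then obtain M where M: "M > 0" "\<And>h. h \<in> ?H \<Longrightarrow> \<not> vcong M ?z h" by blast
      have "\<not> vcong (M * int e) z h" if h: "h \<in> H" for h
      proof
        assume c: "vcong (M * int e) z h"
        obtain l where l: "h r = int e * l" using e_dvd[OF h] by (elim dvdE)
        have "M * int e dvd int e * (k - l)"
          using c k' l by (metis vcong_def right_diff_distrib)
        then have "M dvd k - l" using g(3) by (simp add: mult.commute)
        let ?h = "h - (\<lambda>i. l * g i)"
        have "?h \<in> ?H" using H h g l by (auto intro!: additive_subgroup_diff additive_subgroup_scale)
        moreover have "vcong M ?z ?h"
        proof -
          have "?z i - ?h i = (z i - h i) - (k - l) * g i" for i by (simp add: algebra_simps)
          moreover have "M dvd z i - h i" for i using c by (auto simp: vcong_def dest: dvd_mult_left)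
          ultimately show ?thesis unfolding vcong_def using \<open>M dvd k - l\<close> by (metis dvd_diff dvd_mult2)
        qed
        ultimately show False using M by blast
      qed
      then show ?thesis using M g(3) by (intro exI[of _ "M * int e"]) auto
    qed
  qed
qed

text \<open>Subgroups of the lattice are closed in the congruence topology.\<close>

lemma separate_from_subgroup:
  assumes "additive_subgroup H" "H \<subseteq> integer_vectors d" "z \<in> integer_vectors d" "z \<notin> H"
  obtains M where "M > 0" "\<And>h. h \<in> H \<Longrightarrow> \<not> vcong M z h"
  using separate_from_subgroup_aux[of H z d 0] assms by auto

section \<open>Orbits in the lattice\<close>

definition unit_vector :: "nat \<Rightarrow> nat \<Rightarrow> int" where
  "unit_vector i = (\<lambda>j. of_bool (i = j))"

text \<open>A right action by integral matrices. Linearity is assumed in coordinates, which makes the action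
  of every element linear without conditions on the vectors.\<close>

locale lattice_action = group G for G (structure) +
  fixes d :: nat and T :: "'a \<Rightarrow> (nat \<Rightarrow> int) \<Rightarrow> (nat \<Rightarrow> int)"
  assumes T_lattice: "T g v \<in> integer_vectors d"
    and T_expand: "T g v j = (\<Sum>i<d. v i * T g (unit_vector i) j)"
    and T_mult: "g \<in> carrier G \<Longrightarrow> h \<in> carrier G \<Longrightarrow> T (g \<otimes> h) v = T h (T g v)"
    and T_one: "v \<in> integer_vectors d \<Longrightarrow> T \<one> v = v"
begin

lemma T_add: "T g (u + v) = T g u + T g v"
proof
  fix j
  show "T g (u + v) j = (T g u + T g v) j"
    unfolding plus_fun_apply
    by (subst (1 2 3) T_expand) (simp add: algebra_simps sum.distrib)
qed

lemma T_scale: "T g (\<lambda>i. c * v i) = (\<lambda>j. c * T g v j)"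
proof
  fix j
  show "T g (\<lambda>i. c * v i) j = c * T g v j"
    by (subst (1 2) T_expand) (simp add: sum_distrib_left algebra_simps)
qed

lemma T_minus: "T g (- v) = - T g v"
  using T_scale[of g "-1" v] by (simp add: fun_Compl_def)

lemma T_diff: "T g (u - v) = T g u - T g v"
  using T_add[of g u "- v"] by (simp add: T_minus)

lemma T_zero [simp]: "T g 0 = 0"
  using T_diff[of g 0 0] by simp

lemma T_inv:
  assumes "g \<in> carrier G" "v \<in> integer_vectors d"
  shows "T (inv g) (T g v) = v" "T g (T (inv g) v) = v"
  using assms by (simp_all flip: T_mult add: T_one)

lemma T_vcong: "vcong m u v \<Longrightarrow> vcong m (T g u) (T g v)"
proof -
  assume c: "vcong m u v"
  have "T g u j - T g v j = (\<Sum>i<d. (u i - v i) * T g (unit_vector i) j)" for j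
    by (subst (1 2) T_expand) (simp add: sum_subtractf left_diff_distrib)
  then show ?thesis
    using c unfolding vcong_def by (auto intro!: dvd_sum)
qed

text \<open>The matrix of \<open>g\<close> modulo \<open>M\<close>, as nested lists for the sake of
  counting.\<close>

definition mod_class :: "int \<Rightarrow> 'a \<Rightarrow> int list list" where
  "mod_class M g = map (\<lambda>i. map (\<lambda>j. T g (unit_vector i) j mod M) [0..<d]) [0..<d]"

lemma finite_mod_class:
  assumes "M > 0"
  shows "finite (range (mod_class M))"
proof (rule finite_subset)
  let ?R = "{xs. set xs \<subseteq> {0..<M} \<and> length xs = d}"
  show "range (mod_class M) \<subseteq> {xs. set xs \<subseteq> ?R \<and> length xs = d}"
    using assms by (auto simp: mod_class_def)
  show "finite {xs. set xs \<subseteq> ?R \<and> length xs = d}"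
    by (intro finite_lists_length_eq) auto
qed

lemma mod_class_eqD:
  assumes "mod_class M g = mod_class M h"
  shows "vcong M (T g v) (T h v)"
proof -
  have *: "M dvd T g (unit_vector i) j - T h (unit_vector i) j" if "i < d" for i j
  proof (cases "j < d")
    case True
    have "mod_class M g ! i ! j = mod_class M h ! i ! j" using assms by simp
    then show ?thesis using that True by (simp add: mod_class_def mod_eq_dvd_iff)
  next
    case False
    then show ?thesis using T_lattice[of g "unit_vector i"] T_lattice[of h "unit_vector i"]
      by (simp add: integer_vectors_def)
  qed
  have "T g v j - T h v j = (\<Sum>i<d. v i * (T g (unit_vector i) j - T h (unit_vector i) j))" for j
    by (subst (1 2) T_expand) (simp add: sum_subtractf right_diff_distrib)
  then show ?thesis unfolding vcong_def using * by (auto intro!: dvd_sum)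
qed

text \<open>The principal congruence subgroup of level \<open>M\<close>.\<close>

definition principal :: "int \<Rightarrow> 'a set" where
  "principal M = {g \<in> carrier G. \<forall>v\<in>integer_vectors d. vcong M (T g v) v}"

lemma mod_class_principal:
  assumes "g \<in> carrier G" "h \<in> carrier G" "mod_class M g = mod_class M h"
  shows "g \<otimes> inv h \<in> principal M"
proof -
  have "vcong M (T (g \<otimes> inv h) v) v" if "v \<in> integer_vectors d" for v
    using T_vcong[OF mod_class_eqD[OF assms(3), of v], of "inv h"] assms(1,2) that
    by (simp add: T_mult T_inv)
  then show ?thesis using assms by (auto simp: principal_def)
qed

lemma subgroup_principal: "subgroup (principal M) G"
proof
  show "principal M \<subseteq> carrier G" by (auto simp: principal_def)
  show "\<one> \<in> principal M" by (simp add: principal_def T_one)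
  show "x \<otimes> y \<in> principal M" if "x \<in> principal M" "y \<in> principal M" for x y
    using that T_lattice[of x] by (force simp: principal_def T_mult intro: vcong_trans)
  show "inv x \<in> principal M" if "x \<in> principal M" for x
  proof -
    have "vcong M (T (inv x) v) v" if "v \<in> integer_vectors d" for v
      using \<open>x \<in> principal M\<close> that T_inv[of x v] T_lattice[of "inv x" v]
      by (metis (no_types, lifting) mem_Collect_eq principal_def vcong_sym)
    then show ?thesis using that by (auto simp: principal_def)
  qed
qed

lemma unit_vector_in [simp]: "i < d \<Longrightarrow> unit_vector i \<in> integer_vectors d"
  by (auto simp: unit_vector_def integer_vectors_def)

lemma mod_class_eqI:
  assumes "\<And>v. v \<in> integer_vectors d \<Longrightarrow> vcong M (T g v) (T h v)"
  shows "mod_class M g = mod_class M h"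
  unfolding mod_class_def using assms unit_vector_in
  by (auto simp: vcong_def mod_eq_dvd_iff)

text \<open>Orbits of \<open>Q\<close> in the lattice modulo \<open>W\<close> are closed in the congruence
  topology. The subgroup \<open>W\<close> stands for a term of a filtration; this avoids passing
  to quotient lattices.\<close>

definition approx_closed :: "'a set \<Rightarrow> (nat \<Rightarrow> int) set \<Rightarrow> bool" where
  "approx_closed Q W \<longleftrightarrow> (\<forall>a\<in>integer_vectors d. \<forall>a'\<in>integer_vectors d.
     (\<forall>m>0. \<exists>\<gamma>\<in>Q. \<exists>w\<in>W. vcong m (a' - T \<gamma> a) w) \<longrightarrow> (\<exists>\<gamma>\<in>Q. a' - T \<gamma> a \<in> W))"

text \<open>An orbit of \<open>Q\<close> is the union of finitely many translates of orbits of its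
  congruence subgroup. Each translate that misses \<open>a'\<close> is excluded by some modulus,
  and the product of these moduli excludes all of them. So an element that moves \<open>a\<close>
  close to \<open>a'\<close> can be replaced by one of the same class that moves \<open>a\<close>
  to \<open>a'\<close> modulo \<open>W\<close>.\<close>

lemma coset_modulus:
  assumes Q: "subgroup Q G" and M: "M > 0"
    and W: "\<And>g w. g \<in> Q \<Longrightarrow> w \<in> W \<Longrightarrow> T g w \<in> W"
    and cl: "approx_closed (Q \<inter> principal M) W"
    and a: "a \<in> integer_vectors d" and a': "a' \<in> integer_vectors d"
  obtains m :: int where "m > 0"
    and "\<And>\<gamma> w. \<gamma> \<in> Q \<Longrightarrow> w \<in> W \<Longrightarrow> vcong m (a' - T \<gamma> a) w \<Longrightarrow>
      \<exists>\<sigma>\<in>Q. mod_class M \<sigma> = mod_class M \<gamma> \<and> a' - T \<sigma> a \<in> W"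
proof -
  let ?Q = "Q \<inter> principal M" and ?C = "mod_class M ` Q"
  note QG = subgroup.mem_carrier[OF Q]
  define rep where "rep c = (SOME g. g \<in> Q \<and> mod_class M g = c)" for c
  have rep: "rep c \<in> Q" "mod_class M (rep c) = c" if "c \<in> ?C" for c
    using someI_ex[of "\<lambda>g. g \<in> Q \<and> mod_class M g = c"] that unfolding rep_def by blast+
  have "\<exists>m::int>0. (\<exists>q\<in>?Q. T (inv (rep c)) a' - T q a \<in> W) \<or>
      (\<forall>q\<in>?Q. \<forall>w\<in>W. \<not> vcong m (T (inv (rep c)) a' - T q a) w)" for c
  proof (cases "\<exists>m::int>0. \<forall>q\<in>?Q. \<forall>w\<in>W. \<not> vcong m (T (inv (rep c)) a' - T q a) w")
    case False
    then have "\<exists>q\<in>?Q. T (inv (rep c)) a' - T q a \<in> W"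
      using cl a T_lattice[of "inv (rep c)" a'] unfolding approx_closed_def by blast
    then show ?thesis by (intro exI[of _ 1]) auto
  qed blast
  then obtain mm :: "int list list \<Rightarrow> int" where mm: "\<And>c. mm c > 0"
    "\<And>c. (\<exists>q\<in>?Q. T (inv (rep c)) a' - T q a \<in> W) \<or>
      (\<forall>q\<in>?Q. \<forall>w\<in>W. \<not> vcong (mm c) (T (inv (rep c)) a' - T q a) w)"
    by metis
  have fin: "finite ?C" using finite_mod_class[OF M] by (rule finite_subset[rotated]) auto
  show thesis
  proof (rule that[of "\<Prod>c\<in>?C. mm c"])
    show "0 < (\<Prod>c\<in>?C. mm c)" using mm by (intro prod_pos) auto
    fix \<gamma> w assume \<gamma>: "\<gamma> \<in> Q" and w: "w \<in> W" and c: "vcong (\<Prod>c\<in>?C. mm c) (a' - T \<gamma> a) w"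
    define g where "g = rep (mod_class M \<gamma>)"
    have g: "g \<in> Q" "mod_class M g = mod_class M \<gamma>"
      using rep[of "mod_class M \<gamma>"] \<gamma> unfolding g_def by blast+
    define q where "q = \<gamma> \<otimes> inv g"
    have q: "q \<in> ?Q" unfolding q_def
      using mod_class_principal[of \<gamma> g M] \<gamma> g QG subgroup.m_closed[OF Q \<gamma> subgroup.m_inv_closed[OF Q g(1)]]
      by simp
    have "mm (mod_class M \<gamma>) dvd (\<Prod>c\<in>?C. mm c)" using fin \<gamma> by (intro dvd_prodI) auto
    from vcong_dvd[OF this c] have "vcong (mm (mod_class M \<gamma>)) (T (inv g) (a' - T \<gamma> a)) (T (inv g) w)"
      by (rule T_vcong)
    then have "vcong (mm (mod_class M \<gamma>)) (T (inv g) a' - T q a) (T (inv g) w)"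
      using \<gamma> g QG by (simp add: T_diff q_def T_mult)
    moreover have "T (inv g) w \<in> W" using W w g(1) subgroup.m_inv_closed[OF Q] by blast
    ultimately obtain q0 where q0: "q0 \<in> ?Q" "T (inv g) a' - T q0 a \<in> W"
      using mm(2)[of "mod_class M \<gamma>"] q unfolding g_def by blast
    have "T g (T (inv g) a' - T q0 a) \<in> W" using W g(1) q0(2) by blast
    then have "a' - T (q0 \<otimes> g) a \<in> W" using q0 g QG a' by (simp add: T_diff T_mult T_inv)
    moreover have "mod_class M (q0 \<otimes> g) = mod_class M \<gamma>"
    proof -
      have "vcong M (T (q0 \<otimes> g) v) (T g v)" if "v \<in> integer_vectors d" for v
        using q0 g QG that by (auto simp: T_mult principal_def intro: T_vcong)
      from mod_class_eqI[OF this] show ?thesis using g by simp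
    qed
    ultimately show "\<exists>\<sigma>\<in>Q. mod_class M \<sigma> = mod_class M \<gamma> \<and> a' - T \<sigma> a \<in> W"
      using q0 g Q by (intro bexI[of _ "q0 \<otimes> g"]) (auto intro: subgroup.m_closed)
  qed
qed

text \<open>One step down the filtration. After an element of \<open>Q\<close> has been applied, the two
  vectors differ by an element \<open>z\<close> of \<open>Z'\<close>. The elements that fix
  \<open>b\<close> modulo \<open>Z'\<close> move it, modulo \<open>Z\<close>, by a subgroup
  \<open>H\<close> of \<open>Z'\<close>, because \<open>P\<close> acts trivially on the quotient
  of \<open>Z'\<close> by \<open>Z\<close>. If \<open>z\<close> is not in \<open>H\<close>, then
  it is not in \<open>H\<close> modulo some \<open>M\<close>. But an element that moves
  \<open>b\<close> sufficiently close to \<open>b + z\<close> agrees modulo \<open>M\<close> with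
  one that fixes \<open>b\<close> modulo \<open>Z'\<close>, by the closedness of orbits of the
  congruence subgroup of level \<open>M\<close>.\<close>

lemma approx_closed_step:
  assumes Z: "additive_subgroup Z" "Z \<subseteq> integer_vectors d"
    and Z': "additive_subgroup Z'" "Z' \<subseteq> integer_vectors d" "Z \<subseteq> Z'"
    and P: "\<And>\<gamma> v. \<gamma> \<in> P \<Longrightarrow> v \<in> Z' \<Longrightarrow> T \<gamma> v - v \<in> Z"
    and cl: "\<And>Q. subgroup Q G \<Longrightarrow> Q \<subseteq> P \<Longrightarrow> approx_closed Q Z'"
    and Q: "subgroup Q G" "Q \<subseteq> P"
  shows "approx_closed Q Z"
  unfolding approx_closed_def
proof (intro ballI impI)
  fix a a' assume a: "a \<in> integer_vectors d" and a': "a' \<in> integer_vectors d"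
    and app: "\<forall>m>0. \<exists>\<gamma>\<in>Q. \<exists>w\<in>Z. vcong m (a' - T \<gamma> a) w"
  note QG = subgroup.mem_carrier[OF Q(1)]
  have inv': "T \<gamma> v \<in> Z'" if "\<gamma> \<in> Q" "v \<in> Z'" for \<gamma> v
    using additive_subgroup_add[OF Z'(1), of "T \<gamma> v - v" v] P[of \<gamma> v] that Q(2) Z'(3)
    by (auto simp: subset_iff)
  obtain \<gamma>0 where \<gamma>0: "\<gamma>0 \<in> Q" "a' - T \<gamma>0 a \<in> Z'"
    using cl[OF Q] app a a' Z'(3) unfolding approx_closed_def by (meson subsetD)
  define b where "b = T \<gamma>0 a"
  define z where "z = a' - b"
  have b: "b \<in> integer_vectors d" unfolding b_def by (rule T_lattice)
  have z: "z \<in> Z'" "z \<in> integer_vectors d" using \<gamma>0 Z' by (auto simp: z_def b_def)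
  have appb: "\<exists>\<gamma>\<in>Q. \<exists>w\<in>Z. vcong m (a' - T \<gamma> b) w" if m: "m > 0" for m
  proof -
    obtain \<gamma> w where \<gamma>: "\<gamma> \<in> Q" "w \<in> Z" "vcong m (a' - T \<gamma> a) w" using app m by blast
    have "T (inv \<gamma>0 \<otimes> \<gamma>) b = T \<gamma> a"
      using \<gamma> \<gamma>0 QG a by (simp add: b_def T_mult T_inv)
    then show ?thesis using \<gamma> \<gamma>0 subgroup.m_closed[OF Q(1) subgroup.m_inv_closed[OF Q(1) \<gamma>0(1)] \<gamma>(1)]
      by metis
  qed
  \<comment> \<open>The displacements of \<open>b\<close> that remain in \<open>Z'\<close>; adding \<open>Z\<close> makes them a group.\<close>
  define H where "H = {w. \<exists>\<sigma>\<in>Q. \<exists>x\<in>Z. T \<sigma> b - b \<in> Z' \<and> w = T \<sigma> b - b + x}"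
  have "H \<subseteq> integer_vectors d"
    using Z' Z additive_subgroup_add[OF additive_subgroup_integer_vectors] by (auto simp: H_def subset_iff)
  moreover have "additive_subgroup H"
    unfolding additive_subgroup_def
  proof (intro conjI ballI)
    show "0 \<in> H" unfolding H_def
      using subgroup.one_closed[OF Q(1)] additive_subgroup_zero[OF Z(1)] additive_subgroup_zero[OF Z'(1)] T_one[OF b]
      by (auto intro!: bexI[of _ \<one>] bexI[of _ 0])
    fix u v assume "u \<in> H" "v \<in> H"
    then obtain \<sigma> x \<rho> y where u: "\<sigma> \<in> Q" "x \<in> Z" "T \<sigma> b - b \<in> Z'" "u = T \<sigma> b - b + x"
      and v: "\<rho> \<in> Q" "y \<in> Z" "T \<rho> b - b \<in> Z'" "v = T \<rho> b - b + y"
      by (auto simp: H_def)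
    define e where "e = (T \<sigma> b - b) - (T \<rho> b - b)"
    define f where "f = T (inv \<rho>) e - e"
    have e: "e \<in> Z'" unfolding e_def by (rule additive_subgroup_diff[OF Z'(1) u(3) v(3)])
    have f: "f \<in> Z" unfolding f_def
      using e P subgroup.m_inv_closed[OF Q(1) v(1)] Q by blast
    have "T (\<sigma> \<otimes> inv \<rho>) b = T (inv \<rho>) (T \<rho> b + e)"
      using u v QG by (simp add: T_mult e_def)
    also have "\<dots> = b + (e + f)" using v QG b by (simp add: T_add T_inv f_def)
    finally have *: "T (\<sigma> \<otimes> inv \<rho>) b - b = e + f" by simp
    moreover have "e + f \<in> Z'" using e f Z' by (intro additive_subgroup_add) auto
    moreover have "u - v = (e + f) + (x - y - f)" using u v by (simp add: e_def)
    moreover have "x - y - f \<in> Z" using u v f Z by (intro additive_subgroup_diff)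
    moreover have "\<sigma> \<otimes> inv \<rho> \<in> Q"
      using u v subgroup.m_closed[OF Q(1)] subgroup.m_inv_closed[OF Q(1)] by blast
    ultimately show "u - v \<in> H" unfolding H_def mem_Collect_eq
      by (intro bexI[of _ "\<sigma> \<otimes> inv \<rho>"] bexI[of _ "x - y - f"]) (simp_all only: *)
  qed
  moreover have "z \<in> H"
  proof (rule ccontr)
    assume "z \<notin> H"
    then obtain M where M: "M > 0" "\<And>h. h \<in> H \<Longrightarrow> \<not> vcong M z h"
      using separate_from_subgroup[OF \<open>additive_subgroup H\<close> \<open>H \<subseteq> _\<close> z(2)] by metis
    have "approx_closed (Q \<inter> principal M) Z'"
      using Q subgroup_principal subgroups_Inter_pair by (intro cl) auto
    then obtain m where m: "m > 0" "\<And>\<gamma> w. \<gamma> \<in> Q \<Longrightarrow> w \<in> Z' \<Longrightarrow> vcong m (b - T \<gamma> b) w \<Longrightarrow>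
      \<exists>\<sigma>\<in>Q. mod_class M \<sigma> = mod_class M \<gamma> \<and> b - T \<sigma> b \<in> Z'"
      using coset_modulus[OF Q(1) M(1) inv' _ b b] by metis
    obtain \<gamma> w where \<gamma>: "\<gamma> \<in> Q" "w \<in> Z" "vcong (m * M) (a' - T \<gamma> b) w"
      using appb[of "m * M"] m M by auto
    have "vcong m (a' - T \<gamma> b) w" "vcong M (a' - T \<gamma> b) w"
      using \<gamma>(3) by (auto intro: vcong_dvd[rotated])
    have "vcong m (b - T \<gamma> b) (w - z)"
      using vcong_diff[OF \<open>vcong m (a' - T \<gamma> b) w\<close> vcong_refl[of m z]] by (simp add: z_def algebra_simps)
    moreover have "w - z \<in> Z'" using \<gamma> z Z' by (intro additive_subgroup_diff) auto
    ultimately obtain \<sigma> where \<sigma>: "\<sigma> \<in> Q" "mod_class M \<sigma> = mod_class M \<gamma>" "b - T \<sigma> b \<in> Z'"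
      using m(2) \<gamma> by blast
    have "- (b - T \<sigma> b) \<in> Z'" using \<sigma>(3) Z' by (intro additive_subgroup_minus)
    then have "T \<sigma> b - b + w \<in> H" using \<sigma> \<gamma> unfolding H_def by auto
    moreover have "vcong M z (T \<sigma> b - b + w)"
    proof -
      have "vcong M (T \<gamma> b - b + (a' - T \<gamma> b)) (T \<sigma> b - b + w)"
        using mod_class_eqD[OF \<sigma>(2), of b] \<open>vcong M (a' - T \<gamma> b) w\<close>
        by (intro vcong_add vcong_diff) (auto intro: vcong_sym)
      then show ?thesis by (simp add: z_def)
    qed
    ultimately show False using M by blast
  qed
  then obtain \<sigma> x where \<sigma>: "\<sigma> \<in> Q" "x \<in> Z" "z = T \<sigma> b - b + x" by (auto simp: H_def)
  then have "a' - T \<sigma> b = x" by (simp add: z_def algebra_simps)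
  moreover have "T (\<gamma>0 \<otimes> \<sigma>) a = T \<sigma> b" using \<sigma> \<gamma>0 QG by (simp add: b_def T_mult)
  ultimately show "\<exists>\<gamma>\<in>Q. a' - T \<gamma> a \<in> Z"
    using \<sigma> \<gamma>0 subgroup.m_closed[OF Q(1) \<gamma>0(1) \<sigma>(1)] by metis
qed

lemma orbit_separable:
  assumes M: "M > 0"
    and Z: "\<And>i. additive_subgroup (Z i)" "\<And>i. Z i \<subseteq> integer_vectors d" "\<And>i. Z i \<subseteq> Z (Suc i)"
    and Z0: "Z 0 = {0}" and Zk: "Z k = integer_vectors d"
    and P: "\<And>i \<gamma> v. \<gamma> \<in> principal M \<Longrightarrow> v \<in> Z (Suc i) \<Longrightarrow> T \<gamma> v - v \<in> Z i"
    and a: "a \<in> integer_vectors d" and a': "a' \<in> integer_vectors d"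
    and app: "\<And>m. m > 0 \<Longrightarrow> \<exists>\<gamma>\<in>carrier G. vcong m (T \<gamma> a) a'"
  shows "\<exists>\<gamma>\<in>carrier G. T \<gamma> a = a'"
proof -
  have "approx_closed Q (Z (k - j))" if "subgroup Q G" "Q \<subseteq> principal M" for Q j
    using that
  proof (induction j arbitrary: Q)
    case 0
    have "\<one> \<in> Q" using 0 by (simp add: subgroup.one_closed)
    then show ?case unfolding approx_closed_def
      using Zk additive_subgroup_diff[OF additive_subgroup_integer_vectors _ T_lattice] by auto
  next
    case (Suc j)
    show ?case
    proof (cases "k - j")
      case 0
      then show ?thesis using Suc by (metis diff_Suc diff_0_eq_0 old.nat.simps(4))
    next
      case i': (Suc i)
      then have i: "k - Suc j = i" by simp
      show ?thesis unfolding i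
      proof (rule approx_closed_step[of "Z i" "Z (Suc i)" "principal M"])
        show "approx_closed Q (Z (Suc i))" if "subgroup Q G" "Q \<subseteq> principal M" for Q
          using Suc.IH[OF that] i' by simp
      qed (use Z P Suc.prems in auto)
    qed
  qed
  from this[of "principal M" k] have "approx_closed (carrier G \<inter> principal M) {0}"
    using subgroup_principal subgroup.subset[OF subgroup_principal[of M]]
    by (simp add: Z0 Int_absorb1)
  note cl = this
  have W: "T g w \<in> {0}" if "g \<in> carrier G" "w \<in> {0}" for g w using that by simp
  show ?thesis
  proof (rule coset_modulus[OF subgroup_self M W cl a a'])
    fix m :: int
    assume m: "m > 0" "\<And>\<gamma> w. \<gamma> \<in> carrier G \<Longrightarrow> w \<in> {0} \<Longrightarrow> vcong m (a' - T \<gamma> a) w \<Longrightarrow>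
      \<exists>\<sigma>\<in>carrier G. mod_class M \<sigma> = mod_class M \<gamma> \<and> a' - T \<sigma> a \<in> {0}"
    obtain \<gamma> where \<gamma>: "\<gamma> \<in> carrier G" "vcong m (T \<gamma> a) a'" using app m by blast
    then have "vcong m (a' - T \<gamma> a) 0" by (simp add: vcong_diff_0 vcong_sym)
    then obtain \<sigma> where "\<sigma> \<in> carrier G" "a' - T \<sigma> a \<in> {0}"
      using m(2)[OF \<gamma>(1)] by blast
    then show ?thesis by auto
  qed
qed

end

section \<open>Free groups\<close>

definition inv_word :: "'a gword \<Rightarrow> 'a gword" where
  "inv_word w = rev (map inv_letter w)"

lemma length_inv_word [simp]: "length (inv_word w) = length w"
  by (simp add: inv_word_def)

lemma inv_word_append: "inv_word (u @ v) = inv_word v @ inv_word u"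
  by (simp add: inv_word_def)

lemma inv_word_inv_word [simp]: "inv_word (inv_word w) = w"
proof -
  have "inv_letter \<circ> inv_letter = (id :: 'a \<times> bool \<Rightarrow> _)" by (rule ext) simp
  then show ?thesis by (simp add: inv_word_def rev_map)
qed

lemma inv_word_words_over [simp]: "inv_word w \<in> words_over X \<longleftrightarrow> w \<in> words_over X"
proof -
  have "w \<in> words_over X \<Longrightarrow> inv_word w \<in> words_over X" for w :: "'a gword"
    by (force simp: inv_word_def words_over_def elim: inv_letter.elims)
  from this[of w] this[of "inv_word w"] show ?thesis by auto
qed

lemma words_over_append [simp]: "u @ v \<in> words_over X \<longleftrightarrow> u \<in> words_over X \<and> v \<in> words_over X"
  by (auto simp: words_over_def)

lemma words_over_Cons [simp]: "l # v \<in> words_over X \<longleftrightarrow> fst l \<in> X \<and> v \<in> words_over X"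
  by (cases l) (auto simp: words_over_def)

lemma words_over_Nil [simp]: "[] \<in> words_over X"
  by (auto simp: words_over_def)

lemma fst_inv_letter [simp]: "fst (inv_letter l) = fst l"
  by (cases l) simp

lemma reduce_cancel: "reduce (u @ inv_word p @ p @ v) = reduce (u @ v)"
proof -
  have "reduce (inv_word p @ p @ v) = reduce (reduce (inv_word p @ p) @ v)"
    by (simp add: append_assoc[symmetric] del: append_assoc)
  also have "\<dots> = reduce v" by (simp add: inv_word_def reduce_inverse)
  finally show ?thesis by (metis reduce_append_reduce(2))
qed

lemma length_cancel_cons: "length (cancel_cons a w) \<le> Suc (length w)"
  by (cases w) auto

lemma length_reduce_le: "length (reduce w) \<le> length w"
proof (induction w)
  case (Cons a w)
  have "reduce (a # w) = cancel_cons a (reduce w)" by (simp add: reduce_def)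
  then show ?case using Cons length_cancel_cons[of a "reduce w"] by simp
qed (simp add: reduce_def)

lemma free_group_carrier: "w \<in> carrier (free_group X) \<longleftrightarrow> w \<in> words_over X \<and> reduced w"
  by (simp add: free_group_def)

lemma free_group_mult: "u \<otimes>\<^bsub>free_group X\<^esub> v = reduce (u @ v)"
  by (simp add: free_group_def)

lemma free_group_one: "\<one>\<^bsub>free_group X\<^esub> = []"
  by (simp add: free_group_def)

lemma reduce_in_free_group: "w \<in> words_over X \<Longrightarrow> reduce w \<in> carrier (free_group X)"
  by (simp add: free_group_carrier reduce_words_over)

lemma free_group_inv:
  assumes "w \<in> carrier (free_group X)"
  shows "inv\<^bsub>free_group X\<^esub> w = reduce (inv_word w)"
proof -
  interpret group "free_group X" by (rule group_free_group)
  show ?thesis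
  proof (rule inv_equality)
    show "reduce (inv_word w) \<otimes>\<^bsub>free_group X\<^esub> w = \<one>\<^bsub>free_group X\<^esub>"
      using reduce_cancel[of "[]" w "[]"] by (simp add: free_group_mult free_group_one reduce_reduced)
  qed (use assms in \<open>auto simp: free_group_carrier reduce_words_over\<close>)
qed

lemma length_free_group_inv:
  assumes "w \<in> carrier (free_group X)"
  shows "length (inv\<^bsub>free_group X\<^esub> w) = length w"
proof -
  interpret group "free_group X" by (rule group_free_group)
  have *: "length (inv\<^bsub>free_group X\<^esub> w) \<le> length w" if "w \<in> carrier (free_group X)" for w
    using length_reduce_le[of "inv_word w"] that by (simp add: free_group_inv)
  from *[OF assms] *[of "inv\<^bsub>free_group X\<^esub> w"] assms show ?thesis by simp
qed

text \<open>In a product of reduced words cancellation takes place at one spot only.\<close>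

lemma reduced_append_decompose:
  assumes "reduced u" "reduced v"
  obtains p q s where "u = p @ q" "v = inv_word q @ s" "reduce (u @ v) = p @ s"
proof -
  have "\<exists>p q s. u = p @ q \<and> v = inv_word q @ s \<and> reduce (u @ v) = p @ s"
    using assms(1)
  proof (induction u)
    case Nil
    then show ?case using assms(2) by (simp add: reduce_reduced inv_word_def)
  next
    case (Cons a u)
    then obtain p q s where IH: "u = p @ q" "v = inv_word q @ s" "reduce (u @ v) = p @ s"
      by (auto simp: reduced_Cons)
    have red: "reduce ((a # u) @ v) = cancel_cons a (p @ s)"
      using IH(3) by (simp add: reduce_def)
    show ?case
    proof (cases "p = [] \<and> s \<noteq> [] \<and> hd s = inv_letter a")
      case True
      then obtain s' where s': "s = inv_letter a # s'" by (cases s) auto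
      have "a # u = [] @ (a # q)" "v = inv_word (a # q) @ s'" "reduce ((a # u) @ v) = [] @ s'"
        using True IH s' red by (simp_all add: inv_word_def)
      then show ?thesis by blast
    next
      case False
      have "cancel_cons a (p @ s) = a # p @ s"
      proof (cases p)
        case Nil then show ?thesis using False by (cases s) auto
      next
        case (Cons b p') then show ?thesis using \<open>reduced (a # u)\<close> IH by (auto simp: reduced_Cons)
      qed
      then have "a # u = (a # p) @ q" "v = inv_word q @ s" "reduce ((a # u) @ v) = (a # p) @ s"
        using IH red by simp_all
      then show ?thesis by blast
    qed
  qed
  then show thesis using that by blast
qed

lemma hd_reduce_append:
  assumes "reduced u" "reduced v" "length v < length u"
  shows "reduce (u @ v) \<noteq> [] \<and> hd (reduce (u @ v)) = hd u"
proof -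
  obtain p q s where d: "u = p @ q" "v = inv_word q @ s" "reduce (u @ v) = p @ s"
    using reduced_append_decompose[OF assms(1,2)] .
  then have "p \<noteq> []" using assms(3) by auto
  then show ?thesis using d by (cases p) auto
qed

text \<open>If neither \<open>b\<close> nor its inverse shortens \<open>h\<close>, then at most half of
  \<open>b\<close> cancels against \<open>h\<close>; were \<open>h\<close> long, the equation
  would exhibit the uncancelled part of \<open>b\<close> as a prefix of \<open>h\<close> too, and
  multiplication by the inverse of \<open>b\<close> would remove it.\<close>

lemma short_conjugator:
  fixes X :: "'a set"
  defines "F \<equiv> free_group X"
  assumes b: "b \<in> carrier F" "b \<noteq> []" and b': "b' \<in> carrier F" and h: "h \<in> carrier F"
    and conj: "b \<otimes>\<^bsub>F\<^esub> h = h \<otimes>\<^bsub>F\<^esub> b'"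
    and min: "length h \<le> length (b \<otimes>\<^bsub>F\<^esub> h)" "length h \<le> length (inv\<^bsub>F\<^esub> b \<otimes>\<^bsub>F\<^esub> h)"
  shows "length h < length b + length b'"
proof (rule ccontr)
  assume long: "\<not> length h < length b + length b'"
  have red: "reduced b" "reduced b'" "reduced h" using b b' h by (auto simp: F_def free_group_carrier)
  obtain p q s where d: "b = p @ q" "h = inv_word q @ s" "reduce (b @ h) = p @ s"
    using reduced_append_decompose[OF red(1,3)] .
  obtain p' q' s' where d': "h = p' @ q'" "b' = inv_word q' @ s'" "reduce (h @ b') = p' @ s'"
    using reduced_append_decompose[OF red(3,2)] .
  have eq: "p @ s = p' @ s'" using conj d(3) d'(3) by (simp add: F_def free_group_mult)
  have "length h + length q' = length p' + 2 * length q'" "length q' \<le> length b'"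
    using d' by auto
  moreover have "length q' + length p' = length h" using d' by simp
  ultimately have "length p \<le> length p'" using long d(1) by auto
  then obtain r where "p' = p @ r" using eq by (metis append_eq_append_conv_if append_take_drop_id)
  then obtain t where t: "h = p @ t" using d' by auto
  have "inv\<^bsub>F\<^esub> b \<otimes>\<^bsub>F\<^esub> h = reduce (inv_word q @ inv_word p @ p @ t)"
    using b t d(1) by (simp add: F_def free_group_inv free_group_mult inv_word_append)
  then have "length (inv\<^bsub>F\<^esub> b \<otimes>\<^bsub>F\<^esub> h) \<le> length q + length t"
    using length_reduce_le[of "inv_word q @ t"] by (simp add: reduce_cancel)
  with min(2) t have "length p \<le> length q" by simp
  moreover have "length q \<le> length p" using min(1) d by (simp add: F_def free_group_mult)
  ultimately have "p = inv_word q"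
    using t d(2) by (metis append_eq_append_conv antisym length_inv_word)
  then have "reduce b = []" using d(1) by (simp add: inv_word_def reduce_inverse)
  with b red(1) show False by (simp add: reduce_reduced)
qed

section \<open>Antisymmetric costs and area\<close>

lemma (in group) foldr_mult_closed:
  "set cs \<subseteq> carrier G \<Longrightarrow> foldr (\<otimes>) cs \<one> \<in> carrier G"
  by (induction cs) auto

lemma (in group) foldr_mult_append:
  "set cs \<subseteq> carrier G \<Longrightarrow> set ds \<subseteq> carrier G \<Longrightarrow>
    foldr (\<otimes>) (cs @ ds) \<one> = foldr (\<otimes>) cs \<one> \<otimes> foldr (\<otimes>) ds \<one>"
  by (induction cs) (auto simp: m_assoc foldr_mult_closed simp del: foldr_append)

lemma (in group) conjugate_set_closed:
  "R \<subseteq> carrier G \<Longrightarrow> conjugate_set G R \<subseteq> carrier G"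
  by (auto simp: conjugate_set_def)

lemma (in group) subset_conjugate_set:
  assumes "R \<subseteq> carrier G"
  shows "R \<subseteq> conjugate_set G R"
proof
  fix r assume "r \<in> R"
  moreover from this have "r = inv \<one> \<otimes> r \<otimes> \<one>" using assms by auto
  ultimately show "r \<in> conjugate_set G R"
    unfolding conjugate_set_def using one_closed by (intro CollectI exI[of _ \<one>] exI[of _ r]) blast
qed

text \<open>The inverse of a conjugate of \<open>r\<close> is a conjugate of the inverse of
  \<open>r\<close>. This gives the decompositions that the area of a word minimizes over.\<close>

lemma (in group) generate_conjugates_product:
  assumes R: "R \<subseteq> carrier G" and x: "x \<in> generate G (conjugate_set G R)"
  shows "\<exists>cs. set cs \<subseteq> conjugate_set G (R \<union> m_inv G ` R) \<and> x = foldr (\<otimes>) cs \<one>"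
proof -
  let ?S = "R \<union> m_inv G ` R"
  have S: "?S \<subseteq> carrier G" using R by auto
  note closed = conjugate_set_closed[OF S]
  show ?thesis using x
  proof induction
    case one
    then show ?case by (intro exI[of _ "[]"]) simp
  next
    case (incl h)
    then have "h \<in> conjugate_set G ?S" by (auto simp: conjugate_set_def)
    then show ?case using closed by (intro exI[of _ "[h]"]) auto
  next
    case (inv h)
    then obtain g r where g: "g \<in> carrier G" "r \<in> R" "h = inv g \<otimes> r \<otimes> g"
      by (auto simp: conjugate_set_def)
    then have "inv h = inv g \<otimes> inv r \<otimes> g" using R by (auto simp: inv_mult_group m_assoc subset_iff)
    then have "inv h \<in> conjugate_set G ?S" using g unfolding conjugate_set_def by blast
    then show ?case using closed by (intro exI[of _ "[inv h]"]) auto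
  next
    case (eng h1 h2)
    then obtain cs ds where "set cs \<subseteq> conjugate_set G ?S" "h1 = foldr (\<otimes>) cs \<one>"
      "set ds \<subseteq> conjugate_set G ?S" "h2 = foldr (\<otimes>) ds \<one>" by blast
    then show ?case using closed foldr_mult_append[of cs ds]
      by (intro exI[of _ "cs @ ds"]) (auto simp del: foldr_append)
  qed
qed

locale presented_group = group G for G :: "('g, 'x) monoid_scheme" (structure) +
  fixes X :: "'a set" and R :: "'a gword set" and \<theta> :: "'a gword \<Rightarrow> 'g"
  assumes finite_X: "finite X" and finite_R: "finite R" and R: "R \<subseteq> carrier (free_group X)"
    and hom: "\<theta> \<in> hom (free_group X) G"
    and surj: "\<theta> ` carrier (free_group X) = carrier G"
    and kernel: "w \<in> carrier (free_group X) \<Longrightarrow> \<theta> w = \<one> \<longleftrightarrow> w \<in> normal_closure (free_group X) R"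

text \<open>The homomorphism is the quotient map followed by the given isomorphism.\<close>

lemma finite_presentation_presented_group:
  assumes G: "group G" and P: "finite_presentation G X R"
  obtains \<theta> where "presented_group G X R \<theta>"
proof -
  let ?F = "free_group X" and ?N = "normal_closure (free_group X) R"
  interpret F: group ?F by (rule group_free_group)
  interpret G: group G by (rule G)
  have R: "R \<subseteq> carrier ?F" and fin: "finite X" "finite R"
    using P by (auto simp: finite_presentation_def)
  interpret N: normal ?N ?F by (rule F.normal_normal_closure[OF R])
  obtain h where h: "h \<in> iso (?F Mod ?N) G"
    using P by (auto simp: finite_presentation_def is_iso_def)
  interpret Q: group "?F Mod ?N" by (rule N.factorgroup_is_group)
  have hh: "h \<in> hom (?F Mod ?N) G" and hb: "bij_betw h (carrier (?F Mod ?N)) (carrier G)"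
    using h by (auto simp: iso_def)
  interpret hom: group_hom "?F Mod ?N" G h using hh by unfold_locales
  have carr: "(\<lambda>w. ?N #>\<^bsub>?F\<^esub> w) ` carrier ?F = carrier (?F Mod ?N)"
    by (auto simp: FactGroup_def RCOSETS_def)
  show thesis
  proof (rule that[of "\<lambda>w. h (?N #>\<^bsub>?F\<^esub> w)"], unfold_locales)
    have "h \<circ> (\<lambda>w. ?N #>\<^bsub>?F\<^esub> w) \<in> hom ?F G"
      by (rule Group.hom_compose[OF N.r_coset_hom_Mod hh])
    then show "(\<lambda>w. h (?N #>\<^bsub>?F\<^esub> w)) \<in> hom ?F G" by (simp add: comp_def)
    show "(\<lambda>w. h (?N #>\<^bsub>?F\<^esub> w)) ` carrier ?F = carrier G"
      using hb carr unfolding bij_betw_def by (metis image_image)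
    fix w assume w: "w \<in> carrier ?F"
    have "?N #>\<^bsub>?F\<^esub> w \<in> carrier (?F Mod ?N)" using carr w by blast
    moreover have "h \<one>\<^bsub>?F Mod ?N\<^esub> = \<one>\<^bsub>G\<^esub>" by (rule hom.hom_one)
    ultimately have "h (?N #>\<^bsub>?F\<^esub> w) = \<one>\<^bsub>G\<^esub> \<longleftrightarrow> ?N #>\<^bsub>?F\<^esub> w = \<one>\<^bsub>?F Mod ?N\<^esub>"
      using hb Q.one_closed unfolding bij_betw_def inj_on_def by metis
    also have "\<dots> \<longleftrightarrow> w \<in> ?N"
      using F.coset_join1[OF _ w N.is_subgroup] F.coset_join2[OF w N.is_subgroup] N.subset
      by (auto simp: FactGroup_def)
    finally show "h (?N #>\<^bsub>?F\<^esub> w) = \<one>\<^bsub>G\<^esub> \<longleftrightarrow> w \<in> ?N" .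
  qed (use fin R in auto)
qed

context presented_group
begin

abbreviation "F \<equiv> free_group X"

definition word_elem :: "'a gword \<Rightarrow> 'g" where
  "word_elem w = \<theta> (reduce w)"

lemma word_elem_closed [simp]: "w \<in> words_over X \<Longrightarrow> word_elem w \<in> carrier G"
  unfolding word_elem_def using hom reduce_in_free_group by (auto simp: hom_def)

lemma word_elem_append:
  assumes "u \<in> words_over X" "v \<in> words_over X"
  shows "word_elem (u @ v) = word_elem u \<otimes> word_elem v"
proof -
  have "\<theta> (reduce u \<otimes>\<^bsub>F\<^esub> reduce v) = \<theta> (reduce u) \<otimes> \<theta> (reduce v)"
    using hom assms by (auto simp: hom_def reduce_in_free_group)
  then show ?thesis by (simp add: word_elem_def free_group_mult)
qed

lemma word_elem_reduce [simp]: "word_elem (reduce w) = word_elem w"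
  by (simp add: word_elem_def reduce_reduced)

lemma word_elem_Nil [simp]: "word_elem [] = \<one>"
  using word_elem_append[of "[]" "[]"] by (metis append_Nil l_cancel_one word_elem_closed words_over_Nil)

lemma word_elem_Cons:
  "l # w \<in> words_over X \<Longrightarrow> word_elem (l # w) = word_elem [l] \<otimes> word_elem w"
  using word_elem_append[of "[l]" w] by simp

lemma word_elem_inv_word:
  assumes "w \<in> words_over X"
  shows "word_elem (inv_word w) \<otimes> word_elem w = \<one>"
proof -
  have "word_elem (inv_word w @ w) = word_elem (reduce (inv_word w @ w))" by simp
  also have "reduce (inv_word w @ w) = []" by (simp add: inv_word_def reduce_inverse)
  finally show ?thesis using assms by (simp add: word_elem_append)
qed

lemma word_elem_surj:
  assumes "g \<in> carrier G"
  obtains w where "w \<in> words_over X" "word_elem w = g"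
proof -
  have "g \<in> \<theta> ` carrier F" unfolding surj by (rule assms)
  then obtain w where w: "w \<in> carrier F" "\<theta> w = g" by (elim imageE) simp
  then have "reduce w = w" by (simp add: free_group_carrier reduce_reduced)
  with w have "w \<in> words_over X" "word_elem w = g"
    unfolding word_elem_def free_group_carrier by simp_all
  then show thesis by (rule that)
qed

lemma null_word_iff: "w \<in> words_over X \<Longrightarrow> null_word X R w \<longleftrightarrow> word_elem w = \<one>"
  by (simp add: null_word_def word_elem_def kernel reduce_in_free_group)

lemma word_elem_conjugate:
  assumes "c \<in> conjugate_set F (R \<union> m_inv F ` R)"
  shows "c \<in> words_over X" "word_elem c = \<one>"
proof -
  interpret F: group F by (rule group_free_group)
  interpret N: normal "normal_closure F R" F by (rule F.normal_normal_closure[OF R])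
  obtain g r where g: "g \<in> carrier F" "r \<in> R \<union> m_inv F ` R" "c = inv\<^bsub>F\<^esub> g \<otimes>\<^bsub>F\<^esub> r \<otimes>\<^bsub>F\<^esub> g"
    using assms by (auto simp: conjugate_set_def)
  have "r' \<in> normal_closure F R" if "r' \<in> R" for r'
  proof -
    have "r' \<in> conjugate_set F R" using F.subset_conjugate_set[OF R] that by blast
    then show ?thesis unfolding normal_closure_def by (rule generate.incl)
  qed
  then have "r \<in> normal_closure F R" using g(2) N.m_inv_closed by auto
  then have c: "c \<in> normal_closure F R" using N.inv_op_closed1[OF g(1)] g(3) by simp
  then have cF: "c \<in> carrier F" using N.subset by blast
  then show "c \<in> words_over X" by (simp add: free_group_carrier)
  show "word_elem c = \<one>" using c cF kernel[OF cF] by (simp add: word_elem_def free_group_carrier reduce_reduced)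
qed

text \<open>The total cost of the path that a word describes from \<open>g\<close> in the Cayley graph.\<close>

fun cost :: "('g \<Rightarrow> 'g \<Rightarrow> int) \<Rightarrow> 'g \<Rightarrow> 'a gword \<Rightarrow> int" where
  "cost \<kappa> g [] = 0"
| "cost \<kappa> g (l # w) = \<kappa> g (g \<otimes> word_elem [l]) + cost \<kappa> (g \<otimes> word_elem [l]) w"

lemma cost_append:
  "g \<in> carrier G \<Longrightarrow> u \<in> words_over X \<Longrightarrow> v \<in> words_over X \<Longrightarrow>
    cost \<kappa> g (u @ v) = cost \<kappa> g u + cost \<kappa> (g \<otimes> word_elem u) v"
proof (induction u arbitrary: g)
  case (Cons l u)
  then show ?case using word_elem_Cons[of l u] by (simp add: m_assoc)
qed simp

context
  fixes \<kappa> :: "'g \<Rightarrow> 'g \<Rightarrow> int"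
  assumes antisym: "\<And>g h. \<kappa> h g = - \<kappa> g h"
begin

lemma cost_cancel:
  assumes "g \<in> carrier G" "l # w \<in> words_over X"
  shows "cost \<kappa> g (l # inv_letter l # w) = cost \<kappa> g w"
proof -
  have "word_elem [l] \<otimes> word_elem [inv_letter l] = \<one>"
    using word_elem_inv_word[of "[inv_letter l]"] assms by (simp add: inv_word_def)
  then have "g \<otimes> word_elem [l] \<otimes> word_elem [inv_letter l] = g"
    using assms by (simp add: m_assoc)
  then show ?thesis using antisym[of g "g \<otimes> word_elem [l]"] by simp
qed

lemma cost_reduce:
  "g \<in> carrier G \<Longrightarrow> w \<in> words_over X \<Longrightarrow> cost \<kappa> g (reduce w) = cost \<kappa> g w"
proof (induction w arbitrary: g)
  case (Cons l w)
  have *: "cost \<kappa> g (cancel_cons l v) = cost \<kappa> g (l # v)" if "v \<in> words_over X" for v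
    using that Cons.prems cost_cancel[of g l "tl v"] by (cases v) auto
  have "reduce (l # w) = cancel_cons l (reduce w)" by (simp add: reduce_def)
  then show ?case using *[of "reduce w"] Cons by (simp add: reduce_words_over)
qed (simp add: reduce_def)

lemma cost_inv_word:
  assumes "g \<in> carrier G" "w \<in> words_over X"
  shows "cost \<kappa> g (inv_word w) = - cost \<kappa> (g \<otimes> word_elem (inv_word w)) w"
proof -
  have "cost \<kappa> g (inv_word w @ w) = cost \<kappa> g (reduce (inv_word w @ w))"
    using cost_reduce assms by simp
  also have "reduce (inv_word w @ w) = []" by (simp add: inv_word_def reduce_inverse)
  finally show ?thesis using assms by (simp add: cost_append)
qed

text \<open>Going along a conjugator and back costs nothing, so a null word costs at most its area times the
  largest cost of a relator, over all starting points.\<close>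

lemma cost_le_area:
  assumes C: "\<And>g r. g \<in> carrier G \<Longrightarrow> r \<in> R \<Longrightarrow> \<bar>cost \<kappa> g r\<bar> \<le> C"
    and w: "null_word X R w" and g: "g \<in> carrier G"
  shows "\<bar>cost \<kappa> g w\<bar> \<le> C * int (word_area X R w)"
proof -
  interpret F: group F by (rule group_free_group)
  let ?S = "conjugate_set F (R \<union> m_inv F ` R)"
  have wX: "w \<in> words_over X" and wN: "reduce w \<in> normal_closure F R"
    using w by (auto simp: null_word_def)
  have conj: "\<bar>cost \<kappa> g c\<bar> \<le> C" if c: "c \<in> ?S" and g: "g \<in> carrier G" for c g
  proof -
    obtain p r where p: "p \<in> carrier F" "r \<in> R \<union> m_inv F ` R" "c = inv\<^bsub>F\<^esub> p \<otimes>\<^bsub>F\<^esub> r \<otimes>\<^bsub>F\<^esub> p"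
      using c unfolding conjugate_set_def by blast
    have r: "r \<in> ?S" "r \<in> words_over X"
    proof -
      have S: "R \<union> m_inv F ` R \<subseteq> carrier F" using R by auto
      then show "r \<in> ?S" using F.subset_conjugate_set p(2) by blast
      show "r \<in> words_over X" using S p(2) by (auto simp: free_group_carrier)
    qed
    have pX: "p \<in> words_over X" using p by (simp add: free_group_carrier)
    have rb: "\<bar>cost \<kappa> h r\<bar> \<le> C" if h: "h \<in> carrier G" for h
    proof (cases "r \<in> R")
      case False
      then obtain s where s: "s \<in> R" "r = inv\<^bsub>F\<^esub> s" using p by blast
      then have sX: "s \<in> carrier F" "s \<in> words_over X" using R by (auto simp: free_group_carrier)
      then have "cost \<kappa> h r = cost \<kappa> h (inv_word s)" using h s(2)
        by (simp add: free_group_inv cost_reduce)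
      then show ?thesis using C[OF _ s(1), of "h \<otimes> word_elem (inv_word s)"] h sX
        by (simp add: cost_inv_word)
    qed (use C h in auto)
    have "c = reduce (inv_word p @ r @ p)" using p by (simp add: free_group_inv free_group_mult)
    then have "cost \<kappa> g c = cost \<kappa> g (inv_word p @ r @ p)"
      using pX r g by (simp add: cost_reduce)
    also have "\<dots> = cost \<kappa> (g \<otimes> word_elem (inv_word p)) r"
      using pX r g word_elem_conjugate[OF r(1)] by (simp add: cost_append cost_inv_word)
    finally show ?thesis using rb g pX by simp
  qed
  have prod: "\<bar>cost \<kappa> g (foldr (\<otimes>\<^bsub>F\<^esub>) cs \<one>\<^bsub>F\<^esub>)\<bar> \<le> C * int (length cs) \<and>
      foldr (\<otimes>\<^bsub>F\<^esub>) cs \<one>\<^bsub>F\<^esub> \<in> words_over X" if "set cs \<subseteq> ?S" for cs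
    using that
  proof (induction cs)
    case Nil
    then show ?case by (simp add: free_group_one)
  next
    case (Cons c cs)
    then have c: "c \<in> words_over X" "word_elem c = \<one>" using word_elem_conjugate by auto
    define v where "v = foldr (\<otimes>\<^bsub>F\<^esub>) cs \<one>\<^bsub>F\<^esub>"
    have v: "\<bar>cost \<kappa> g v\<bar> \<le> C * int (length cs)" "v \<in> words_over X"
      using Cons by (auto simp: v_def)
    have "cost \<kappa> g (reduce (c @ v)) = cost \<kappa> g c + cost \<kappa> g v"
      using v c g by (simp add: cost_reduce cost_append)
    moreover have "foldr (\<otimes>\<^bsub>F\<^esub>) (c # cs) \<one>\<^bsub>F\<^esub> = reduce (c @ v)"
      by (simp add: v_def free_group_mult)
    moreover have "\<bar>cost \<kappa> g c\<bar> \<le> C" using conj Cons.prems g by simp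
    moreover have "C * int (length (c # cs)) = C + C * int (length cs)" by (simp add: algebra_simps)
    ultimately show ?case using v c by (auto simp: reduce_words_over)
  qed
  have "\<exists>N cs. length cs = N \<and> set cs \<subseteq> ?S \<and> reduce w = foldr (\<otimes>\<^bsub>F\<^esub>) cs \<one>\<^bsub>F\<^esub>"
    using F.generate_conjugates_product[OF R] wN unfolding normal_closure_def by blast
  from LeastI_ex[OF this, folded word_area_def]
  obtain cs where cs: "length cs = word_area X R w" "set cs \<subseteq> ?S"
      "reduce w = foldr (\<otimes>\<^bsub>F\<^esub>) cs \<one>\<^bsub>F\<^esub>"
    by blast
  have "cost \<kappa> g w = cost \<kappa> g (reduce w)" using wX g by (simp add: cost_reduce)
  then show ?thesis using prod[OF cs(2)] cs(1,3) by simp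
qed

end

lemma word_area_le_Dehn_function:
  assumes "null_word X R w" "length w \<le> m"
  shows "word_area X R w \<le> Dehn_function X R m"
proof -
  have "{w. null_word X R w \<and> length w \<le> m} \<subseteq> {w. set w \<subseteq> X \<times> UNIV \<and> length w \<le> m}"
    by (auto simp: null_word_def words_over_def)
  moreover have "finite {w. set w \<subseteq> X \<times> (UNIV :: bool set) \<and> length w \<le> m}"
    using finite_X by (intro finite_lists_length_le) auto
  ultimately have "finite {w. null_word X R w \<and> length w \<le> m}" by (rule finite_subset)
  then have "finite (word_area X R ` {w. null_word X R w \<and> length w \<le> m})" by (rule finite_imageI)
  then show ?thesis unfolding Dehn_function_def using assms
    by (intro Max_ge) (auto simp: setcompr_eq_image)
qed

end

section \<open>The action on the lattice\<close>

lemma Nil_in_free_group [simp]: "[] \<in> carrier (free_group X)"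
  by (simp add: free_group_carrier)

locale free_lattice_action =
  fixes d n :: nat and \<tau> :: "nat gword \<Rightarrow> int mat"
  assumes \<tau>: "\<tau> \<in> hom (free_group {..<n}) (GL_int d)"
begin

abbreviation "Fn \<equiv> free_group {..<n}"
abbreviation "G \<equiv> lattice_by_free d n \<tau>"

definition T :: "nat gword \<Rightarrow> (nat \<Rightarrow> int) \<Rightarrow> nat \<Rightarrow> int" where
  "T h v = (\<lambda>j. if j < d then \<Sum>i<d. v i * \<tau> h $$ (i, j) else 0)"

sublocale Fn: group Fn by (rule group_free_group)
sublocale G: group G by (rule group_lattice_by_free[OF \<tau>])

lemma \<tau>_carrier: "h \<in> carrier Fn \<Longrightarrow> \<tau> h \<in> carrier_mat d d"
  using \<tau> by (auto simp: hom_def GL_int_def units_of_def Units_def ring_mat_simps)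

lemma \<tau>_mult: "g \<in> carrier Fn \<Longrightarrow> h \<in> carrier Fn \<Longrightarrow> \<tau> (g \<otimes>\<^bsub>Fn\<^esub> h) = \<tau> g * \<tau> h"
  using \<tau> by (auto simp: hom_def GL_int_def units_of_def ring_mat_simps)

lemma \<tau>_one: "\<tau> [] = 1\<^sub>m d"
proof -
  interpret GL: group "GL_int d" by (rule group_GL_int)
  have "\<tau> \<one>\<^bsub>Fn\<^esub> = \<one>\<^bsub>GL_int d\<^esub>" by (rule hom_one[OF \<tau> Fn.is_group GL.is_group])
  then show ?thesis by (simp add: free_group_one GL_int_def units_of_def ring_mat_simps)
qed

lemma T_unit_vector: "i < d \<Longrightarrow> T h (unit_vector i) j = (if j < d then \<tau> h $$ (i, j) else 0)"
  unfolding T_def unit_vector_def by (simp add: of_bool_def if_distrib[of "\<lambda>x. x * _"] cong: if_cong)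

lemma T_mult:
  assumes "g \<in> carrier Fn" "h \<in> carrier Fn"
  shows "T (g \<otimes>\<^bsub>Fn\<^esub> h) v = T h (T g v)"
proof
  fix j
  have *: "\<tau> (g \<otimes>\<^bsub>Fn\<^esub> h) $$ (i, j) = (\<Sum>k<d. \<tau> g $$ (i, k) * \<tau> h $$ (k, j))" if "i < d" "j < d" for i
    using that \<tau>_carrier[OF assms(1)] \<tau>_carrier[OF assms(2)]
    by (simp add: \<tau>_mult[OF assms] scalar_prod_def atLeast0LessThan)
  show "T (g \<otimes>\<^bsub>Fn\<^esub> h) v j = T h (T g v) j"
  proof (cases "j < d")
    case True
    have "T (g \<otimes>\<^bsub>Fn\<^esub> h) v j = (\<Sum>i<d. \<Sum>k<d. v i * (\<tau> g $$ (i, k) * \<tau> h $$ (k, j)))"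
      using True by (simp add: T_def * sum_distrib_left)
    also have "\<dots> = (\<Sum>k<d. \<Sum>i<d. v i * (\<tau> g $$ (i, k) * \<tau> h $$ (k, j)))" by (rule sum.swap)
    also have "\<dots> = T h (T g v) j" using True by (simp add: T_def sum_distrib_right mult.assoc)
    finally show ?thesis .
  qed (simp add: T_def)
qed

sublocale act: lattice_action Fn d T
proof
  show "T g v \<in> integer_vectors d" for g v by (simp add: T_def integer_vectors_def)
  show "T g v j = (\<Sum>i<d. v i * T g (unit_vector i) j)" for g v j
  proof -
    have "(\<Sum>i<d. v i * T g (unit_vector i) j) = (\<Sum>i<d. v i * (if j < d then \<tau> g $$ (i, j) else 0))"
      by (intro sum.cong) (simp_all add: T_unit_vector)
    then show ?thesis by (simp add: T_def)
  qed
  show "T (g \<otimes>\<^bsub>Fn\<^esub> h) v = T h (T g v)" if "g \<in> carrier Fn" "h \<in> carrier Fn" for g h v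
    using that by (rule T_mult)
  show "T \<one>\<^bsub>Fn\<^esub> v = v" if "v \<in> integer_vectors d" for v
  proof
    fix j
    show "T \<one>\<^bsub>Fn\<^esub> v j = v j"
    proof (cases "j < d")
      case True
      have "T \<one>\<^bsub>Fn\<^esub> v j = (\<Sum>i<d. v i * (if i = j then 1 else 0))"
        using True by (simp add: T_def free_group_one \<tau>_one)
      also have "\<dots> = (\<Sum>i<d. if i = j then v i else 0)" by (intro sum.cong) auto
      finally have "T \<one>\<^bsub>Fn\<^esub> v j = (\<Sum>i<d. if i = j then v i else 0)" .
      then show ?thesis using True by simp
    next
      case False
      then show ?thesis using that by (simp add: T_def integer_vectors_def)
    qed
  qed
qed

definition vec_part :: "nat gword \<times> int vec \<Rightarrow> nat \<Rightarrow> int" where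
  "vec_part g = (\<lambda>i. if i < d then snd g $ i else 0)"

definition elem :: "nat gword \<Rightarrow> (nat \<Rightarrow> int) \<Rightarrow> nat gword \<times> int vec" where
  "elem b v = (b, vec d v)"

lemma fst_elem [simp]: "fst (elem b v) = b"
  by (simp add: elem_def)

lemma vec_part_elem [simp]: "v \<in> integer_vectors d \<Longrightarrow> vec_part (elem b v) = v"
  by (auto simp: elem_def vec_part_def integer_vectors_def)

lemma carrier_G: "g \<in> carrier G \<longleftrightarrow> fst g \<in> carrier Fn \<and> snd g \<in> carrier_vec d"
  by (cases g) (simp add: lattice_by_free_def semidirect_def monoid_vec_simps)

lemma elem_closed [simp]: "b \<in> carrier Fn \<Longrightarrow> elem b v \<in> carrier G"
  by (simp add: carrier_G elem_def)

lemma fst_closed [simp]: "g \<in> carrier G \<Longrightarrow> fst g \<in> carrier Fn"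
  by (simp add: carrier_G)

lemma vec_part_closed [simp]: "vec_part g \<in> integer_vectors d"
  by (simp add: vec_part_def integer_vectors_def)

lemma G_eqI:
  assumes "g \<in> carrier G" "h \<in> carrier G" "fst g = fst h" "vec_part g = vec_part h"
  shows "g = h"
proof -
  have "snd g $ i = snd h $ i" if "i < d" for i
    using fun_cong[OF assms(4), of i] that by (simp add: vec_part_def)
  then have "snd g = snd h" using assms by (intro eq_vecI) (auto simp: carrier_G)
  with assms(3) show ?thesis by (simp add: prod_eq_iff)
qed

lemma fst_mult [simp]: "fst (g \<otimes>\<^bsub>G\<^esub> h) = fst g \<otimes>\<^bsub>Fn\<^esub> fst h"
  by (cases g; cases h) (simp add: lattice_by_free_def semidirect_def)

lemma vec_part_mult:
  assumes "g \<in> carrier G" "h \<in> carrier G"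
  shows "vec_part (g \<otimes>\<^bsub>G\<^esub> h) = T (fst h) (vec_part g) + vec_part h"
proof
  fix j
  have s: "snd (g \<otimes>\<^bsub>G\<^esub> h) = row_mult (snd g) (\<tau> (fst h)) + snd h"
    by (cases g; cases h) (simp add: lattice_by_free_def semidirect_def monoid_vec_simps)
  show "vec_part (g \<otimes>\<^bsub>G\<^esub> h) j = (T (fst h) (vec_part g) + vec_part h) j"
    using assms \<tau>_carrier[OF fst_closed[OF assms(2)]]
    by (auto simp: vec_part_def s T_def row_mult_def carrier_G scalar_prod_def atLeast0LessThan
        intro!: sum.cong)
qed

lemma fst_one [simp]: "fst \<one>\<^bsub>G\<^esub> = []"
  by (simp add: lattice_by_free_def semidirect_def free_group_one)

lemma vec_part_one [simp]: "vec_part \<one>\<^bsub>G\<^esub> = 0"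
  by (auto simp: lattice_by_free_def semidirect_def monoid_vec_simps vec_part_def)

text \<open>Conjugacy as an equation without inverses, which is the form that is tested in computations.\<close>

lemma conjugate_in_G:
  assumes "x \<in> carrier G" "y \<in> carrier G"
  shows "conjugate_in G x y \<longleftrightarrow> (\<exists>g\<in>carrier G. x \<otimes>\<^bsub>G\<^esub> g = g \<otimes>\<^bsub>G\<^esub> y)"
proof -
  have "inv\<^bsub>G\<^esub> g \<otimes>\<^bsub>G\<^esub> x \<otimes>\<^bsub>G\<^esub> g = y \<longleftrightarrow> x \<otimes>\<^bsub>G\<^esub> g = g \<otimes>\<^bsub>G\<^esub> y" if "g \<in> carrier G" for g
    using that assms by (metis G.inv_closed G.inv_solve_left G.m_assoc G.m_closed)
  then show ?thesis by (auto simp: conjugate_in_def)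
qed

end

section \<open>Area and the growth of the action\<close>

context free_lattice_action
begin

definition vnorm :: "(nat \<Rightarrow> int) \<Rightarrow> int" where
  "vnorm v = (\<Sum>i<d. \<bar>v i\<bar>)"

definition opnorm :: "nat gword \<Rightarrow> int" where
  "opnorm h = (\<Sum>i<d. vnorm (T h (unit_vector i)))"

lemma vnorm_nonneg [simp]: "0 \<le> vnorm v"
  by (simp add: vnorm_def sum_nonneg)

lemma vnorm_zero [simp]: "vnorm 0 = 0"
  by (simp add: vnorm_def)

lemma vnorm_add: "vnorm (u + v) \<le> vnorm u + vnorm v"
  by (simp add: vnorm_def sum_mono flip: sum.distrib)

lemma vnorm_minus [simp]: "vnorm (- v) = vnorm v"
  by (simp add: vnorm_def)

lemma vnorm_diff: "vnorm (u - v) \<le> vnorm u + vnorm v"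
  using vnorm_add[of u "- v"] by simp

lemma vnorm_unit_vector: "i < d \<Longrightarrow> vnorm (unit_vector i) = 1"
proof -
  assume "i < d"
  have "vnorm (unit_vector i) = (\<Sum>j<d. if i = j then 1 else 0)"
    unfolding vnorm_def unit_vector_def by (intro sum.cong) auto
  then show ?thesis using \<open>i < d\<close> by simp
qed

lemma opnorm_nonneg [simp]: "0 \<le> opnorm h"
  by (simp add: opnorm_def sum_nonneg)

lemma vnorm_T_unit_vector: "i < d \<Longrightarrow> vnorm (T h (unit_vector i)) \<le> opnorm h"
  unfolding opnorm_def by (rule member_le_sum) auto

lemma vnorm_T: "vnorm (T h v) \<le> opnorm h * vnorm v"
proof -
  have "vnorm (T h v) \<le> (\<Sum>j<d. \<Sum>i<d. \<bar>v i\<bar> * \<bar>T h (unit_vector i) j\<bar>)"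
    unfolding vnorm_def
  proof (rule sum_mono)
    fix j
    show "\<bar>T h v j\<bar> \<le> (\<Sum>i<d. \<bar>v i\<bar> * \<bar>T h (unit_vector i) j\<bar>)"
      by (subst act.T_expand) (rule order_trans[OF sum_abs], simp add: abs_mult)
  qed
  also have "\<dots> = (\<Sum>i<d. \<bar>v i\<bar> * vnorm (T h (unit_vector i)))"
    unfolding vnorm_def sum_distrib_left by (rule sum.swap)
  also have "\<dots> \<le> (\<Sum>i<d. \<bar>v i\<bar> * opnorm h)"
    by (intro sum_mono mult_left_mono) (auto simp: vnorm_T_unit_vector)
  also have "\<dots> = opnorm h * vnorm v" by (simp add: vnorm_def sum_distrib_left mult.commute)
  finally show ?thesis .
qed

lemma opnorm_mult:
  assumes "g \<in> carrier Fn" "h \<in> carrier Fn"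
  shows "opnorm (g \<otimes>\<^bsub>Fn\<^esub> h) \<le> opnorm g * opnorm h"
proof -
  have "opnorm (g \<otimes>\<^bsub>Fn\<^esub> h) = (\<Sum>i<d. vnorm (T h (T g (unit_vector i))))"
    using assms by (simp add: opnorm_def T_mult)
  also have "\<dots> \<le> (\<Sum>i<d. opnorm h * vnorm (T g (unit_vector i)))" by (intro sum_mono vnorm_T)
  also have "\<dots> = opnorm g * opnorm h"
    unfolding opnorm_def[of g] sum_distrib_right by (simp add: mult.commute)
  finally show ?thesis .
qed

text \<open>The coordinate of \<open>g\<close> in which right multiplication by elements of the free group
  is invisible.\<close>

definition position :: "nat gword \<times> int vec \<Rightarrow> nat \<Rightarrow> int" where
  "position g = T (inv\<^bsub>Fn\<^esub> fst g) (vec_part g)"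

text \<open>Whether \<open>g\<close> lies beyond the edge from the root of the tree to \<open>s\<close>.\<close>

definition far_side :: "nat \<times> bool \<Rightarrow> nat gword \<times> int vec \<Rightarrow> int" where
  "far_side s g = of_bool (fst g \<noteq> [] \<and> hd (fst g) = s)"

text \<open>The truncation gives the same height to all vectors of norm at least \<open>L\<close>. Without
  it, the alternating sum of the heights of the corners of a large parallelogram could vanish.\<close>

definition height :: "int \<Rightarrow> nat gword \<times> int vec \<Rightarrow> int" where
  "height L g = min (vnorm (position g)) L"

text \<open>Only edges whose ends are on different sides contribute. The sum of the heights of both ends,
  instead of the height of one of them, makes the function antisymmetric.\<close>

definition crossing :: "int \<Rightarrow> nat \<times> bool \<Rightarrow> nat gword \<times> int vec \<Rightarrow> nat gword \<times> int vec \<Rightarrow> int" where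
  "crossing L s g h = (far_side s h - far_side s g) * (height L g + height L h)"

lemma crossing_antisym: "crossing L s h g = - crossing L s g h"
  by (simp add: crossing_def algebra_simps)

lemma position_mult:
  assumes "g \<in> carrier G" "k \<in> carrier G"
  shows "position (g \<otimes>\<^bsub>G\<^esub> k) = position g + T (inv\<^bsub>Fn\<^esub> (fst g \<otimes>\<^bsub>Fn\<^esub> fst k)) (vec_part k)"
proof -
  have gk: "fst g \<in> carrier Fn" "fst k \<in> carrier Fn" using assms by auto
  have "T (inv\<^bsub>Fn\<^esub> (fst g \<otimes>\<^bsub>Fn\<^esub> fst k)) (T (fst k) (vec_part g)) =
      T (inv\<^bsub>Fn\<^esub> fst g) (T (inv\<^bsub>Fn\<^esub> fst k) (T (fst k) (vec_part g)))"
    using gk by (simp add: Fn.inv_mult_group T_mult)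
  also have "\<dots> = position g" using gk by (simp add: act.T_inv position_def)
  finally show ?thesis using assms
    by (simp add: position_def[of "g \<otimes>\<^bsub>G\<^esub> k"] vec_part_mult act.T_add)
qed

lemma G_eq_positionI:
  assumes "g \<in> carrier G" "h \<in> carrier G" "fst g = fst h" "position g = position h"
  shows "g = h"
proof (rule G_eqI)
  have "T (fst g) (position g) = T (fst h) (position h)" using assms by simp
  then show "vec_part g = vec_part h" using assms by (simp add: position_def act.T_inv)
qed (use assms in auto)

lemma finite_short_words: "finite {b \<in> carrier Fn. length b \<le> l}"
proof (rule finite_subset)
  show "{b \<in> carrier Fn. length b \<le> l} \<subseteq> {w. set w \<subseteq> {..<n} \<times> UNIV \<and> length w \<le> l}"
    by (auto simp: free_group_carrier words_over_def)
qed (intro finite_lists_length_le, auto)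

lemma far_side_mult:
  assumes "g \<in> carrier G" "k \<in> carrier G" "length (fst k) < length (fst g)"
  shows "far_side s (g \<otimes>\<^bsub>G\<^esub> k) = far_side s g"
proof -
  have "fst (g \<otimes>\<^bsub>G\<^esub> k) = reduce (fst g @ fst k)" by (simp add: free_group_mult)
  moreover have "reduced (fst g)" "reduced (fst k)"
    using assms by (auto simp: carrier_G free_group_carrier)
  moreover have "fst g \<noteq> []" using assms(3) by auto
  ultimately show ?thesis using hd_reduce_append[of "fst g" "fst k"] assms(3)
    by (simp add: far_side_def)
qed

text \<open>Far from the base edge of the tree the side does not change, and there are only finitely many
  places near it; hence the bound is uniform in \<open>g\<close>.\<close>

lemma height_change_bounded:
  assumes k: "k1 \<in> carrier G" "k2 \<in> carrier G" and x: "x \<in> carrier G"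
  shows "\<exists>C\<ge>0. \<forall>g\<in>carrier G. \<forall>L s.
    \<bar>far_side s (g \<otimes>\<^bsub>G\<^esub> k1) - far_side s (g \<otimes>\<^bsub>G\<^esub> k2)\<bar> * \<bar>height L (g \<otimes>\<^bsub>G\<^esub> x) - height L g\<bar> \<le> C"
proof -
  define D where "D b = vnorm (T (inv\<^bsub>Fn\<^esub> (b \<otimes>\<^bsub>Fn\<^esub> fst x)) (vec_part x))" for b
  define S where "S = {b \<in> carrier Fn. length b \<le> max (length (fst k1)) (length (fst k2))}"
  have S: "finite S" unfolding S_def by (rule finite_short_words)
  show ?thesis
  proof (intro exI[of _ "\<Sum>b\<in>S. D b"] conjI ballI allI)
    show "0 \<le> (\<Sum>b\<in>S. D b)" by (intro sum_nonneg) (simp add: D_def)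
    fix g L s assume g: "g \<in> carrier G"
    let ?f = "far_side s (g \<otimes>\<^bsub>G\<^esub> k1) - far_side s (g \<otimes>\<^bsub>G\<^esub> k2)"
    let ?h = "height L (g \<otimes>\<^bsub>G\<^esub> x) - height L g"
    show "\<bar>?f\<bar> * \<bar>?h\<bar> \<le> (\<Sum>b\<in>S. D b)"
    proof (cases "fst g \<in> S")
      case True
      have "\<bar>?h\<bar> \<le> D (fst g)"
        using vnorm_add[of "position g" "T (inv\<^bsub>Fn\<^esub> (fst g \<otimes>\<^bsub>Fn\<^esub> fst x)) (vec_part x)"]
          vnorm_diff[of "position (g \<otimes>\<^bsub>G\<^esub> x)" "T (inv\<^bsub>Fn\<^esub> (fst g \<otimes>\<^bsub>Fn\<^esub> fst x)) (vec_part x)"]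
        unfolding height_def D_def position_mult[OF g x] by (auto simp: min_def)
      also have "\<dots> \<le> (\<Sum>b\<in>S. D b)" using S True by (intro member_le_sum) (auto simp: D_def)
      finally have "\<bar>?h\<bar> \<le> (\<Sum>b\<in>S. D b)" .
      moreover have "\<bar>?f\<bar> \<le> 1" by (simp add: far_side_def)
      ultimately show ?thesis using mult_mono[of "\<bar>?f\<bar>" 1 "\<bar>?h\<bar>" "\<Sum>b\<in>S. D b"] by simp
    next
      case False
      then have "length (fst k1) < length (fst g)" "length (fst k2) < length (fst g)"
        using g by (auto simp: S_def)
      then have "?f = 0" using far_side_mult g k by simp
      moreover have "0 \<le> (\<Sum>b\<in>S. D b)" by (intro sum_nonneg) (simp add: D_def)
      ultimately show ?thesis by simp
    qed
  qed
qed

end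

locale presented_free_lattice_action = free_lattice_action d n \<tau> +
  pres: presented_group "lattice_by_free d n \<tau>" X R \<theta>
  for d n \<tau> and X :: "nat set" and R \<theta>
begin

abbreviation "val \<equiv> pres.word_elem"
abbreviation "cost L s \<equiv> pres.cost (crossing L s)"

text \<open>Up to a bounded error, the height can be regarded as constant along a fixed word, because it
  changes little wherever the word can cross the base edge. Crossings then cancel, and only the
  sides of the two ends matter.\<close>

lemma cost_approx:
  assumes "w \<in> words_over X"
  shows "\<exists>C\<ge>0. \<forall>g\<in>carrier G. \<forall>L s.
    \<bar>cost L s g w - 2 * (far_side s (g \<otimes>\<^bsub>G\<^esub> val w) - far_side s g) * height L g\<bar> \<le> C"
  using assms
proof (induction w)
  case Nil
  show ?case by (intro exI[of _ 0]) auto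
next
  case (Cons l w)
  have lX: "[l] \<in> words_over X" and wX: "w \<in> words_over X" using Cons.prems by auto
  let ?x = "val [l]" and ?z = "val (l # w)"
  have x: "?x \<in> carrier G" and z: "?z \<in> carrier G" using lX Cons.prems by (auto simp del: words_over_Cons)
  have zx: "?z = ?x \<otimes>\<^bsub>G\<^esub> val w" using pres.word_elem_Cons[OF Cons.prems] .
  obtain C where C: "C \<ge> 0" "\<And>g L s. g \<in> carrier G \<Longrightarrow>
    \<bar>cost L s g w - 2 * (far_side s (g \<otimes>\<^bsub>G\<^esub> val w) - far_side s g) * height L g\<bar> \<le> C"
    using Cons.IH[OF wX] by auto
  obtain C1 where C1: "C1 \<ge> 0" "\<And>g L s. g \<in> carrier G \<Longrightarrow>
    \<bar>far_side s (g \<otimes>\<^bsub>G\<^esub> ?x) - far_side s (g \<otimes>\<^bsub>G\<^esub> \<one>\<^bsub>G\<^esub>)\<bar> * \<bar>height L (g \<otimes>\<^bsub>G\<^esub> ?x) - height L g\<bar> \<le> C1"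
    using height_change_bounded[OF x G.one_closed x] by auto
  obtain C2 where C2: "C2 \<ge> 0" "\<And>g L s. g \<in> carrier G \<Longrightarrow>
    \<bar>far_side s (g \<otimes>\<^bsub>G\<^esub> ?z) - far_side s (g \<otimes>\<^bsub>G\<^esub> ?x)\<bar> * \<bar>height L (g \<otimes>\<^bsub>G\<^esub> ?x) - height L g\<bar> \<le> C2"
    using height_change_bounded[OF z x x] by auto
  show ?case
  proof (intro exI[of _ "C + C1 + 2 * C2"] conjI ballI allI)
    show "0 \<le> C + C1 + 2 * C2" using C C1 C2 by simp
    fix g L s assume g: "g \<in> carrier G"
    define y where "y = g \<otimes>\<^bsub>G\<^esub> ?x"
    have y: "y \<in> carrier G" using g x by (simp add: y_def)
    have yz: "y \<otimes>\<^bsub>G\<^esub> val w = g \<otimes>\<^bsub>G\<^esub> ?z" using g x wX unfolding y_def zx by (simp add: G.m_assoc)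
    define a b c where "a = far_side s g" and "b = far_side s y" and "c = far_side s (g \<otimes>\<^bsub>G\<^esub> ?z)"
    define p q where "p = height L g" and "q = height L y"
    have "cost L s g (l # w) = (b - a) * (p + q) + cost L s y w"
      by (simp add: crossing_def y_def a_def b_def p_def q_def)
    moreover have "\<bar>cost L s y w - 2 * (c - b) * q\<bar> \<le> C"
      using C(2)[OF y, of L s] yz by (simp add: b_def c_def q_def)
    moreover have "\<bar>(b - a) * (q - p)\<bar> \<le> C1" "\<bar>(c - b) * (q - p)\<bar> \<le> C2"
      using C1(2)[OF g, of s L] C2(2)[OF g, of s L] g
      by (simp_all add: abs_mult a_def b_def c_def p_def q_def y_def)
    moreover have "(b - a) * (p + q) + u - 2 * (c - a) * p =
        (b - a) * (q - p) + (u - 2 * (c - b) * q) + 2 * ((c - b) * (q - p))" for u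
      by (simp add: algebra_simps)
    moreover have "\<bar>x + y + 2 * z\<bar> \<le> C + C1 + 2 * C2"
      if "\<bar>x\<bar> \<le> C1" "\<bar>y\<bar> \<le> C" "\<bar>z\<bar> \<le> C2" for x y z
      using that by linarith
    ultimately have "\<bar>cost L s g (l # w) - 2 * (c - a) * p\<bar> \<le> C + C1 + 2 * C2" by metis
    then show "\<bar>cost L s g (l # w) - 2 * (far_side s (g \<otimes>\<^bsub>G\<^esub> ?z) - far_side s g) * height L g\<bar>
        \<le> C + C1 + 2 * C2"
      unfolding a_def c_def p_def .
  qed
qed

lemma relator_cost_bounded:
  "\<exists>C\<ge>0. \<forall>g\<in>carrier G. \<forall>r\<in>R. \<forall>L s. \<bar>cost L s g r\<bar> \<le> C"
proof -
  have "\<exists>C\<ge>0. \<forall>g\<in>carrier G. \<forall>L s. \<bar>cost L s g r\<bar> \<le> C" if r: "r \<in> R" for r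
  proof -
    have "r \<in> words_over X" using pres.R r by (auto simp: free_group_carrier)
    moreover have "val r = \<one>\<^bsub>G\<^esub>"
    proof (rule pres.word_elem_conjugate)
      interpret F: group "free_group X" by (rule group_free_group)
      show "r \<in> conjugate_set (free_group X) (R \<union> m_inv (free_group X) ` R)"
        using F.subset_conjugate_set[of "R \<union> m_inv (free_group X) ` R"] pres.R r by auto
    qed
    ultimately show ?thesis using cost_approx[of r] by simp
  qed
  then obtain C where C: "\<And>r. r \<in> R \<Longrightarrow> C r \<ge> 0"
      "\<And>r g L s. r \<in> R \<Longrightarrow> g \<in> carrier G \<Longrightarrow> \<bar>cost L s g r\<bar> \<le> C r"
    by metis
  show ?thesis
  proof (intro exI[of _ "\<Sum>r\<in>R. C r"] conjI ballI allI)
    show "0 \<le> (\<Sum>r\<in>R. C r)" by (intro sum_nonneg C)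
    fix g r L s assume "g \<in> carrier G" "r \<in> R"
    then have "\<bar>cost L s g r\<bar> \<le> C r" by (intro C)
    also have "C r \<le> (\<Sum>r\<in>R. C r)" using pres.finite_R \<open>r \<in> R\<close> C by (intro member_le_sum) auto
    finally show "\<bar>cost L s g r\<bar> \<le> (\<Sum>r\<in>R. C r)" .
  qed
qed

lemma cost_le_Dehn:
  "\<exists>C\<ge>0. \<forall>g\<in>carrier G. \<forall>w m L s. null_word X R w \<longrightarrow> length w \<le> m \<longrightarrow>
    \<bar>cost L s g w\<bar> \<le> C * int (Dehn_function X R m)"
proof -
  obtain C where C: "C \<ge> 0" "\<And>g r L s. g \<in> carrier G \<Longrightarrow> r \<in> R \<Longrightarrow> \<bar>cost L s g r\<bar> \<le> C"
    using relator_cost_bounded by auto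
  show ?thesis
  proof (intro exI[of _ C] conjI ballI allI impI)
    fix g w m L s assume g: "g \<in> carrier G" and w: "null_word X R w" "length w \<le> m"
    have "\<bar>cost L s g w\<bar> \<le> C * int (word_area X R w)"
      by (rule pres.cost_le_area[OF crossing_antisym C(2) w(1) g])
    also have "\<dots> \<le> C * int (Dehn_function X R m)"
      using pres.word_area_le_Dehn_function[OF w] C(1) by (intro mult_left_mono) auto
    finally show "\<bar>cost L s g w\<bar> \<le> C * int (Dehn_function X R m)" .
  qed (rule C)
qed

text \<open>Words over \<open>X\<close> for the letters of the free group and for the unit vectors. The
  presentation is arbitrary, and these need not be among its generators.\<close>

definition lift_letter :: "nat \<times> bool \<Rightarrow> nat gword" where
  "lift_letter l = (SOME w. w \<in> words_over X \<and> val w = elem [l] 0)"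

definition lift_word :: "nat gword \<Rightarrow> nat gword" where
  "lift_word h = concat (map lift_letter h)"

definition lift_unit :: "nat \<Rightarrow> nat gword" where
  "lift_unit i = (SOME w. w \<in> words_over X \<and> val w = elem [] (unit_vector i))"

lemma letter_carrier: "fst l < n \<Longrightarrow> [l] \<in> carrier Fn"
  by (simp add: free_group_carrier reduced_def)

lemma lift_letter:
  assumes "fst l < n"
  shows "lift_letter l \<in> words_over X \<and> val (lift_letter l) = elem [l] 0"
proof -
  have "elem [l] 0 \<in> carrier G" using letter_carrier[OF assms] by simp
  then obtain w where "w \<in> words_over X" "val w = elem [l] 0" by (rule pres.word_elem_surj)
  then show ?thesis unfolding lift_letter_def
    by (intro someI[of "\<lambda>w. w \<in> words_over X \<and> val w = elem [l] 0"]) simp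
qed

lemma lift_unit: "lift_unit i \<in> words_over X \<and> val (lift_unit i) = elem [] (unit_vector i)"
proof -
  have "elem [] (unit_vector i) \<in> carrier G" by (simp add: free_group_carrier)
  then obtain w where "w \<in> words_over X" "val w = elem [] (unit_vector i)" by (rule pres.word_elem_surj)
  then show ?thesis unfolding lift_unit_def
    by (intro someI[of "\<lambda>w. w \<in> words_over X \<and> val w = elem [] (unit_vector i)"]) simp
qed

lemma elem_mult_0:
  assumes "b \<in> carrier Fn" "c \<in> carrier Fn"
  shows "elem b 0 \<otimes>\<^bsub>G\<^esub> elem c 0 = elem (b \<otimes>\<^bsub>Fn\<^esub> c) 0"
proof (rule G_eqI)
  have "(0 :: nat \<Rightarrow> int) \<in> integer_vectors d" by (simp add: integer_vectors_def)
  then show "vec_part (elem b 0 \<otimes>\<^bsub>G\<^esub> elem c 0) = vec_part (elem (b \<otimes>\<^bsub>Fn\<^esub> c) 0)"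
    using assms by (simp add: vec_part_mult)
qed (use assms in auto)

lemma lift_word:
  assumes "h \<in> words_over {..<n}"
  shows "lift_word h \<in> words_over X \<and> val (lift_word h) = elem (reduce h) (0 :: nat \<Rightarrow> int)"
  using assms
proof (induction h)
  case Nil
  have "(0 :: nat \<Rightarrow> int) \<in> integer_vectors d" by (simp add: integer_vectors_def)
  then have "\<one>\<^bsub>G\<^esub> = elem [] 0" by (intro G_eqI) (auto simp: free_group_carrier)
  moreover have "val (lift_word []) = \<one>\<^bsub>G\<^esub>" "lift_word [] \<in> words_over X" "reduce [] = ([] :: nat gword)"
    by (simp_all add: lift_word_def reduce_def)
  ultimately show ?case by metis
next
  case (Cons l h)
  then have l: "fst l < n" and h: "h \<in> words_over {..<n}" by auto
  have "elem [l] 0 \<otimes>\<^bsub>G\<^esub> elem (reduce h) 0 = elem (reduce (l # h)) 0"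
    using elem_mult_0[OF letter_carrier[OF l] reduce_in_free_group[OF h]] reduce_append_reduce(2)[of "[l]" h]
    by (simp add: free_group_mult)
  moreover have IH: "lift_word h \<in> words_over X" "val (lift_word h) = elem (reduce h) 0"
    using Cons.IH[OF h] by blast+
  moreover have app: "lift_word (l # h) = lift_letter l @ lift_word h" by (simp add: lift_word_def)
  moreover have "val (lift_word (l # h)) = val (lift_letter l) \<otimes>\<^bsub>G\<^esub> val (lift_word h)"
    unfolding app using lift_letter[OF l] IH by (intro pres.word_elem_append) auto
  moreover have "lift_word (l # h) \<in> words_over X" using app lift_letter[OF l] IH by simp
  ultimately show ?case using lift_letter[OF l] by metis
qed

lemma length_lift_word: "\<exists>K. \<forall>h\<in>words_over {..<n}. length (lift_word h) \<le> K * length h"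
proof -
  define K where "K = (\<Sum>l\<in>{..<n} \<times> UNIV. length (lift_letter l))"
  have K: "length (lift_letter l) \<le> K" if "fst l < n" for l
    unfolding K_def using that by (intro member_le_sum) (auto simp: mem_Times_iff)
  have "length (lift_word h) \<le> K * length h" if "h \<in> words_over {..<n}" for h
    using that
  proof (induction h)
    case (Cons l h)
    then show ?case using K[of l] by (simp add: lift_word_def)
  qed (simp add: lift_word_def)
  then show ?thesis by blast
qed

text \<open>Bookkeeping for paths: in terms of these two coordinates every step is a translation.\<close>

definition located :: "nat gword \<times> int vec \<Rightarrow> nat gword \<Rightarrow> (nat \<Rightarrow> int) \<Rightarrow> bool" where
  "located g b y \<longleftrightarrow> g \<in> carrier G \<and> fst g = b \<and> position g = y"

lemma located_lift_word:
  assumes "located g b y" "h \<in> words_over {..<n}"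
  shows "located (g \<otimes>\<^bsub>G\<^esub> val (lift_word h)) (reduce (b @ h)) y"
proof -
  have "(0 :: nat \<Rightarrow> int) \<in> integer_vectors d" by (simp add: integer_vectors_def)
  then show ?thesis using assms lift_word[OF assms(2)] reduce_in_free_group[OF assms(2)]
    by (auto simp: located_def position_mult free_group_mult)
qed

lemma located_lift_unit:
  assumes g: "located g b y" and i: "i < d"
  shows "located (g \<otimes>\<^bsub>G\<^esub> val (lift_unit i)) b (y + T (inv\<^bsub>Fn\<^esub> b) (unit_vector i))"
    and "located (g \<otimes>\<^bsub>G\<^esub> val (inv_word (lift_unit i))) b (y - T (inv\<^bsub>Fn\<^esub> b) (unit_vector i))"
proof -
  have *: "located (g \<otimes>\<^bsub>G\<^esub> val (lift_unit i)) (fst g) (position g + T (inv\<^bsub>Fn\<^esub> fst g) (unit_vector i))"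
    if g: "g \<in> carrier G" for g
  proof -
    have k: "elem [] (unit_vector i) \<in> carrier G" by (simp add: free_group_carrier)
    have e: "fst g \<otimes>\<^bsub>Fn\<^esub> [] = fst g" using Fn.r_one[OF fst_closed[OF g]] by (simp add: free_group_one)
    have "vec_part (elem [] (unit_vector i)) = unit_vector i" using i by simp
    with position_mult[OF g k]
    have "position (g \<otimes>\<^bsub>G\<^esub> elem [] (unit_vector i)) = position g + T (inv\<^bsub>Fn\<^esub> fst g) (unit_vector i)"
      by (simp only: fst_elem e)
    moreover have "fst (g \<otimes>\<^bsub>G\<^esub> elem [] (unit_vector i)) = fst g" by (simp only: fst_mult fst_elem e)
    ultimately show ?thesis using g k lift_unit[of i] by (simp add: located_def)
  qed
  show "located (g \<otimes>\<^bsub>G\<^esub> val (lift_unit i)) b (y + T (inv\<^bsub>Fn\<^esub> b) (unit_vector i))"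
    using *[of g] g by (simp add: located_def)
  let ?g = "g \<otimes>\<^bsub>G\<^esub> val (inv_word (lift_unit i))"
  have gG: "g \<in> carrier G" using g by (simp add: located_def)
  have gc: "?g \<in> carrier G" using gG lift_unit[of i] by simp
  have "?g \<otimes>\<^bsub>G\<^esub> val (lift_unit i) = g"
    using gG lift_unit[of i] pres.word_elem_inv_word[of "lift_unit i"] by (simp add: G.m_assoc)
  then have "located g (fst ?g) (position ?g + T (inv\<^bsub>Fn\<^esub> fst ?g) (unit_vector i))"
    using *[OF gc] by simp
  then show "located ?g b (y - T (inv\<^bsub>Fn\<^esub> b) (unit_vector i))"
    using g gc by (auto simp: located_def)
qed

text \<open>Along such a word the height is constant, so the approximations for its letters telescope, with
  an error that is linear in the length.\<close>

lemma lift_word_cost: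
  "\<exists>C\<ge>0. \<forall>g\<in>carrier G. \<forall>h\<in>words_over {..<n}. \<forall>L s.
    \<bar>cost L s g (lift_word h) - 2 * (far_side s (g \<otimes>\<^bsub>G\<^esub> val (lift_word h)) - far_side s g) * height L g\<bar>
      \<le> C * int (length h)"
proof -
  have "\<exists>C\<ge>0. \<forall>g\<in>carrier G. \<forall>L s. \<bar>cost L s g (lift_letter l) -
      2 * (far_side s (g \<otimes>\<^bsub>G\<^esub> val (lift_letter l)) - far_side s g) * height L g\<bar> \<le> C"
    if "l \<in> {..<n} \<times> UNIV" for l
    using cost_approx[of "lift_letter l"] lift_letter[of l] that by auto
  then obtain C where C: "\<And>l. l \<in> {..<n} \<times> UNIV \<Longrightarrow> C l \<ge> 0"
    "\<And>l g L s. l \<in> {..<n} \<times> UNIV \<Longrightarrow> g \<in> carrier G \<Longrightarrow> \<bar>cost L s g (lift_letter l) -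
      2 * (far_side s (g \<otimes>\<^bsub>G\<^esub> val (lift_letter l)) - far_side s g) * height L g\<bar> \<le> C l"
    by metis
  define K where "K = (\<Sum>l\<in>{..<n} \<times> UNIV. C l)"
  have K: "C l \<le> K" if "l \<in> {..<n} \<times> UNIV" for l
    unfolding K_def using that C by (intro member_le_sum) auto
  show ?thesis
  proof (intro exI[of _ K] conjI ballI allI)
    show "0 \<le> K" unfolding K_def by (intro sum_nonneg C)
    fix g h L s assume "g \<in> carrier G" "h \<in> words_over {..<n}"
    then show "\<bar>cost L s g (lift_word h) - 2 * (far_side s (g \<otimes>\<^bsub>G\<^esub> val (lift_word h)) - far_side s g) * height L g\<bar>
      \<le> K * int (length h)"
    proof (induction h arbitrary: g)
      case Nil
      then show ?case by (simp add: lift_word_def)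
    next
      case (Cons l h)
      have l: "l \<in> {..<n} \<times> UNIV" "fst l < n" and h: "h \<in> words_over {..<n}"
        using Cons.prems by (auto simp: mem_Times_iff)
      note ll = lift_letter[OF l(2)] and lh = lift_word[OF h]
      define y where "y = g \<otimes>\<^bsub>G\<^esub> val (lift_letter l)"
      have y: "y \<in> carrier G" using ll Cons.prems letter_carrier[OF l(2)] by (simp add: y_def)
      have "located y (reduce (fst g @ [l])) (position g)"
        using located_lift_word[of g "fst g" "position g" "[l]"] Cons.prems l
        by (simp add: located_def y_def lift_word_def)
      then have hy: "height L y = height L g" by (simp add: height_def located_def)
      have app: "lift_word (l # h) = lift_letter l @ lift_word h" by (simp add: lift_word_def)
      have z: "y \<otimes>\<^bsub>G\<^esub> val (lift_word h) = g \<otimes>\<^bsub>G\<^esub> val (lift_word (l # h))"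
        using ll lh Cons.prems letter_carrier[OF l(2)] reduce_in_free_group[OF h]
        by (simp add: app y_def pres.word_elem_append G.m_assoc)
      have c: "cost L s g (lift_word (l # h)) = cost L s g (lift_letter l) + cost L s y (lift_word h)"
        using ll lh Cons.prems by (simp add: app y_def pres.cost_append)
      have "\<bar>cost L s y (lift_word h) - 2 * (far_side s (g \<otimes>\<^bsub>G\<^esub> val (lift_word (l # h))) - far_side s y) * height L g\<bar>
          \<le> K * int (length h)"
        using Cons.IH[OF y h] hy z by simp
      moreover have "\<bar>cost L s g (lift_letter l) - 2 * (far_side s y - far_side s g) * height L g\<bar> \<le> K"
        using C(2)[OF l(1) Cons.prems(1), of L s] K[OF l(1)] unfolding y_def by linarith
      moreover have "(u + v) - 2 * (a - b) * p = (v - 2 * (a - c) * p) + (u - 2 * (c - b) * p)"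
        for u v a b c p :: int by (simp add: algebra_simps)
      moreover have "K * int (length (l # h)) = K * int (length h) + K" by (simp add: algebra_simps)
      ultimately show ?case unfolding c by (smt (verit))
    qed
  qed
qed

end

context presented_free_lattice_action
begin

lemma unit_cost:
  "\<exists>C\<ge>0. \<forall>i<d. \<forall>g b y L s. located g b y \<longrightarrow>
    \<bar>cost L s g (lift_unit i)\<bar> \<le> C \<and> \<bar>cost L s g (inv_word (lift_unit i))\<bar> \<le> C"
proof -
  have "\<exists>C\<ge>0. \<forall>g b y L s. located g b y \<longrightarrow>
    \<bar>cost L s g (lift_unit i)\<bar> \<le> C \<and> \<bar>cost L s g (inv_word (lift_unit i))\<bar> \<le> C" if i: "i < d" for i
  proof -
    obtain C where C: "C \<ge> 0" "\<And>g L s. g \<in> carrier G \<Longrightarrow> \<bar>cost L s g (lift_unit i) -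
      2 * (far_side s (g \<otimes>\<^bsub>G\<^esub> val (lift_unit i)) - far_side s g) * height L g\<bar> \<le> C"
      using cost_approx[of "lift_unit i"] lift_unit[of i] by auto
    obtain C' where C': "C' \<ge> 0" "\<And>g L s. g \<in> carrier G \<Longrightarrow> \<bar>cost L s g (inv_word (lift_unit i)) -
      2 * (far_side s (g \<otimes>\<^bsub>G\<^esub> val (inv_word (lift_unit i))) - far_side s g) * height L g\<bar> \<le> C'"
      using cost_approx[of "inv_word (lift_unit i)"] lift_unit[of i] by auto
    have "\<bar>cost L s g (lift_unit i)\<bar> \<le> C + C' \<and> \<bar>cost L s g (inv_word (lift_unit i))\<bar> \<le> C + C'"
      if g: "located g b y" for g b y L s
    proof -
      have "g \<in> carrier G" using g by (simp add: located_def)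
      moreover have "far_side s (g \<otimes>\<^bsub>G\<^esub> val (lift_unit i)) = far_side s g"
        "far_side s (g \<otimes>\<^bsub>G\<^esub> val (inv_word (lift_unit i))) = far_side s g"
        using g located_lift_unit[OF g i] unfolding far_side_def located_def by metis+
      ultimately show ?thesis using C(2)[of g L s] C'(2)[of g L s] C(1) C'(1) by simp
    qed
    then show ?thesis using C(1) C'(1) by (intro exI[of _ "C + C'"]) auto
  qed
  then obtain C where C: "\<And>i. i < d \<Longrightarrow> C i \<ge> 0" "\<And>i g b y L s. i < d \<Longrightarrow> located g b y \<Longrightarrow>
    \<bar>cost L s g (lift_unit i)\<bar> \<le> C i \<and> \<bar>cost L s g (inv_word (lift_unit i))\<bar> \<le> C i"
    by metis
  have le: "C i \<le> (\<Sum>i<d. C i)" if "i < d" for i using that C(1) by (intro member_le_sum) auto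
  show ?thesis
  proof (intro exI[of _ "\<Sum>i<d. C i"] conjI allI impI)
    show "0 \<le> (\<Sum>i<d. C i)" by (intro sum_nonneg) (simp add: C(1))
    fix i g b y L s assume i: "i < d" and g: "located g b y"
    show "\<bar>cost L s g (lift_unit i)\<bar> \<le> (\<Sum>i<d. C i)"
      "\<bar>cost L s g (inv_word (lift_unit i))\<bar> \<le> (\<Sum>i<d. C i)"
      using C(2)[OF i g, of L s] le[OF i] by linarith+
  qed
qed

text \<open>The word makes four journeys between \<open>p\<close> and \<open>q\<close>, with steps by unit
  vectors in between. The steps are \<open>\<plusminus>\<alpha>\<close> at \<open>q\<close> and
  \<open>\<plusminus>\<beta>\<close> at \<open>p\<close>, so the journeys take place at the
  corners of a parallelogram. They cross the base edge in alternating directions, and the cost is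
  twice the alternating sum of the heights of the corners, up to an error that is linear in the
  length. If \<open>L\<close> is the smaller one of the norms of \<open>\<alpha>\<close> and
  \<open>\<beta>\<close>, then \<open>0\<close> has height \<open>0\<close>, its two neighbours
  have height \<open>L\<close>, and the opposite corner has height at most \<open>L\<close>.\<close>

lemma parallelogram_bound:
  "\<exists>C. \<forall>p\<in>carrier Fn. \<forall>q\<in>carrier Fn. \<forall>i<d. \<forall>j<d. p \<noteq> [] \<and> (q = [] \<or> hd q \<noteq> hd p) \<longrightarrow>
    min (vnorm (T (inv\<^bsub>Fn\<^esub> q) (unit_vector i))) (vnorm (T (inv\<^bsub>Fn\<^esub> p) (unit_vector j)))
      \<le> int (C * (length p + length q + 1) + C * Dehn_function X R (C * (length p + length q + 1)))"
proof -
  obtain CD where CD: "CD \<ge> 0" "\<And>g w m L s. g \<in> carrier G \<Longrightarrow> null_word X R w \<Longrightarrow> length w \<le> m \<Longrightarrow>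
    \<bar>cost L s g w\<bar> \<le> CD * int (Dehn_function X R m)"
    using cost_le_Dehn by blast
  obtain CU where CU: "CU \<ge> 0" "\<And>i g b y L s. i < d \<Longrightarrow> located g b y \<Longrightarrow>
    \<bar>cost L s g (lift_unit i)\<bar> \<le> CU" "\<And>i g b y L s. i < d \<Longrightarrow> located g b y \<Longrightarrow>
    \<bar>cost L s g (inv_word (lift_unit i))\<bar> \<le> CU"
    using unit_cost by blast
  obtain CL where CL: "CL \<ge> 0" "\<And>g h L s. g \<in> carrier G \<Longrightarrow> h \<in> words_over {..<n} \<Longrightarrow>
    \<bar>cost L s g (lift_word h) - 2 * (far_side s (g \<otimes>\<^bsub>G\<^esub> val (lift_word h)) - far_side s g) * height L g\<bar>
      \<le> CL * int (length h)"
    using lift_word_cost by blast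
  obtain K where K: "\<And>h. h \<in> words_over {..<n} \<Longrightarrow> length (lift_word h) \<le> K * length h"
    using length_lift_word by blast
  define KU where "KU = (\<Sum>i<d. length (lift_unit i))"
  have KU: "length (lift_unit i) \<le> KU" if "i < d" for i
    unfolding KU_def using that by (intro member_le_sum) auto
  define C where "C = nat (CD + 4 * CU + 4 * CL) + 4 * K + 4 * KU"
  have Cint: "CD \<le> int C" "4 * CU \<le> int C" "4 * CL \<le> int C" "4 * CU + 4 * CL \<le> int C"
    using CD CU CL unfolding C_def by auto
  show ?thesis
  proof (intro exI[of _ C] ballI allI impI)
    fix p q i j
    assume p: "p \<in> carrier Fn" and q: "q \<in> carrier Fn" and i: "i < d" and j: "j < d"
      and pq: "p \<noteq> [] \<and> (q = [] \<or> hd q \<noteq> hd p)"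
    define \<alpha> where "\<alpha> = T (inv\<^bsub>Fn\<^esub> q) (unit_vector i)"
    define \<beta> where "\<beta> = T (inv\<^bsub>Fn\<^esub> p) (unit_vector j)"
    define L where "L = min (vnorm \<alpha>) (vnorm \<beta>)"
    define s where "s = hd p"
    have L0: "0 \<le> L" by (simp add: L_def)
    have pw: "p \<in> words_over {..<n}" "reduced p" and qw: "q \<in> words_over {..<n}" "reduced q"
      using p q by (auto simp: free_group_carrier)
    define t where "t = inv_word q @ p"
    define t' where "t' = inv_word p @ q"
    have tw: "t \<in> words_over {..<n}" "t' \<in> words_over {..<n}" using pw qw by (auto simp: t_def t'_def)
    have red: "reduce (q @ t) = p" "reduce (p @ t') = q"
      using reduce_cancel[of "[]" "inv_word q" p] reduce_cancel[of "[]" "inv_word p" q] pw qw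
      by (simp_all add: t_def t'_def reduce_reduced)
    have len: "length t = length p + length q" "length t' = length p + length q"
      by (simp_all add: t_def t'_def)
    have to_p: "located (g \<otimes>\<^bsub>G\<^esub> val (lift_word t)) p y" if "located g q y" for g y
      using located_lift_word[OF that tw(1)] red by simp
    have to_q: "located (g \<otimes>\<^bsub>G\<^esub> val (lift_word t')) q y" if "located g p y" for g y
      using located_lift_word[OF that tw(2)] red by simp
    have side: "far_side s g = 1" if "located g p y" for g y
      using that pq by (auto simp: far_side_def s_def located_def)
    have side': "far_side s g = 0" if "located g q y" for g y
      using that pq by (auto simp: far_side_def s_def located_def)
    have ht: "height L g = min (vnorm y) L" if "located g b y" for g b y
      using that by (simp add: height_def located_def)
    have car: "g \<in> carrier G" if "located g b y" for g b y
      using that by (simp add: located_def)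
    define g0 where "g0 = elem p 0"
    define g1 where "g1 = g0 \<otimes>\<^bsub>G\<^esub> val (lift_word t')"
    define g2 where "g2 = g1 \<otimes>\<^bsub>G\<^esub> val (lift_unit i)"
    define g3 where "g3 = g2 \<otimes>\<^bsub>G\<^esub> val (lift_word t)"
    define g4 where "g4 = g3 \<otimes>\<^bsub>G\<^esub> val (lift_unit j)"
    define g5 where "g5 = g4 \<otimes>\<^bsub>G\<^esub> val (lift_word t')"
    define g6 where "g6 = g5 \<otimes>\<^bsub>G\<^esub> val (inv_word (lift_unit i))"
    define g7 where "g7 = g6 \<otimes>\<^bsub>G\<^esub> val (lift_word t)"
    define g8 where "g8 = g7 \<otimes>\<^bsub>G\<^esub> val (inv_word (lift_unit j))"
    have z: "(0 :: nat \<Rightarrow> int) \<in> integer_vectors d" by (simp add: integer_vectors_def)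
    have l0: "located g0 p 0" unfolding located_def g0_def position_def
      using p by (simp add: vec_part_elem[OF z])
    have l1: "located g1 q 0" unfolding g1_def by (rule to_q[OF l0])
    have l2: "located g2 q \<alpha>" unfolding g2_def \<alpha>_def using located_lift_unit(1)[OF l1 i] by simp
    have l3: "located g3 p \<alpha>" unfolding g3_def by (rule to_p[OF l2])
    have l4: "located g4 p (\<alpha> + \<beta>)" unfolding g4_def \<beta>_def by (rule located_lift_unit(1)[OF l3 j])
    have l5: "located g5 q (\<alpha> + \<beta>)" unfolding g5_def by (rule to_q[OF l4])
    have l6: "located g6 q \<beta>" unfolding g6_def
      using located_lift_unit(2)[OF l5 i] by (simp add: \<alpha>_def)
    have l7: "located g7 p \<beta>" unfolding g7_def by (rule to_p[OF l6])
    have l8: "located g8 p 0" unfolding g8_def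
      using located_lift_unit(2)[OF l7 j] by (simp add: \<beta>_def)
    have "g8 = g0" using l0 l8 by (intro G_eq_positionI) (auto simp: located_def)
    define W where "W = lift_word t' @ lift_unit i @ lift_word t @ lift_unit j @
      lift_word t' @ inv_word (lift_unit i) @ lift_word t @ inv_word (lift_unit j)"
    have wX: "lift_word t \<in> words_over X" "lift_word t' \<in> words_over X"
      "lift_unit i \<in> words_over X" "lift_unit j \<in> words_over X"
      using lift_word[OF tw(1)] lift_word[OF tw(2)] lift_unit by auto
    then have WX: "W \<in> words_over X" by (simp add: W_def)
    note carr = l0[THEN car] l1[THEN car] l2[THEN car] l3[THEN car] l4[THEN car] l5[THEN car]
      l6[THEN car] l7[THEN car]
    have "g0 \<otimes>\<^bsub>G\<^esub> val W = g8"
      using carr wX unfolding W_def g8_def g7_def g6_def g5_def g4_def g3_def g2_def g1_def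
      by (simp add: pres.word_elem_append G.m_assoc)
    then have "val W = \<one>\<^bsub>G\<^esub>" using \<open>g8 = g0\<close> carr(1) WX by simp
    then have null: "null_word X R W" using pres.null_word_iff[OF WX] by simp
    have lenW: "length W \<le> C * (length p + length q + 1)"
    proof -
      have "length W \<le> 4 * (K * (length p + length q)) + 4 * KU"
        using K[OF tw(1)] K[OF tw(2)] KU[OF i] KU[OF j] len unfolding W_def by simp
      also have "\<dots> \<le> C * (length p + length q) + C"
        unfolding C_def by (intro add_mono) (auto simp: algebra_simps)
      finally show ?thesis by simp
    qed
    have cW: "cost L s g0 W = cost L s g0 (lift_word t') + cost L s g1 (lift_unit i) +
        cost L s g2 (lift_word t) + cost L s g3 (lift_unit j) + cost L s g4 (lift_word t') +
        cost L s g5 (inv_word (lift_unit i)) + cost L s g6 (lift_word t) +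
        cost L s g7 (inv_word (lift_unit j))"
      using carr wX unfolding W_def
      by (simp add: pres.cost_append flip: g1_def g2_def g3_def g4_def g5_def g6_def g7_def)
    define N where "N = CL * int (length p + length q)"
    have long: "\<bar>cost L s g (lift_word t') + 2 * min (vnorm y) L\<bar> \<le> N" if "located g p y" for g y
      using CL(2)[OF car[OF that] tw(2), of L s] side[OF that] side'[OF to_q[OF that]] ht[OF that] len
      by (simp add: N_def)
    have long': "\<bar>cost L s g (lift_word t) - 2 * min (vnorm y) L\<bar> \<le> N" if "located g q y" for g y
      using CL(2)[OF car[OF that] tw(1), of L s] side'[OF that] side[OF to_p[OF that]] ht[OF that] len
      by (simp add: N_def)
    have m: "min (vnorm 0) L = 0" "min (vnorm \<alpha>) L = L" "min (vnorm \<beta>) L = L"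
      "min (vnorm (\<alpha> + \<beta>)) L \<le> L"
      using L0 by (auto simp: L_def)
    have lower: "b - c \<le> a" if "\<bar>a - b\<bar> \<le> c" for a b c :: int
      using that by linarith
    have "- N \<le> cost L s g0 (lift_word t')" using lower[of _ 0 N] long[OF l0] m(1) by simp
    moreover have "2 * L - N \<le> cost L s g2 (lift_word t)"
      using lower[OF long'[OF l2]] unfolding m(2) .
    moreover have "- 2 * min (vnorm (\<alpha> + \<beta>)) L - N \<le> cost L s g4 (lift_word t')"
      using lower[of _ "- 2 * min (vnorm (\<alpha> + \<beta>)) L" N] long[OF l4] by simp
    moreover have "2 * L - N \<le> cost L s g6 (lift_word t)"
      using lower[OF long'[OF l6]] unfolding m(3) .
    moreover have "- CU \<le> cost L s g1 (lift_unit i)" "- CU \<le> cost L s g3 (lift_unit j)"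
      "- CU \<le> cost L s g5 (inv_word (lift_unit i))" "- CU \<le> cost L s g7 (inv_word (lift_unit j))"
      using CU(2)[OF i l1, of L s] CU(2)[OF j l3, of L s] CU(3)[OF i l5, of L s] CU(3)[OF j l7, of L s]
      by (simp_all only: abs_le_iff) linarith+
    ultimately have "2 * L \<le> cost L s g0 W + 4 * N + 4 * CU"
      using m(4) unfolding cW by linarith
    moreover have "cost L s g0 W \<le> CD * int (Dehn_function X R (C * (length p + length q + 1)))"
      using CD(2)[OF carr(1) null lenW, of L s] by linarith
    moreover have "CD * int (Dehn_function X R (C * (length p + length q + 1))) \<le>
        int C * int (Dehn_function X R (C * (length p + length q + 1)))"
      by (intro mult_right_mono Cint) auto
    moreover have "4 * N + 4 * CU \<le> int C * int (length p + length q + 1)"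
    proof -
      have "4 * N + 4 * CU \<le> (4 * CL + 4 * CU) * int (length p + length q + 1)"
        using CU(1) CL(1) by (simp add: N_def algebra_simps)
      also have "\<dots> \<le> int C * int (length p + length q + 1)"
        using Cint(4) by (intro mult_right_mono) auto
      finally show ?thesis .
    qed
    ultimately have "2 * L \<le> int C * int (length p + length q + 1) +
        int C * int (Dehn_function X R (C * (length p + length q + 1)))"
      by linarith
    then have "L \<le> int C * int (length p + length q + 1) +
        int C * int (Dehn_function X R (C * (length p + length q + 1)))"
      using L0 by linarith
    then show "min (vnorm (T (inv\<^bsub>Fn\<^esub> q) (unit_vector i))) (vnorm (T (inv\<^bsub>Fn\<^esub> p) (unit_vector j)))
      \<le> int (C * (length p + length q + 1) + C * Dehn_function X R (C * (length p + length q + 1)))"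
      unfolding \<alpha>_def[symmetric] \<beta>_def[symmetric] L_def[symmetric] of_nat_add of_nat_mult .
  qed
qed

end

text \<open>The form in which the Dehn function enters below: linear rescaling of the argument, as in
  \<open>parallelogram_bound\<close>, does not affect subexponential growth.\<close>

lemma subexponential_bound:
  assumes \<delta>: "subexponential \<delta>" and \<epsilon>: "\<epsilon> > 0"
  obtains K where "K > 0" "\<And>k. real (C * (k + 1) + C * \<delta> (C * (k + 1))) \<le> K * exp (\<epsilon> * real k)"
proof (cases "C = 0")
  case True
  then show thesis by (intro that[of 1]) auto
next
  case False
  define \<eta> where "\<eta> = \<epsilon> / real C"
  have \<eta>: "\<eta> > 0" using \<epsilon> False by (simp add: \<eta>_def)
  have "\<forall>\<^sub>F m in sequentially. ln (1 + real (\<delta> m)) / real m < \<eta>"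
    using \<delta> \<eta> unfolding subexponential_def by (rule order_tendstoD(2))
  then obtain M where M: "\<And>m. m \<ge> M \<Longrightarrow> ln (1 + real (\<delta> m)) / real m < \<eta>"
    by (auto simp: eventually_sequentially)
  define K0 where "K0 = 1 + (\<Sum>m<M + 1. real (\<delta> m))"
  have K0: "K0 \<ge> 1" by (simp add: K0_def sum_nonneg)
  have bound: "real (\<delta> m) \<le> K0 * exp (\<eta> * real m)" for m
  proof (cases "m < M + 1")
    case True
    then have "real (\<delta> m) \<le> (\<Sum>m<M + 1. real (\<delta> m))" by (intro member_le_sum) auto
    also have "\<dots> \<le> K0" by (simp add: K0_def)
    also have "\<dots> \<le> K0 * exp (\<eta> * real m)" using K0 \<eta> by simp
    finally show ?thesis .
  next
    case False
    then have "ln (1 + real (\<delta> m)) < \<eta> * real m" using M[of m] by (simp add: field_simps)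
    then have "exp (ln (1 + real (\<delta> m))) < exp (\<eta> * real m)" by (simp only: exp_less_cancel_iff)
    moreover have "exp (ln (1 + real (\<delta> m))) = 1 + real (\<delta> m)" by (simp add: add_pos_nonneg)
    ultimately have "1 + real (\<delta> m) < exp (\<eta> * real m)" by metis
    also have "\<dots> \<le> K0 * exp (\<eta> * real m)" using K0 by simp
    finally show ?thesis by simp
  qed
  define K where "K = (real C / \<epsilon> + real C * K0) * exp \<epsilon>"
  show thesis
  proof (rule that[of K])
    show "K > 0" using False \<epsilon> K0 by (auto simp: K_def intro!: mult_pos_pos add_pos_pos)
    fix k
    have "\<epsilon> * real (k + 1) \<le> exp (\<epsilon> * real (k + 1))"
      using exp_ge_add_one_self[of "\<epsilon> * real (k + 1)"] by linarith
    then have "real C / \<epsilon> * (\<epsilon> * real (k + 1)) \<le> real C / \<epsilon> * exp (\<epsilon> * real (k + 1))"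
      by (rule mult_left_mono) (use \<epsilon> in simp)
    moreover have "real C / \<epsilon> * (\<epsilon> * real (k + 1)) = real (C * (k + 1))"
      using \<epsilon> by (simp only: of_nat_mult) simp
    ultimately have "real (C * (k + 1)) \<le> real C / \<epsilon> * exp (\<epsilon> * real (k + 1))" by (simp only:)
    moreover have "real (C * \<delta> (C * (k + 1))) \<le> real C * (K0 * exp (\<epsilon> * real (k + 1)))"
    proof -
      have "\<eta> * real (C * (k + 1)) = \<epsilon> * real (k + 1)"
        using False unfolding \<eta>_def of_nat_mult by simp
      with bound[of "C * (k + 1)"] have "real (\<delta> (C * (k + 1))) \<le> K0 * exp (\<epsilon> * real (k + 1))"
        by (simp only:)
      then have "real C * real (\<delta> (C * (k + 1))) \<le> real C * (K0 * exp (\<epsilon> * real (k + 1)))"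
        by (rule mult_left_mono) simp
      then show ?thesis by (simp only: of_nat_mult)
    qed
    moreover have "exp (\<epsilon> * real (k + 1)) = exp \<epsilon> * exp (\<epsilon> * real k)"
      by (simp add: algebra_simps flip: exp_add)
    ultimately show "real (C * (k + 1) + C * \<delta> (C * (k + 1))) \<le> K * exp (\<epsilon> * real k)"
      unfolding of_nat_add K_def by (simp only: distrib_right mult.assoc)
  qed
qed

lemma abs_det_le:
  fixes A :: "int mat"
  assumes A: "A \<in> carrier_mat k k" and M: "\<And>i j. i < k \<Longrightarrow> j < k \<Longrightarrow> \<bar>A $$ (i, j)\<bar> \<le> M"
  shows "\<bar>det A\<bar> \<le> fact k * M ^ k"
proof -
  let ?P = "{p. p permutes {0..<k}}"
  have "\<bar>det A\<bar> = \<bar>\<Sum>p\<in>?P. signof p * (\<Prod>i = 0..<k. A $$ (i, p i))\<bar>"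
    by (simp add: det_def'[OF A])
  also have "\<dots> \<le> (\<Sum>p\<in>?P. M ^ k)"
  proof (rule order_trans[OF sum_abs sum_mono])
    fix p assume p: "p \<in> ?P"
    have "\<bar>\<Prod>i = 0..<k. A $$ (i, p i)\<bar> \<le> (\<Prod>i = 0..<k. M)"
      unfolding abs_prod using p M permutes_in_image[of p "{0..<k}"] by (intro prod_mono) auto
    then show "\<bar>signof p * (\<Prod>i = 0..<k. A $$ (i, p i))\<bar> \<le> M ^ k"
      by (simp add: abs_mult sign_def)
  qed
  also have "\<dots> = fact k * M ^ k"
    using card_permutations[of "{0..<k}" k] by simp
  finally show ?thesis .
qed

context free_lattice_action
begin

lemma entry_le_opnorm: "i < d \<Longrightarrow> j < d \<Longrightarrow> \<bar>\<tau> h $$ (i, j)\<bar> \<le> opnorm h"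
proof -
  assume ij: "i < d" "j < d"
  have "\<bar>T h (unit_vector i) j\<bar> \<le> vnorm (T h (unit_vector i))"
    unfolding vnorm_def using ij by (intro member_le_sum) auto
  then show ?thesis using vnorm_T_unit_vector[OF ij(1), of h] ij by (simp add: T_unit_vector)
qed

lemma opnorm_le:
  assumes "\<And>i j. i < d \<Longrightarrow> j < d \<Longrightarrow> \<bar>\<tau> h $$ (i, j)\<bar> \<le> M"
  shows "opnorm h \<le> int d * int d * M"
proof -
  have "opnorm h \<le> (\<Sum>i<d. \<Sum>j<d. M)"
    unfolding opnorm_def vnorm_def using assms by (intro sum_mono) (auto simp: T_unit_vector)
  then show ?thesis by simp
qed

lemma opnorm_one: "opnorm [] = int d"
proof -
  have "T [] (unit_vector i) = unit_vector i" if "i < d" for i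
    using act.T_one[of "unit_vector i"] that by (simp add: free_group_one)
  then have "opnorm [] = (\<Sum>i<d. 1)"
    unfolding opnorm_def by (intro sum.cong) (auto simp: vnorm_unit_vector)
  then show ?thesis by simp
qed

lemma opnorm_ge_1:
  assumes "d > 0" "h \<in> carrier Fn"
  shows "1 \<le> opnorm h"
proof -
  have "int d \<le> opnorm h * opnorm (inv\<^bsub>Fn\<^esub> h)"
    using opnorm_mult[of h "inv\<^bsub>Fn\<^esub> h"] assms by (simp add: opnorm_one free_group_one)
  then have "opnorm h \<noteq> 0" using assms(1) by auto
  then show ?thesis using opnorm_nonneg[of h] by linarith
qed

text \<open>The determinants are \<open>\<plusminus>1\<close>, so the entries of an inverse are minors up to sign.\<close>

lemma opnorm_le_opnorm_inv:
  assumes h: "h \<in> carrier Fn"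
  shows "opnorm h \<le> int d * int d * (fact d * opnorm (inv\<^bsub>Fn\<^esub> h) ^ d)"
proof (cases "d = 0")
  case True
  then have "{..<d} = {}" by simp
  then have "opnorm h = 0" unfolding opnorm_def by (simp only: sum.empty)
  then show ?thesis using True by simp
next
  case False
  define A B M where "A = \<tau> h" and "B = \<tau> (inv\<^bsub>Fn\<^esub> h)" and "M = opnorm (inv\<^bsub>Fn\<^esub> h)"
  have A: "A \<in> carrier_mat d d" and B: "B \<in> carrier_mat d d" using h by (auto simp: A_def B_def \<tau>_carrier)
  have M: "1 \<le> M" unfolding M_def using False h by (intro opnorm_ge_1) auto
  have BA: "B * A = 1\<^sub>m d"
    using h \<tau>_mult[of "inv\<^bsub>Fn\<^esub> h" h] by (simp add: A_def B_def \<tau>_one free_group_one)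
  have "det B * det A = 1" using det_mult[OF B A] by (simp add: BA)
  then have detB: "\<bar>det B\<bar> = 1" by (metis abs_mult abs_one abs_zmult_eq_1)
  note adj = adj_mat[OF B]
  have "adj_mat B = adj_mat B * (B * A)" using adj(1) by (simp add: BA)
  also have "\<dots> = (adj_mat B * B) * A" using adj(1) A B by (simp add: assoc_mult_mat[of _ d d _ d _ d])
  also have "\<dots> = det B \<cdot>\<^sub>m A" using A by (simp add: adj(3) mult_smult_assoc_mat[of _ d d _ d])
  finally have adjB: "adj_mat B = det B \<cdot>\<^sub>m A" .
  have "\<bar>\<tau> h $$ (i, j)\<bar> \<le> fact d * M ^ d" if ij: "i < d" "j < d" for i j
  proof -
    have "\<bar>\<tau> h $$ (i, j)\<bar> = \<bar>adj_mat B $$ (i, j)\<bar>"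
      using ij A detB by (simp add: adjB abs_mult A_def)
    also have "\<dots> = \<bar>det (mat_delete B j i)\<bar>"
      using ij B by (simp add: adj_mat_def cofactor_def abs_mult power_abs)
    also have "\<dots> \<le> fact (d - 1) * M ^ (d - 1)"
    proof (rule abs_det_le)
      show "mat_delete B j i \<in> carrier_mat (d - 1) (d - 1)" by (rule mat_delete_carrier[OF B])
      fix k l assume kl: "k < d - 1" "l < d - 1"
      have "mat_delete B j i $$ (k, l) = B $$ (insert_index j k, insert_index i l)"
        using mat_delete_index[of B "d - 1" j i k l] B False ij kl by simp
      moreover have "insert_index j k < d" "insert_index i l < d"
        using kl by (auto simp: insert_index_def)
      ultimately show "\<bar>mat_delete B j i $$ (k, l)\<bar> \<le> M"
        by (simp add: B_def M_def entry_le_opnorm)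
    qed
    also have "\<dots> \<le> fact d * M ^ d"
      using M by (intro mult_mono fact_mono power_increasing) auto
    finally show ?thesis .
  qed
  then show ?thesis unfolding M_def by (rule opnorm_le)
qed

end

context presented_free_lattice_action
begin

text \<open>If for every pair of rows one of them satisfies the bound, then all rows of one of the two
  matrices do.\<close>

lemma min_opnorm_bound:
  assumes \<delta>: "subexponential (Dehn_function X R)" and \<epsilon>: "\<epsilon> > 0"
  obtains K where "K > 0" "\<And>p q. p \<in> carrier Fn \<Longrightarrow> q \<in> carrier Fn \<Longrightarrow> p \<noteq> [] \<Longrightarrow> q = [] \<or> hd q \<noteq> hd p \<Longrightarrow>
    real_of_int (min (opnorm (inv\<^bsub>Fn\<^esub> q)) (opnorm (inv\<^bsub>Fn\<^esub> p))) \<le> K * exp (\<epsilon> * real (length p + length q))"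
proof -
  obtain C where C: "\<And>p q i j. p \<in> carrier Fn \<Longrightarrow> q \<in> carrier Fn \<Longrightarrow> i < d \<Longrightarrow> j < d \<Longrightarrow>
    p \<noteq> [] \<and> (q = [] \<or> hd q \<noteq> hd p) \<Longrightarrow>
    min (vnorm (T (inv\<^bsub>Fn\<^esub> q) (unit_vector i))) (vnorm (T (inv\<^bsub>Fn\<^esub> p) (unit_vector j)))
      \<le> int (C * (length p + length q + 1) + C * Dehn_function X R (C * (length p + length q + 1)))"
    using parallelogram_bound by blast
  obtain K where K: "K > 0" "\<And>k. real (C * (k + 1) + C * Dehn_function X R (C * (k + 1))) \<le> K * exp (\<epsilon> * real k)"
    using subexponential_bound[OF \<delta> \<epsilon>, of C] by blast
  show thesis
  proof (rule that[of "(real d + 1) * K"])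
    show "(real d + 1) * K > 0" using K(1) by simp
    fix p q assume p: "p \<in> carrier Fn" and q: "q \<in> carrier Fn" and pq: "p \<noteq> []" "q = [] \<or> hd q \<noteq> hd p"
    define k where "k = length p + length q"
    define E where "E = int (C * (k + 1) + C * Dehn_function X R (C * (k + 1)))"
    have E: "min (vnorm (T (inv\<^bsub>Fn\<^esub> q) (unit_vector i))) (vnorm (T (inv\<^bsub>Fn\<^esub> p) (unit_vector j))) \<le> E"
      if "i < d" "j < d" for i j
      using C[OF p q that] pq unfolding E_def k_def by blast
    have sum: "opnorm h \<le> int d * E" if "\<And>i. i < d \<Longrightarrow> vnorm (T h (unit_vector i)) \<le> E" for h
    proof -
      have "opnorm h \<le> (\<Sum>i<d. E)" unfolding opnorm_def by (intro sum_mono that) auto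
      then show ?thesis by simp
    qed
    have "min (opnorm (inv\<^bsub>Fn\<^esub> q)) (opnorm (inv\<^bsub>Fn\<^esub> p)) \<le> int d * E"
    proof (cases "\<forall>i<d. vnorm (T (inv\<^bsub>Fn\<^esub> q) (unit_vector i)) \<le> E")
      case True
      then show ?thesis using sum[of "inv\<^bsub>Fn\<^esub> q"] by (simp add: min_le_iff_disj)
    next
      case False
      then have "vnorm (T (inv\<^bsub>Fn\<^esub> p) (unit_vector j)) \<le> E" if "j < d" for j
        using E that by (metis min_le_iff_disj)
      then show ?thesis using sum[of "inv\<^bsub>Fn\<^esub> p"] by (simp add: min_le_iff_disj)
    qed
    then have "real_of_int (min (opnorm (inv\<^bsub>Fn\<^esub> q)) (opnorm (inv\<^bsub>Fn\<^esub> p))) \<le> real_of_int (int d * E)"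
      by (simp only: of_int_le_iff)
    also have "\<dots> = real d * real (C * (k + 1) + C * Dehn_function X R (C * (k + 1)))"
      by (simp only: E_def of_int_mult of_int_of_nat_eq)
    also have "\<dots> \<le> (real d + 1) * (K * exp (\<epsilon> * real k))"
      using K by (intro mult_mono) auto
    finally show "real_of_int (min (opnorm (inv\<^bsub>Fn\<^esub> q)) (opnorm (inv\<^bsub>Fn\<^esub> p)))
      \<le> (real d + 1) * K * exp (\<epsilon> * real (length p + length q))"
      by (simp add: k_def mult.assoc)
  qed
qed

lemma reduced_one_generator:
  assumes "reduced p" "p \<noteq> []" "\<And>l. l \<in> set p \<Longrightarrow> fst l = fst (hd p)"
  shows "last p = hd p"
  using assms
proof (induction p)
  case (Cons a p)
  show ?case
  proof (cases "p = []")
    case False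
    then obtain b p' where p: "p = b # p'" by (cases p) auto
    have "fst b = fst a" using Cons.prems(3)[of b] p by simp
    moreover have "b \<noteq> inv_letter a" using Cons.prems(1) p by (simp add: reduced_Cons)
    ultimately have ba: "b = a" by (cases a; cases b) auto
    have "last p = hd p"
    proof (rule Cons.IH)
      show "reduced p" using Cons.prems(1) by (simp add: reduced_Cons)
      show "fst l = fst (hd p)" if "l \<in> set p" for l
        using Cons.prems(3)[of l] that by (simp add: p ba)
    qed (rule False)
    then show ?thesis using False by (simp add: p ba)
  qed simp
qed simp

text \<open>Every element is compared with one on the other side of the base edge. If there is a second free
  generator, it can be put in front; otherwise the inverse is on the other side.\<close>

lemma opnorm_subexponential:
  assumes \<delta>: "subexponential (Dehn_function X R)" and \<epsilon>: "\<epsilon> > 0"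
  obtains K where "K > 0" "\<And>h. h \<in> carrier Fn \<Longrightarrow> real_of_int (opnorm h) \<le> K * exp (\<epsilon> * real (length h))"
proof -
  \<comment> \<open>The factor 2 is for a pair of words, the factor \<open>d\<close> for the \<open>d\<close>-th power in the bound on inverses.\<close>
  define \<epsilon>' where "\<epsilon>' = \<epsilon> / (2 * (real d + 1))"
  have \<epsilon>': "\<epsilon>' > 0" "2 * \<epsilon>' \<le> \<epsilon>" "2 * real d * \<epsilon>' \<le> \<epsilon>"
    using \<epsilon> by (auto simp: \<epsilon>'_def field_simps)
  obtain K where K: "K > 0" "\<And>p q. p \<in> carrier Fn \<Longrightarrow> q \<in> carrier Fn \<Longrightarrow> p \<noteq> [] \<Longrightarrow> q = [] \<or> hd q \<noteq> hd p \<Longrightarrow>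
    real_of_int (min (opnorm (inv\<^bsub>Fn\<^esub> q)) (opnorm (inv\<^bsub>Fn\<^esub> p))) \<le> K * exp (\<epsilon>' * real (length p + length q))"
    using min_opnorm_bound[OF \<delta> \<epsilon>'(1)] by blast
  define c where "c = 1 + (\<Sum>l\<in>{..<n} \<times> (UNIV :: bool set). real_of_int (opnorm [l]))"
  have c: "1 \<le> c" "\<And>l. fst l < n \<Longrightarrow> real_of_int (opnorm [l]) \<le> c"
  proof -
    show "1 \<le> c" by (simp add: c_def sum_nonneg)
    fix l :: "nat \<times> bool" assume "fst l < n"
    then have "real_of_int (opnorm [l]) \<le> (\<Sum>l\<in>{..<n} \<times> (UNIV :: bool set). real_of_int (opnorm [l]))"
      by (intro member_le_sum) (auto simp: mem_Times_iff)
    then show "real_of_int (opnorm [l]) \<le> c" by (simp add: c_def)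
  qed
  define D where "D = real d * real d * fact d"
  define K' where "K' = real d + c * K * exp \<epsilon>' + K + D * K ^ d + 1"
  have D: "D \<ge> 0" by (simp add: D_def)
  have K': "K' > 0" using K(1) c(1) D by (auto simp: K'_def intro!: add_nonneg_pos add_nonneg_nonneg)
  show thesis
  proof (rule that[OF K'])
    fix h assume h: "h \<in> carrier Fn"
    define p where "p = inv\<^bsub>Fn\<^esub> h"
    have p: "p \<in> carrier Fn" "inv\<^bsub>Fn\<^esub> p = h" "length p = length h"
      using h by (simp_all add: p_def length_free_group_inv)
    have pr: "reduced p" "p \<in> words_over {..<n}" using p by (auto simp: free_group_carrier)
    have K'_le: "x * exp (\<epsilon> * real (length h)) \<le> K' * exp (\<epsilon> * real (length h))" if "x \<le> K'" for x
      using that by (intro mult_right_mono) auto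
    show "real_of_int (opnorm h) \<le> K' * exp (\<epsilon> * real (length h))"
    proof (cases "h = []")
      case True
      have "0 \<le> c * K * exp \<epsilon>'" "0 \<le> D * K ^ d" using K(1) c(1) D by auto
      then have "real d \<le> K'" using K(1) by (simp add: K'_def)
      then show ?thesis using True by (simp add: opnorm_one)
    next
      case False
      then have pne: "p \<noteq> []" using p(3) by auto
      show ?thesis
      proof (cases "\<exists>y. y < n \<and> y \<noteq> fst (hd p)")
        case True
        then obtain y where y: "y < n" "y \<noteq> fst (hd p)" by blast
        define l where "l = (y, True)"
        have l: "fst l < n" "[l] \<in> carrier Fn" using y letter_carrier[of l] by (auto simp: l_def)
        have lq: "l # p \<in> carrier Fn"
          using y pr pne by (cases "hd p") (auto simp: free_group_carrier reduced_Cons l_def)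
        have q: "l # p = [l] \<otimes>\<^bsub>Fn\<^esub> p" using lq by (simp add: free_group_mult free_group_carrier reduce_reduced)
        have iq: "inv\<^bsub>Fn\<^esub> (l # p) = h \<otimes>\<^bsub>Fn\<^esub> inv\<^bsub>Fn\<^esub> [l]" unfolding q using l p by (simp add: Fn.inv_mult_group)
        have "h = inv\<^bsub>Fn\<^esub> (l # p) \<otimes>\<^bsub>Fn\<^esub> [l]" unfolding iq using l h by (simp add: Fn.m_assoc)
        then have "opnorm h \<le> opnorm (inv\<^bsub>Fn\<^esub> (l # p)) * opnorm [l]"
          using opnorm_mult[of "inv\<^bsub>Fn\<^esub> (l # p)" "[l]"] l lq by simp
        then have "real_of_int (opnorm h) \<le> real_of_int (opnorm (inv\<^bsub>Fn\<^esub> (l # p))) * real_of_int (opnorm [l])"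
          by (simp only: of_int_le_iff flip: of_int_mult)
        also have "\<dots> \<le> real_of_int (opnorm (inv\<^bsub>Fn\<^esub> (l # p))) * c"
          using c(2)[OF l(1)] by (intro mult_left_mono) auto
        finally have 1: "real_of_int (opnorm h) \<le> c * real_of_int (opnorm (inv\<^bsub>Fn\<^esub> (l # p)))"
          by (simp add: mult.commute)
        have 2: "real_of_int (opnorm h) \<le> c * real_of_int (opnorm h)"
          using mult_right_mono[OF c(1), of "real_of_int (opnorm h)"] by simp
        have "hd (l # p) \<noteq> hd p" using y by (cases "hd p") (auto simp: l_def)
        then have min: "real_of_int (min (opnorm (inv\<^bsub>Fn\<^esub> (l # p))) (opnorm h)) \<le>
            K * exp (\<epsilon>' * real (length p + length (l # p)))"
          using K(2)[OF p(1) lq pne] unfolding p(2) by blast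
        have "real_of_int (opnorm h) \<le> c * real_of_int (min (opnorm (inv\<^bsub>Fn\<^esub> (l # p))) (opnorm h))"
          using 1 2 by (simp add: min_def)
        also have "\<dots> \<le> c * (K * exp (\<epsilon>' * real (length p + length (l # p))))"
          by (rule mult_left_mono[OF min]) (use c(1) in simp)
        also have "\<dots> = c * K * exp \<epsilon>' * exp (2 * \<epsilon>' * real (length h))"
          using p(3) by (simp add: algebra_simps flip: exp_add)
        also have "\<dots> \<le> c * K * exp \<epsilon>' * exp (\<epsilon> * real (length h))"
          using \<epsilon>' K(1) c(1) by (intro mult_left_mono) (auto intro!: mult_right_mono)
        also have "\<dots> \<le> K' * exp (\<epsilon> * real (length h))"
          using K(1) c(1) D by (intro K'_le) (auto simp: K'_def)
        finally show ?thesis .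
      next
        case one: False
        have "fst l = fst (hd p)" if "l \<in> set p" for l
          using one pr(2) that by (cases l) (auto simp: words_over_def)
        then have lp: "last p = hd p" by (rule reduced_one_generator[OF pr(1) pne])
        have hr: "reduced h" using h by (simp add: free_group_carrier)
        have side: "h = [] \<or> hd h \<noteq> hd p"
        proof (rule ccontr)
          assume "\<not> (h = [] \<or> hd h \<noteq> hd p)"
          then have "h \<noteq> []" "hd h = last p" using lp by auto
          then have "reduced (p @ h)"
            using pr(1) hr by (auto simp: reduced_def successively_append_iff)
          then have "p \<otimes>\<^bsub>Fn\<^esub> h = p @ h" by (simp add: free_group_mult reduce_reduced)
          moreover have "p \<otimes>\<^bsub>Fn\<^esub> h = []" using h by (simp add: p_def free_group_one)
          ultimately show False using pne by simp
        qed
        define E where "E = K * exp (\<epsilon>' * real (length p + length h))"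
        have min: "real_of_int (min (opnorm p) (opnorm h)) \<le> E"
          using K(2)[OF p(1) h pne side] unfolding p(2) p_def[symmetric] E_def .
        have "E = K * exp (2 * \<epsilon>' * real (length h))" using p(3) by (simp add: E_def algebra_simps)
        also have "\<dots> \<le> K * exp (\<epsilon> * real (length h))"
          using \<epsilon>' K(1) by (auto intro!: mult_right_mono)
        also have "\<dots> \<le> K' * exp (\<epsilon> * real (length h))"
          using K(1) c(1) D by (intro K'_le) (auto simp: K'_def)
        finally have E1: "E \<le> K' * exp (\<epsilon> * real (length h))" .
        have "D * E ^ d = D * K ^ d * exp (2 * real d * \<epsilon>' * real (length h))"
          using p(3) by (simp add: E_def power_mult_distrib algebra_simps flip: exp_of_nat_mult)
        also have "\<dots> \<le> D * K ^ d * exp (\<epsilon> * real (length h))"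
          using \<epsilon>' K(1) D by (intro mult_left_mono) (auto intro!: mult_right_mono)
        also have "\<dots> \<le> K' * exp (\<epsilon> * real (length h))"
          using K(1) c(1) D by (intro K'_le) (auto simp: K'_def)
        finally have E2: "D * E ^ d \<le> K' * exp (\<epsilon> * real (length h))" .
        show ?thesis
        proof (cases "opnorm h \<le> opnorm p")
          case True
          then show ?thesis using min E1 by (simp add: min_def split: if_splits)
        next
          case False
          then have "real_of_int (opnorm p) \<le> E" using min by (simp add: min_def)
          then have "real_of_int (opnorm p) ^ d \<le> E ^ d" by (intro power_mono) auto
          then have "D * real_of_int (opnorm p) ^ d \<le> D * E ^ d" using D by (intro mult_left_mono)
          moreover have "real_of_int (opnorm h) \<le> D * real_of_int (opnorm p) ^ d"
          proof -
            have "real_of_int (opnorm h) \<le> real_of_int (int d * int d * (fact d * opnorm p ^ d))"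
              using opnorm_le_opnorm_inv[OF h] unfolding p_def by (simp only: of_int_le_iff)
            then show ?thesis by (simp add: D_def mult.assoc)
          qed
          ultimately show ?thesis using E2 by linarith
        qed
      qed
    qed
  qed
qed

end

section \<open>Unipotence\<close>

context free_lattice_action
begin

text \<open>The product of the operators \<open>T s - 1\<close>, applied to \<open>v\<close>.\<close>

fun differences :: "nat gword list \<Rightarrow> (nat \<Rightarrow> int) \<Rightarrow> nat \<Rightarrow> int" where
  "differences [] v = v"
| "differences (s # ss) v = differences ss (T s v - v)"

lemma differences_append: "differences (ss @ ts) v = differences ts (differences ss v)"
  by (induction ss arbitrary: v) auto

lemma differences_diff: "differences ss (u - v) = differences ss u - differences ss v"
proof (induction ss arbitrary: u v)
  case (Cons s ss)
  have "T s (u - v) - (u - v) = (T s u - u) - (T s v - v)" by (simp add: act.T_diff)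
  then show ?case by (simp only: differences.simps Cons.IH)
qed simp

lemma differences_zero [simp]: "differences ss 0 = 0"
  using differences_diff[of ss 0 0] by simp

lemma differences_closed: "v \<in> integer_vectors d \<Longrightarrow> differences ss v \<in> integer_vectors d"
proof (induction ss arbitrary: v)
  case (Cons s ss)
  have "T s v - v \<in> integer_vectors d"
    using additive_subgroup_integer_vectors act.T_lattice Cons.prems by (rule additive_subgroup_diff)
  from Cons.IH[OF this] show ?case by (simp only: differences.simps)
qed simp

lemma expand_unit_vectors:
  assumes "v \<in> integer_vectors d"
  shows "v j = (\<Sum>i<d. v i * unit_vector i j)"
proof -
  have "T [] w = w" if "w \<in> integer_vectors d" for w
    using act.T_one[OF that] by (simp add: free_group_one)
  then show ?thesis using act.T_expand[of "[]" v j] assms by simp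
qed

lemma differences_expand:
  assumes v: "v \<in> integer_vectors d"
  shows "differences ss v j = (\<Sum>i<d. v i * differences ss (unit_vector i) j)"
proof (induction ss arbitrary: j rule: rev_induct)
  case Nil
  show ?case unfolding differences.simps by (rule expand_unit_vectors[OF v])
next
  case (snoc s ss)
  let ?w = "differences ss v"
  have "T s ?w j = (\<Sum>k<d. (\<Sum>i<d. v i * differences ss (unit_vector i) k) * T s (unit_vector k) j)"
    by (subst act.T_expand) (simp add: snoc)
  also have "\<dots> = (\<Sum>i<d. \<Sum>k<d. v i * (differences ss (unit_vector i) k * T s (unit_vector k) j))"
    unfolding sum_distrib_right by (subst sum.swap) (simp add: mult.assoc)
  also have "\<dots> = (\<Sum>i<d. v i * T s (differences ss (unit_vector i)) j)"
    by (intro sum.cong refl, subst (2) act.T_expand) (simp add: sum_distrib_left)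
  finally show ?case
    by (simp add: differences_append snoc sum_subtractf right_diff_distrib)
qed

text \<open>Every factor contributes a factor \<open>M\<close>.\<close>

lemma differences_dvd:
  assumes "set ss \<subseteq> act.principal M" "v \<in> integer_vectors d"
  shows "M ^ length ss dvd differences ss v j"
  using assms
proof (induction ss arbitrary: j rule: rev_induct)
  case (snoc s ss)
  let ?w = "differences ss v" and ?m = "M ^ length ss"
  define u where "u = (\<lambda>j. ?w j div ?m)"
  have w: "?w = (\<lambda>j. ?m * u j)" using snoc by (auto simp: u_def)
  have "u \<in> integer_vectors d"
    using differences_closed[OF snoc.prems(2), of ss] by (auto simp: u_def integer_vectors_def)
  then have "vcong M (T s u) u" using snoc.prems(1) by (auto simp: act.principal_def)
  then have "M dvd T s u j - u j" by (simp add: vcong_def)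
  moreover have "differences (ss @ [s]) v j = ?m * (T s u j - u j)"
    by (simp add: differences_append w act.T_scale right_diff_distrib)
  ultimately show ?case by (simp add: mult.commute mult_dvd_mono)
qed simp

text \<open>Expanding the product gives \<open>2\<^sup>k\<close> words of length at most \<open>k l\<close>;
  the extra word \<open>h\<close> is there for the induction.\<close>

lemma vnorm_differences:
  assumes K: "\<And>h. h \<in> carrier Fn \<Longrightarrow> real_of_int (opnorm h) \<le> K * exp (\<epsilon> * real (length h))"
    and \<epsilon>: "\<epsilon> > 0" and S: "\<And>s. s \<in> set ss \<Longrightarrow> s \<in> carrier Fn \<and> length s \<le> l"
    and h: "h \<in> carrier Fn"
  shows "real_of_int (vnorm (T h (differences ss v))) \<le>
    2 ^ length ss * (K * exp (\<epsilon> * real (length h + l * length ss))) * real_of_int (vnorm v)"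
  using S h
proof (induction ss arbitrary: h rule: rev_induct)
  case Nil
  have "real_of_int (vnorm (T h v)) \<le> real_of_int (opnorm h) * real_of_int (vnorm v)"
    using vnorm_T[of h v] by (simp only: of_int_le_iff flip: of_int_mult)
  also have "\<dots> \<le> (K * exp (\<epsilon> * real (length h))) * real_of_int (vnorm v)"
    using K Nil by (intro mult_right_mono) auto
  finally show ?case by simp
next
  case (snoc s ss)
  let ?w = "differences ss v"
  let ?E = "\<lambda>k. 2 ^ length ss * (K * exp (\<epsilon> * real (k + l * length ss))) * real_of_int (vnorm v)"
  have s: "s \<in> carrier Fn" "length s \<le> l" using snoc.prems by auto
  have sh: "s \<otimes>\<^bsub>Fn\<^esub> h \<in> carrier Fn" using s snoc.prems by simp
  have lsh: "length (s \<otimes>\<^bsub>Fn\<^esub> h) \<le> length h + l"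
    using length_reduce_le[of "s @ h"] s by (simp add: free_group_mult)
  have "K * exp (\<epsilon> * real (length h)) \<ge> 0"
    using K[OF snoc.prems(2)] opnorm_nonneg[of h] by (smt (verit) of_int_0_le_iff)
  then have K0: "K \<ge> 0" by (simp add: zero_le_mult_iff)
  have mono: "?E k \<le> ?E k'" if "k \<le> k'" for k k'
    using that \<epsilon> K0 by (intro mult_right_mono mult_left_mono) auto
  have "T h (differences (ss @ [s]) v) = T (s \<otimes>\<^bsub>Fn\<^esub> h) ?w - T h ?w"
    using s snoc.prems by (simp add: differences_append act.T_diff T_mult)
  then have "vnorm (T h (differences (ss @ [s]) v)) \<le> vnorm (T (s \<otimes>\<^bsub>Fn\<^esub> h) ?w) + vnorm (T h ?w)"
    using vnorm_diff by simp
  then have "real_of_int (vnorm (T h (differences (ss @ [s]) v))) \<le>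
      real_of_int (vnorm (T (s \<otimes>\<^bsub>Fn\<^esub> h) ?w)) + real_of_int (vnorm (T h ?w))"
    by (simp only: of_int_le_iff flip: of_int_add)
  also have "\<dots> \<le> ?E (length (s \<otimes>\<^bsub>Fn\<^esub> h)) + ?E (length h)"
    using snoc.IH[OF _ sh] snoc.IH[OF _ snoc.prems(2)] snoc.prems(1) by (intro add_mono) auto
  also have "\<dots> \<le> ?E (length h + l) + ?E (length h + l)"
    using lsh by (intro add_mono mono) auto
  also have "\<dots> = 2 ^ length (ss @ [s]) * (K * exp (\<epsilon> * real (length h + l * length (ss @ [s])))) * real_of_int (vnorm v)"
    by (simp add: algebra_simps)
  finally show ?case .
qed

text \<open>A product of \<open>k\<close> differences is divisible by \<open>3\<^sup>k\<close>, and its norm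
  grows at most like \<open>c\<^sup>k\<close> with \<open>c < 3\<close>. An integer with both
  properties is \<open>0\<close> for large \<open>k\<close>.\<close>

lemma differences_vanish:
  assumes growth: "\<And>\<epsilon>. \<epsilon> > 0 \<Longrightarrow> \<exists>K>0. \<forall>h\<in>carrier Fn. real_of_int (opnorm h) \<le> K * exp (\<epsilon> * real (length h))"
    and S: "finite S" "S \<subseteq> act.principal 3"
  obtains k where "\<And>ss v. set ss \<subseteq> S \<Longrightarrow> length ss = k \<Longrightarrow> v \<in> integer_vectors d \<Longrightarrow> differences ss v = 0"
proof -
  define l where "l = Max (insert 0 (length ` S))"
  have l: "length s \<le> l" if "s \<in> S" for s using that S(1) by (auto simp: l_def)
  \<comment> \<open>The constants satisfy \<open>2 * (5 / 4) < 3\<close>.\<close>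
  define \<epsilon> where "\<epsilon> = ln (5 / 4) / (real l + 1)"
  have \<epsilon>: "\<epsilon> > 0" by (simp add: \<epsilon>_def)
  have "\<epsilon> * real l \<le> ln (5 / 4)" by (simp add: \<epsilon>_def field_simps)
  then have "exp (\<epsilon> * real l) \<le> exp (ln (5 / 4))" by (simp only: exp_le_cancel_iff)
  then have expl: "exp (\<epsilon> * real l) \<le> 5 / 4" by simp
  obtain K where K: "K > 0" "\<And>h. h \<in> carrier Fn \<Longrightarrow> real_of_int (opnorm h) \<le> K * exp (\<epsilon> * real (length h))"
    using growth[OF \<epsilon>] by blast
  obtain k where k: "(5 / 6) ^ k < 1 / K" using real_arch_pow_inv[of "1 / K" "5 / 6"] K(1) by auto
  have SF: "S \<subseteq> carrier Fn" using S(2) by (auto simp: act.principal_def)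
  have unit: "differences ss (unit_vector i) j = 0"
    if ss: "set ss \<subseteq> S" "length ss = k" and i: "i < d" for ss i j
  proof (cases "j < d")
    case True
    have ui: "unit_vector i \<in> integer_vectors d" using i by simp
    let ?w = "differences ss (unit_vector i)"
    have "T [] ?w = ?w" using act.T_one[OF differences_closed[OF ui, of ss]] by (simp add: free_group_one)
    then have "real_of_int (vnorm ?w) \<le> 2 ^ k * (K * exp (\<epsilon> * real (l * k))) * 1"
      using vnorm_differences[OF K(2) \<epsilon>, of ss l "[]" "unit_vector i"] ss SF l i
      by (auto simp: vnorm_unit_vector subset_iff)
    also have "exp (\<epsilon> * real (l * k)) = exp (\<epsilon> * real l) ^ k"
      by (simp add: exp_of_nat_mult[symmetric] algebra_simps)
    also have "2 ^ k * (K * exp (\<epsilon> * real l) ^ k) * 1 \<le> 2 ^ k * (K * (5 / 4) ^ k) * 1"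
      using K(1) expl by (intro mult_right_mono mult_left_mono power_mono) auto
    also have "\<dots> = 3 ^ k * (K * (5 / 6) ^ k)"
    proof -
      have "(2::real) ^ k * (5 / 4) ^ k = 3 ^ k * (5 / 6) ^ k" by (simp flip: power_mult_distrib)
      then show ?thesis by (simp add: mult.left_commute)
    qed
    also have "\<dots> < 3 ^ k * 1" using k K(1) by (intro mult_strict_left_mono) (auto simp: field_simps)
    finally have "real_of_int (vnorm ?w) < real_of_int (3 ^ k)" by simp
    then have "vnorm ?w < 3 ^ k" by (simp only: of_int_less_iff)
    moreover have "\<bar>?w j\<bar> \<le> vnorm ?w" unfolding vnorm_def using True by (intro member_le_sum) auto
    moreover have "3 ^ k dvd ?w j"
      using differences_dvd[of ss 3 "unit_vector i" j] ss S(2) ui by auto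
    ultimately show ?thesis using dvd_imp_le_int[of "?w j" "3 ^ k"] by fastforce
  next
    case False
    then show ?thesis
      using differences_closed[OF act.unit_vector_in[OF i], of ss] by (simp add: integer_vectors_def)
  qed
  show thesis
  proof (rule that[of k])
    fix ss v assume "set ss \<subseteq> S" "length ss = k" "v \<in> integer_vectors d"
    then show "differences ss v = 0"
      using differences_expand[of v ss] unit[of ss] by (intro ext) simp
  qed
qed

lemma mod_class_mult:
  assumes "act.mod_class M g = act.mod_class M h" "g \<in> carrier Fn" "h \<in> carrier Fn" "k \<in> carrier Fn"
  shows "act.mod_class M (g \<otimes>\<^bsub>Fn\<^esub> k) = act.mod_class M (h \<otimes>\<^bsub>Fn\<^esub> k)"
  using assms act.T_vcong[OF act.mod_class_eqD[OF assms(1)]]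
  by (intro act.mod_class_eqI) (simp add: T_mult)

text \<open>Schreier's lemma: with a representative for every class modulo \<open>M\<close>, a word is the
  product of the elements \<open>r [l] r'\<^sup>-\<^sup>1\<close> for its letters
  \<open>l\<close>, where \<open>r\<close> and \<open>r'\<close> represent its prefixes before and
  after \<open>l\<close>. Generation is expressed by the induction principle that is needed below.\<close>

lemma principal_finitely_generated:
  assumes M: "M > 0"
  obtains S where "finite S" "S \<subseteq> act.principal M"
    "\<And>P g. (\<And>s. s \<in> S \<Longrightarrow> P s) \<Longrightarrow> (\<And>g h. g \<in> act.principal M \<Longrightarrow> h \<in> act.principal M \<Longrightarrow> P g \<Longrightarrow> P h \<Longrightarrow> P (g \<otimes>\<^bsub>Fn\<^esub> h)) \<Longrightarrow>
      g \<in> act.principal M \<Longrightarrow> P g"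
proof -
  let ?P = "act.principal M" and ?c = "act.mod_class M"
  define rep where "rep c = (SOME g. g \<in> carrier Fn \<and> ?c g = c)" for c
  have rep: "rep (?c g) \<in> carrier Fn" "?c (rep (?c g)) = ?c g" if "g \<in> carrier Fn" for g
    using someI_ex[of "\<lambda>h. h \<in> carrier Fn \<and> ?c h = ?c g"] that unfolding rep_def by blast+
  define C where "C = ?c ` carrier Fn"
  have C: "finite C" unfolding C_def using act.finite_mod_class[OF M] by (rule finite_subset[rotated]) auto
  define r1 where "r1 = rep (?c [])"
  define S where "S = ((\<lambda>(c, c', l). rep c \<otimes>\<^bsub>Fn\<^esub> [l] \<otimes>\<^bsub>Fn\<^esub> inv\<^bsub>Fn\<^esub> rep c') ` (C \<times> C \<times> ({..<n} \<times> UNIV)) \<union>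
    {r1, inv\<^bsub>Fn\<^esub> r1}) \<inter> ?P"
  have r1: "r1 \<in> carrier Fn" "?c r1 = ?c []" using rep[of "[]"] by (auto simp: r1_def)
  have "r1 \<otimes>\<^bsub>Fn\<^esub> inv\<^bsub>Fn\<^esub> [] = r1"
    using Fn.inv_one[unfolded free_group_one] Fn.r_one[OF r1(1), unfolded free_group_one] by simp
  then have r1P: "r1 \<in> ?P"
    using act.mod_class_principal[OF r1(1) Nil_in_free_group r1(2)] by metis
  have r1P': "inv\<^bsub>Fn\<^esub> r1 \<in> ?P" using subgroup.m_inv_closed[OF act.subgroup_principal r1P] .
  show thesis
  proof (rule that[of S])
    show "finite S" unfolding S_def using C by auto
    show "S \<subseteq> ?P" unfolding S_def by blast
    fix P g assume S: "\<And>s. s \<in> S \<Longrightarrow> P s"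
      and mult: "\<And>g h. g \<in> ?P \<Longrightarrow> h \<in> ?P \<Longrightarrow> P g \<Longrightarrow> P h \<Longrightarrow> P (g \<otimes>\<^bsub>Fn\<^esub> h)" and g: "g \<in> ?P"
    have quot: "u \<otimes>\<^bsub>Fn\<^esub> inv\<^bsub>Fn\<^esub> rep (?c u) \<in> ?P" if "u \<in> carrier Fn" for u
      using act.mod_class_principal[OF that rep(1)[OF that]] rep(2)[OF that] by simp
    have *: "P (reduce w \<otimes>\<^bsub>Fn\<^esub> inv\<^bsub>Fn\<^esub> rep (?c (reduce w)))" if "w \<in> words_over {..<n}" for w
      using that
    proof (induction w rule: rev_induct)
      case Nil
      have "[] \<otimes>\<^bsub>Fn\<^esub> inv\<^bsub>Fn\<^esub> r1 = inv\<^bsub>Fn\<^esub> r1" using r1 Fn.l_one[of "inv\<^bsub>Fn\<^esub> r1"] by (simp add: free_group_one)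
      moreover have "inv\<^bsub>Fn\<^esub> r1 \<in> S" using r1P' by (simp add: S_def)
      moreover have "reduce [] = ([] :: nat gword)" by (simp add: reduce_def)
      ultimately show ?case using S by (simp add: r1_def)
    next
      case (snoc l w)
      define u where "u = reduce w"
      have w: "w \<in> words_over {..<n}" and l: "fst l < n" using snoc.prems by auto
      have uF: "u \<in> carrier Fn" unfolding u_def using w by (rule reduce_in_free_group)
      have lF: "[l] \<in> carrier Fn" using l by (simp add: free_group_carrier reduced_def)
      define r where "r = rep (?c u)"
      define r' where "r' = rep (?c (u \<otimes>\<^bsub>Fn\<^esub> [l]))"
      have r: "r \<in> carrier Fn" "?c r = ?c u" and r': "r' \<in> carrier Fn" "?c r' = ?c (u \<otimes>\<^bsub>Fn\<^esub> [l])"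
        using rep uF lF by (auto simp: r_def r'_def)
      have cl: "?c (r \<otimes>\<^bsub>Fn\<^esub> [l]) = ?c r'" using mod_class_mult[OF r(2) r(1) uF lF] r'(2) by simp
      have "r \<otimes>\<^bsub>Fn\<^esub> [l] \<otimes>\<^bsub>Fn\<^esub> inv\<^bsub>Fn\<^esub> r' \<in> ?P"
        using act.mod_class_principal[OF _ r'(1) cl] r lF by simp
      moreover have "?c u \<in> C" "?c (u \<otimes>\<^bsub>Fn\<^esub> [l]) \<in> C" using uF lF by (auto simp: C_def)
      ultimately have "r \<otimes>\<^bsub>Fn\<^esub> [l] \<otimes>\<^bsub>Fn\<^esub> inv\<^bsub>Fn\<^esub> r' \<in> S"
        unfolding S_def r_def r'_def using l by (cases l) force
      then have "P (r \<otimes>\<^bsub>Fn\<^esub> [l] \<otimes>\<^bsub>Fn\<^esub> inv\<^bsub>Fn\<^esub> r')" by (rule S)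
      moreover have "P (u \<otimes>\<^bsub>Fn\<^esub> inv\<^bsub>Fn\<^esub> r)" using snoc.IH[OF w] by (simp add: u_def r_def)
      moreover have "u \<otimes>\<^bsub>Fn\<^esub> inv\<^bsub>Fn\<^esub> r \<in> ?P" unfolding r_def by (rule quot[OF uF])
      ultimately have "P ((u \<otimes>\<^bsub>Fn\<^esub> inv\<^bsub>Fn\<^esub> r) \<otimes>\<^bsub>Fn\<^esub> (r \<otimes>\<^bsub>Fn\<^esub> [l] \<otimes>\<^bsub>Fn\<^esub> inv\<^bsub>Fn\<^esub> r'))"
        using mult \<open>r \<otimes>\<^bsub>Fn\<^esub> [l] \<otimes>\<^bsub>Fn\<^esub> inv\<^bsub>Fn\<^esub> r' \<in> ?P\<close> by blast
      moreover have "(u \<otimes>\<^bsub>Fn\<^esub> inv\<^bsub>Fn\<^esub> r) \<otimes>\<^bsub>Fn\<^esub> (r \<otimes>\<^bsub>Fn\<^esub> [l] \<otimes>\<^bsub>Fn\<^esub> inv\<^bsub>Fn\<^esub> r') = u \<otimes>\<^bsub>Fn\<^esub> [l] \<otimes>\<^bsub>Fn\<^esub> inv\<^bsub>Fn\<^esub> r'"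
      proof -
        have "inv\<^bsub>Fn\<^esub> r \<otimes>\<^bsub>Fn\<^esub> (r \<otimes>\<^bsub>Fn\<^esub> ([l] \<otimes>\<^bsub>Fn\<^esub> inv\<^bsub>Fn\<^esub> r')) = [l] \<otimes>\<^bsub>Fn\<^esub> inv\<^bsub>Fn\<^esub> r'"
          using r r' lF by (simp flip: Fn.m_assoc)
        then show ?thesis using uF r r' lF by (simp add: Fn.m_assoc)
      qed
      moreover have "reduce (w @ [l]) = u \<otimes>\<^bsub>Fn\<^esub> [l]" by (simp add: u_def free_group_mult)
      ultimately show ?case by (simp add: r'_def)
    qed
    have gF: "g \<in> carrier Fn" using g by (simp add: act.principal_def)
    have "vcong M (T g v) (T [] v)" if "v \<in> integer_vectors d" for v
      using g that act.T_one[OF that] by (simp add: act.principal_def free_group_one)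
    then have "?c g = ?c []" by (rule act.mod_class_eqI)
    then have rg: "rep (?c g) = r1" by (simp add: r1_def)
    have "reduce g = g" "g \<in> words_over {..<n}" using gF by (auto simp: free_group_carrier reduce_reduced)
    with *[of g] have "P (g \<otimes>\<^bsub>Fn\<^esub> inv\<^bsub>Fn\<^esub> r1)" by (simp add: rg)
    moreover have "g \<otimes>\<^bsub>Fn\<^esub> inv\<^bsub>Fn\<^esub> r1 \<in> ?P" using quot[OF gF] by (simp add: rg)
    moreover have "P r1" using r1P by (intro S) (simp add: S_def)
    ultimately have "P (g \<otimes>\<^bsub>Fn\<^esub> inv\<^bsub>Fn\<^esub> r1 \<otimes>\<^bsub>Fn\<^esub> r1)" using mult r1P by blast
    then show "P g" using gF r1 by (simp add: Fn.m_assoc)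
  qed
qed

text \<open>The level 3 can be treated because its differences are nilpotent. The term \<open>Z i\<close> of
  the filtration consists of the vectors that are killed by all products of \<open>i\<close>
  differences of generators; that all elements of the congruence subgroup move \<open>Z (Suc
  i)\<close> into \<open>Z i\<close> passes from generators to products because of \<open>g h - 1
  = (g - 1) (h - 1) + (g - 1) + (h - 1)\<close>.\<close>

lemma orbits_separable:
  assumes growth: "\<And>\<epsilon>. \<epsilon> > 0 \<Longrightarrow> \<exists>K>0. \<forall>h\<in>carrier Fn. real_of_int (opnorm h) \<le> K * exp (\<epsilon> * real (length h))"
    and a: "a \<in> integer_vectors d" "a' \<in> integer_vectors d"
    and app: "\<And>m. m > 0 \<Longrightarrow> \<exists>h\<in>carrier Fn. vcong m (T h a) a'"
  shows "\<exists>h\<in>carrier Fn. T h a = a'"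
proof -
  have "(0 :: int) < 3" by simp
  then show ?thesis
  proof (rule principal_finitely_generated, goal_cases)
    case (1 S)
    note S = this
    show ?case
    proof (rule differences_vanish[OF _ S(1,2)], goal_cases)
      case (1 \<epsilon>)
      then show ?case by (rule growth)
    next
      case (2 k)
      note k = this
  define Z where "Z i = {v \<in> integer_vectors d. \<forall>ss. set ss \<subseteq> S \<and> length ss = i \<longrightarrow> differences ss v = 0}" for i
  have Zsub: "additive_subgroup (Z i)" for i
    using additive_subgroup_integer_vectors[of d]
    by (auto simp: additive_subgroup_def Z_def differences_diff)
  have Zsuc: "Z i \<subseteq> Z (Suc i)" for i
  proof
    fix v assume v: "v \<in> Z i"
    have "differences ss v = 0" if ss: "set ss \<subseteq> S" "length ss = Suc i" for ss
    proof -
      obtain ts s where ts: "ss = ts @ [s]" using ss(2) by (cases ss rule: rev_cases) auto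
      then have "differences ts v = 0" using v ss by (auto simp: Z_def)
      then show ?thesis by (simp add: ts differences_append)
    qed
    with v show "v \<in> Z (Suc i)" by (simp add: Z_def)
  qed
  have P: "\<forall>i. \<forall>v\<in>Z (Suc i). T \<gamma> v - v \<in> Z i" if "\<gamma> \<in> act.principal 3" for \<gamma>
  proof (rule S(3)[OF _ _ that])
    fix s assume s: "s \<in> S"
    show "\<forall>i. \<forall>v\<in>Z (Suc i). T s v - v \<in> Z i"
    proof (intro allI ballI)
      fix i v assume v: "v \<in> Z (Suc i)"
      have "differences ss (T s v - v) = 0" if "set ss \<subseteq> S" "length ss = i" for ss
      proof -
        have "set (s # ss) \<subseteq> S \<and> length (s # ss) = Suc i" using that s by simp
        then have "differences (s # ss) v = 0" using v unfolding Z_def by blast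
        then show ?thesis by simp
      qed
      moreover have "T s v - v \<in> integer_vectors d" using v
        by (auto simp: Z_def intro!: additive_subgroup_diff[OF additive_subgroup_integer_vectors] act.T_lattice)
      ultimately show "T s v - v \<in> Z i" by (simp add: Z_def)
    qed
  next
    fix g h assume g: "g \<in> act.principal 3" and h: "h \<in> act.principal 3"
      and IH: "\<forall>i. \<forall>v\<in>Z (Suc i). T g v - v \<in> Z i" "\<forall>i. \<forall>v\<in>Z (Suc i). T h v - v \<in> Z i"
    show "\<forall>i. \<forall>v\<in>Z (Suc i). T (g \<otimes>\<^bsub>Fn\<^esub> h) v - v \<in> Z i"
    proof (intro allI ballI)
      fix i v assume v: "v \<in> Z (Suc i)"
      define w where "w = T g v - v"
      have w: "w \<in> Z i" using IH(1) v by (simp add: w_def)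
      have eq: "T (g \<otimes>\<^bsub>Fn\<^esub> h) v - v = (T h w - w) + (T h v - v) + w"
        using g h by (simp add: w_def act.principal_def T_mult act.T_diff)
      have "T h w - w \<in> Z i" using IH(2) w Zsuc by blast
      moreover have "T h v - v \<in> Z i" using IH(2) v by blast
      ultimately have "(T h w - w) + (T h v - v) + w \<in> Z i"
        using w by (intro additive_subgroup_add Zsub)
      then show "T (g \<otimes>\<^bsub>Fn\<^esub> h) v - v \<in> Z i" by (simp only: eq)
    qed
  qed
  show ?case
  proof (rule act.orbit_separable[of 3 Z k])
    show "Z i \<subseteq> integer_vectors d" for i by (auto simp: Z_def)
    show "Z 0 = {0}" using additive_subgroup_zero[OF Zsub, of 0] by (auto simp: Z_def)
    show "Z k = integer_vectors d" using k by (auto simp: Z_def)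
  qed (use Zsub Zsuc P a app in auto)
    qed
  qed
qed

end

section \<open>Conjugacy modulo an integer\<close>

context free_lattice_action
begin

lemma T_Nil: "v \<in> integer_vectors d \<Longrightarrow> T [] v = v"
  using act.T_one by (simp add: free_group_one)

lemma Nil_mult: "w \<in> carrier Fn \<Longrightarrow> [] \<otimes>\<^bsub>Fn\<^esub> w = w"
  and mult_Nil: "w \<in> carrier Fn \<Longrightarrow> w \<otimes>\<^bsub>Fn\<^esub> [] = w"
  using Fn.l_one[of w] Fn.r_one[of w] by (simp_all only: free_group_one)

text \<open>\<open>g\<close> conjugates \<open>x\<close> to \<open>y\<close> in the group that arises from
  reducing the lattice modulo \<open>m\<close>; the case \<open>m = 0\<close> is conjugacy itself.\<close>

definition conj_mod :: "int \<Rightarrow> nat gword \<times> int vec \<Rightarrow> nat gword \<times> int vec \<Rightarrow> nat gword \<times> int vec \<Rightarrow> bool" where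
  "conj_mod m x y g \<longleftrightarrow> fst (x \<otimes>\<^bsub>G\<^esub> g) = fst (g \<otimes>\<^bsub>G\<^esub> y) \<and>
     vcong m (vec_part (x \<otimes>\<^bsub>G\<^esub> g)) (vec_part (g \<otimes>\<^bsub>G\<^esub> y))"

lemma vcong_0: "vcong 0 u v \<longleftrightarrow> u = v"
  by (auto simp: vcong_def)

lemma conj_mod_0:
  assumes "x \<in> carrier G" "y \<in> carrier G" "g \<in> carrier G"
  shows "conj_mod 0 x y g \<longleftrightarrow> x \<otimes>\<^bsub>G\<^esub> g = g \<otimes>\<^bsub>G\<^esub> y"
proof
  assume "conj_mod 0 x y g"
  then show "x \<otimes>\<^bsub>G\<^esub> g = g \<otimes>\<^bsub>G\<^esub> y" using assms unfolding conj_mod_def vcong_0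
    by (intro G_eqI) (simp_all del: fst_mult)
next
  assume "x \<otimes>\<^bsub>G\<^esub> g = g \<otimes>\<^bsub>G\<^esub> y"
  then show "conj_mod 0 x y g" unfolding conj_mod_def vcong_0 by (simp del: fst_mult)
qed

lemma conjugate_in_G_iff:
  assumes "x \<in> carrier G" "y \<in> carrier G"
  shows "conjugate_in G x y \<longleftrightarrow> (\<exists>g\<in>carrier G. conj_mod 0 x y g)"
  using assms by (auto simp: conjugate_in_G conj_mod_0)

lemma conj_mod_iff:
  assumes "x \<in> carrier G" "y \<in> carrier G" "g \<in> carrier G"
  shows "conj_mod m x y g \<longleftrightarrow> fst x \<otimes>\<^bsub>Fn\<^esub> fst g = fst g \<otimes>\<^bsub>Fn\<^esub> fst y \<and>
    vcong m (T (fst g) (vec_part x) + vec_part g) (T (fst y) (vec_part g) + vec_part y)"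
  using assms by (simp add: conj_mod_def vec_part_mult)

lemma conj_mod_cong:
  assumes "x \<in> carrier G" "y \<in> carrier G" "g \<in> carrier G" "h \<in> carrier G"
    and "fst g = fst h" "vcong m (vec_part g) (vec_part h)" "conj_mod m x y g"
  shows "conj_mod m x y h"
proof -
  have 1: "vcong m (T (fst h) (vec_part x) + vec_part h) (T (fst g) (vec_part x) + vec_part g)"
    unfolding assms(5) using assms(6) by (intro vcong_add) (auto intro: vcong_sym)
  have 2: "vcong m (T (fst g) (vec_part x) + vec_part g) (T (fst y) (vec_part g) + vec_part y)"
    using assms by (simp add: conj_mod_iff)
  have 3: "vcong m (T (fst y) (vec_part g) + vec_part y) (T (fst y) (vec_part h) + vec_part y)"
    using assms(6) by (intro vcong_add act.T_vcong) auto
  have "vcong m (T (fst h) (vec_part x) + vec_part h) (T (fst y) (vec_part h) + vec_part y)"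
    by (rule vcong_trans[OF 1 vcong_trans[OF 2 3]])
  moreover have "fst x \<otimes>\<^bsub>Fn\<^esub> fst h = fst h \<otimes>\<^bsub>Fn\<^esub> fst y" using assms by (simp add: conj_mod_iff)
  ultimately show ?thesis using assms by (simp add: conj_mod_iff)
qed

text \<open>An element that commutes with \<open>x\<close> turns a conjugator into another one.\<close>

lemma conj_mod_translate:
  assumes x: "x \<in> carrier G" and y: "y \<in> carrier G" and g: "g \<in> carrier G"
    and c: "conj_mod m x y g" and k: "k \<in> carrier G" "k \<otimes>\<^bsub>G\<^esub> x = x \<otimes>\<^bsub>G\<^esub> k"
  shows "conj_mod m x y (k \<otimes>\<^bsub>G\<^esub> g)"
proof -
  have e: "x \<otimes>\<^bsub>G\<^esub> (k \<otimes>\<^bsub>G\<^esub> g) = k \<otimes>\<^bsub>G\<^esub> (x \<otimes>\<^bsub>G\<^esub> g)" "k \<otimes>\<^bsub>G\<^esub> g \<otimes>\<^bsub>G\<^esub> y = k \<otimes>\<^bsub>G\<^esub> (g \<otimes>\<^bsub>G\<^esub> y)"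
    using x y g k by (simp_all flip: G.m_assoc)
  have f: "fst (x \<otimes>\<^bsub>G\<^esub> g) = fst (g \<otimes>\<^bsub>G\<^esub> y)" using c by (simp add: conj_mod_def)
  have "vcong m (vec_part (k \<otimes>\<^bsub>G\<^esub> (x \<otimes>\<^bsub>G\<^esub> g))) (vec_part (k \<otimes>\<^bsub>G\<^esub> (g \<otimes>\<^bsub>G\<^esub> y)))"
    using x y g k c f unfolding conj_mod_def
    by (subst (1 2) vec_part_mult) (auto intro!: vcong_add simp del: fst_mult)
  moreover have "fst (k \<otimes>\<^bsub>G\<^esub> (x \<otimes>\<^bsub>G\<^esub> g)) = fst (k \<otimes>\<^bsub>G\<^esub> (g \<otimes>\<^bsub>G\<^esub> y))"
    unfolding fst_mult[of k] f ..
  ultimately show ?thesis unfolding conj_mod_def e by blast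
qed

text \<open>A conjugator with a shortest first component cannot be shortened by \<open>x\<close> or its
  inverse, so \<open>short_conjugator\<close> applies.\<close>

lemma short_conj_mod:
  assumes x: "x \<in> carrier G" and y: "y \<in> carrier G" and ne: "fst x \<noteq> []"
    and ex: "\<exists>g\<in>carrier G. conj_mod m x y g"
  shows "\<exists>g\<in>carrier G. conj_mod m x y g \<and> length (fst g) < length (fst x) + length (fst y)"
proof -
  define P where "P l \<longleftrightarrow> (\<exists>g\<in>carrier G. conj_mod m x y g \<and> length (fst g) = l)" for l
  have "\<exists>l. P l" using ex by (auto simp: P_def)
  then have "P (LEAST l. P l)" by (rule LeastI_ex)
  then obtain g where g: "g \<in> carrier G" "conj_mod m x y g" "length (fst g) = (LEAST l. P l)"
    by (auto simp: P_def)
  have min: "length (fst g) \<le> length (fst h)" if "h \<in> carrier G" "conj_mod m x y h" for h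
    unfolding g(3) using that by (intro Least_le) (auto simp: P_def)
  have "length (fst g) < length (fst x) + length (fst y)"
  proof (rule short_conjugator[of "fst x" "{..<n}" "fst y" "fst g"])
    show "fst x \<otimes>\<^bsub>Fn\<^esub> fst g = fst g \<otimes>\<^bsub>Fn\<^esub> fst y" using g x y by (simp add: conj_mod_iff)
    have "conj_mod m x y (x \<otimes>\<^bsub>G\<^esub> g)" using x y g by (intro conj_mod_translate) auto
    then show "length (fst g) \<le> length (fst x \<otimes>\<^bsub>Fn\<^esub> fst g)" using min[of "x \<otimes>\<^bsub>G\<^esub> g"] x g by simp
    have "conj_mod m x y (inv\<^bsub>G\<^esub> x \<otimes>\<^bsub>G\<^esub> g)" using x y g by (intro conj_mod_translate) auto
    moreover have "fst (inv\<^bsub>G\<^esub> x) = inv\<^bsub>Fn\<^esub> fst x"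
    proof -
      have "fst (inv\<^bsub>G\<^esub> x \<otimes>\<^bsub>G\<^esub> x) = []" using x by simp
      then have "fst (inv\<^bsub>G\<^esub> x) \<otimes>\<^bsub>Fn\<^esub> fst x = \<one>\<^bsub>Fn\<^esub>" by (simp add: free_group_one)
      then show ?thesis using x by (metis Fn.inv_equality G.inv_closed fst_closed)
    qed
    ultimately show "length (fst g) \<le> length (inv\<^bsub>Fn\<^esub> fst x \<otimes>\<^bsub>Fn\<^esub> fst g)"
      using min[of "inv\<^bsub>G\<^esub> x \<otimes>\<^bsub>G\<^esub> g"] x g by simp
  qed (use x y g ne in auto)
  with g show ?thesis by blast
qed

text \<open>The number of vectors modulo \<open>m\<close> bounds the length of a path in an orbit modulo
  \<open>m\<close>.\<close>

lemma short_orbit_mod: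
  assumes m: "m > 0" and h: "h \<in> carrier Fn"
  shows "\<exists>g\<in>carrier Fn. length g \<le> m ^ d \<and> vcong (int m) (T g a) (T h a)"
proof -
  define P where "P l \<longleftrightarrow> (\<exists>g\<in>carrier Fn. vcong (int m) (T g a) (T h a) \<and> length g = l)" for l
  have "P (length h)" unfolding P_def using h vcong_refl by blast
  then have "P (LEAST l. P l)" by (rule LeastI)
  then obtain g where g: "g \<in> carrier Fn" "vcong (int m) (T g a) (T h a)" "length g = (LEAST l. P l)"
    by (auto simp: P_def)
  have min: "length g \<le> length g'" if "g' \<in> carrier Fn" "vcong (int m) (T g' a) (T h a)" for g'
    unfolding g(3) using that by (intro Least_le) (auto simp: P_def)
  have gw: "g \<in> words_over {..<n}" "reduced g" using g(1) by (auto simp: free_group_carrier)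
  have pre: "reduce (take k g) \<in> carrier Fn" "reduce (drop k g) \<in> carrier Fn" for k
    using gw(1) words_over_append[of "take k g" "drop k g"] by (auto intro!: reduce_in_free_group)
  have "length g \<le> m ^ d"
  proof (rule ccontr)
    assume long: "\<not> length g \<le> m ^ d"
    define f where "f k = map (\<lambda>i. T (reduce (take k g)) a i mod int m) [0..<d]" for k
    let ?B = "{xs. set xs \<subseteq> {0..<int m} \<and> length xs = d}"
    have "f ` {..length g} \<subseteq> ?B" using m by (auto simp: f_def)
    moreover have "finite ?B" by (rule finite_lists_length_eq) simp
    moreover have "card ?B = m ^ d" by (subst card_lists_length_eq) auto
    ultimately have "card (f ` {..length g}) \<le> m ^ d" by (metis card_mono)
    then have "\<not> inj_on f {..length g}" using long by (auto dest: card_image)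
    then obtain k l where "k \<noteq> l" "k \<le> length g" "l \<le> length g" "f k = f l"
      by (auto simp: inj_on_def)
    then obtain k l where kl: "k < l" "l \<le> length g" "f k = f l" by (metis linorder_neqE_nat)
    have eq: "vcong (int m) (T (reduce (take k g)) a) (T (reduce (take l g)) a)"
      unfolding vcong_def
    proof
      fix i
      show "int m dvd T (reduce (take k g)) a i - T (reduce (take l g)) a i"
      proof (cases "i < d")
        case True
        have "f k ! i = f l ! i" using kl by simp
        then show ?thesis using True by (simp add: f_def mod_eq_dvd_iff)
      next
        case False
        then show ?thesis using act.T_lattice[of "reduce (take k g)" a] act.T_lattice[of "reduce (take l g)" a]
          by (simp add: integer_vectors_def)
      qed
    qed
    define g' where "g' = reduce (take k g) \<otimes>\<^bsub>Fn\<^esub> reduce (drop l g)"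
    have g': "g' \<in> carrier Fn" unfolding g'_def using pre by simp
    have "reduce (take l g) \<otimes>\<^bsub>Fn\<^esub> reduce (drop l g) = g"
      using gw(2) by (simp add: free_group_mult reduce_reduced)
    then have "T g a = T (reduce (drop l g)) (T (reduce (take l g)) a)"
      using pre T_mult[of "reduce (take l g)" "reduce (drop l g)"] by simp
    moreover have "T g' a = T (reduce (drop l g)) (T (reduce (take k g)) a)"
      unfolding g'_def using pre by (simp add: T_mult)
    ultimately have "vcong (int m) (T g' a) (T g a)" using act.T_vcong[OF eq] by simp
    then have "vcong (int m) (T g' a) (T h a)" using g(2) by (rule vcong_trans)
    then have "length g \<le> length g'" using min g' by blast
    moreover have "length g' \<le> length (take k g @ drop l g)"
      using length_reduce_le[of "take k g @ drop l g"] by (simp add: g'_def free_group_mult)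
    ultimately show False using kl by simp
  qed
  with g show ?thesis by blast
qed

text \<open>The bound serves both kinds of elements: the length of short conjugators if \<open>fst x\<close>
  is not trivial, and the number of vectors modulo \<open>m\<close>, hence the diameter of orbits,
  if it is.\<close>

definition bounded_conj_mod :: "nat \<Rightarrow> nat gword \<times> int vec \<Rightarrow> nat gword \<times> int vec \<Rightarrow> bool" where
  "bounded_conj_mod m x y \<longleftrightarrow> (\<exists>h\<in>carrier Fn. \<exists>z\<in>integer_vectors d.
     length h \<le> length (fst x) + length (fst y) + m ^ d \<and> (\<forall>i. 0 \<le> z i \<and> z i < int m) \<and>
     conj_mod (int m) x y (elem h z))"

lemma conjugate_imp_bounded_conj_mod:
  assumes x: "x \<in> carrier G" and y: "y \<in> carrier G" and m: "m > 0"
    and conj: "conjugate_in G x y"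
  shows "bounded_conj_mod m x y"
proof -
  have ex: "\<exists>g\<in>carrier G. conj_mod 0 x y g" using conj x y by (simp add: conjugate_in_G_iff)
  have "\<exists>g\<in>carrier G. conj_mod (int m) x y g \<and> length (fst g) \<le> length (fst x) + length (fst y) + m ^ d"
  proof (cases "fst x = []")
    case False
    then obtain g where "g \<in> carrier G" "conj_mod 0 x y g" "length (fst g) < length (fst x) + length (fst y)"
      using short_conj_mod[OF x y False ex] by blast
    then show ?thesis by (auto simp: conj_mod_def vcong_0 intro!: bexI[of _ g])
  next
    case True
    obtain g where g: "g \<in> carrier G" "conj_mod 0 x y g" using ex by blast
    have f: "fst x \<otimes>\<^bsub>Fn\<^esub> fst g = fst g \<otimes>\<^bsub>Fn\<^esub> fst y"
      and v: "T (fst g) (vec_part x) + vec_part g = T (fst y) (vec_part g) + vec_part y"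
      using g x y by (simp_all add: conj_mod_iff vcong_0)
    have fy: "fst y = []"
    proof -
      have "fst g \<otimes>\<^bsub>Fn\<^esub> fst y = fst g \<otimes>\<^bsub>Fn\<^esub> []" using f g(1) by (simp add: True Nil_mult free_group_one)
      then show ?thesis using g(1) y Fn.Units_l_cancel[of "fst g" "fst y" "[]"] by (simp add: Fn.Units_eq free_group_one)
    qed
    have a: "T (fst g) (vec_part x) = vec_part y"
    proof -
      have "T (fst g) (vec_part x) + vec_part g = vec_part y + vec_part g"
        using v by (simp add: fy T_Nil add.commute)
      then show ?thesis by (rule add_right_imp_eq)
    qed
    obtain h where h: "h \<in> carrier Fn" "length h \<le> m ^ d" "vcong (int m) (T h (vec_part x)) (vec_part y)"
      using short_orbit_mod[OF m fst_closed[OF g(1)], of "vec_part x"] unfolding a by blast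
    have z: "0 \<in> integer_vectors d" by (simp add: integer_vectors_def)
    have hc: "elem h 0 \<in> carrier G" using h(1) by simp
    have "conj_mod (int m) x y (elem h 0)"
      unfolding conj_mod_iff[OF x y hc] fst_elem vec_part_elem[OF z] True fy
      using h Nil_mult[OF h(1)] mult_Nil[OF h(1)] by (simp only: T_Nil vec_part_closed) (simp add: act.T_zero)
    then show ?thesis using h hc by (intro bexI[of _ "elem h 0"]) auto
  qed
  then obtain g where g: "g \<in> carrier G" "conj_mod (int m) x y g"
    "length (fst g) \<le> length (fst x) + length (fst y) + m ^ d" by blast
  define z where "z = (\<lambda>i. vec_part g i mod int m)"
  have zc: "z \<in> integer_vectors d" using vec_part_closed[of g] by (simp add: z_def integer_vectors_def)
  have "vcong (int m) (vec_part g) (vec_part (elem (fst g) z))"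
    unfolding vec_part_elem[OF zc] by (simp add: z_def vcong_def minus_mod_eq_mult_div)
  then have "conj_mod (int m) x y (elem (fst g) z)"
    by (intro conj_mod_cong[OF x y g(1) _ _ _ g(2)]) (use g(1) in auto)
  then show ?thesis unfolding bounded_conj_mod_def using g zc m
    by (intro bexI[of _ "fst g"] bexI[of _ z]) (auto simp: z_def)
qed

text \<open>If \<open>fst x\<close> is trivial, this is the separability of orbits. Otherwise only finitely
  many first components need to be considered, independently of \<open>m\<close>. Each of them
  leaves the question whether a vector belongs to the image of \<open>z \<mapsto> z - T (fst y)
  z\<close>, and a modulus separates it if it does not; the product of these moduli contradicts
  the assumption.\<close>

lemma all_conj_mod_imp_conjugate:
  assumes growth: "\<And>\<epsilon>. \<epsilon> > 0 \<Longrightarrow> \<exists>K>0. \<forall>h\<in>carrier Fn. real_of_int (opnorm h) \<le> K * exp (\<epsilon> * real (length h))"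
    and x: "x \<in> carrier G" and y: "y \<in> carrier G"
    and all: "\<And>m. m > 0 \<Longrightarrow> \<exists>g\<in>carrier G. conj_mod m x y g"
  shows "conjugate_in G x y"
proof (cases "fst x = []")
  case True
  have fy: "fst y = []"
  proof -
    obtain g where g: "g \<in> carrier G" "conj_mod 1 x y g" using all[of 1] by auto
    then have "fst g \<otimes>\<^bsub>Fn\<^esub> fst y = fst g \<otimes>\<^bsub>Fn\<^esub> []"
      using x y by (simp add: conj_mod_iff True Nil_mult free_group_one)
    then show ?thesis using g(1) y Fn.Units_l_cancel[of "fst g" "fst y" "[]"] by (simp add: Fn.Units_eq free_group_one)
  qed
  have "\<exists>h\<in>carrier Fn. T h (vec_part x) = vec_part y"
  proof (rule orbits_separable[OF growth vec_part_closed vec_part_closed])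
    fix m :: int assume "m > 0"
    then obtain g where g: "g \<in> carrier G" "conj_mod m x y g" using all by blast
    then have "vcong m (T (fst g) (vec_part x) + vec_part g) (vec_part g + vec_part y)"
      using x y by (simp add: conj_mod_iff fy T_Nil)
    then have "vcong m (T (fst g) (vec_part x)) (vec_part y)" by (simp add: vcong_def)
    then show "\<exists>h\<in>carrier Fn. vcong m (T h (vec_part x)) (vec_part y)"
      using g(1) by (intro bexI[of _ "fst g"]) auto
  qed
  then obtain h where h: "h \<in> carrier Fn" "T h (vec_part x) = vec_part y" by blast
  have z: "0 \<in> integer_vectors d" by (simp add: integer_vectors_def)
  have hc: "elem h 0 \<in> carrier G" using h(1) by simp
  have "conj_mod 0 x y (elem h 0)"
    unfolding conj_mod_iff[OF x y hc] fst_elem vec_part_elem[OF z] True fy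
    using h(2) Nil_mult[OF h(1)] mult_Nil[OF h(1)] by (simp only: T_Nil vec_part_closed) (simp add: act.T_zero)
  then show ?thesis using hc x y by (auto simp: conjugate_in_G_iff)
next
  case False
  define Hs where "Hs = {h \<in> carrier Fn. length h \<le> length (fst x) + length (fst y)}"
  have fin: "finite Hs" unfolding Hs_def by (rule finite_short_words)
  define W where "W = {z - T (fst y) z | z. z \<in> integer_vectors d}"
  have W: "additive_subgroup W" unfolding additive_subgroup_def
  proof (intro conjI ballI)
    have "0 = (0 :: nat \<Rightarrow> int) - T (fst y) 0" by simp
    then show "0 \<in> W" unfolding W_def using additive_subgroup_zero[OF additive_subgroup_integer_vectors] by blast
    fix u v assume "u \<in> W" "v \<in> W"
    then obtain z z' where z: "u = z - T (fst y) z" "v = z' - T (fst y) z'"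
        "z \<in> integer_vectors d" "z' \<in> integer_vectors d" by (auto simp: W_def)
    then have "u - v = (z - z') - T (fst y) (z - z')" by (simp add: act.T_diff)
    moreover have "z - z' \<in> integer_vectors d"
      using z by (intro additive_subgroup_diff additive_subgroup_integer_vectors)
    ultimately show "u - v \<in> W" unfolding W_def by blast
  qed
  have Wd: "W \<subseteq> integer_vectors d"
    unfolding W_def by (auto intro!: additive_subgroup_diff additive_subgroup_integer_vectors act.T_lattice)
  have "\<forall>h. \<exists>M. M > 0 \<and> (vec_part y - T h (vec_part x) \<in> W \<or>
      (\<forall>w\<in>W. \<not> vcong M (vec_part y - T h (vec_part x)) w))"
  proof
    fix h
    show "\<exists>M. M > 0 \<and> (vec_part y - T h (vec_part x) \<in> W \<or>
      (\<forall>w\<in>W. \<not> vcong M (vec_part y - T h (vec_part x)) w))"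
  proof (cases "vec_part y - T h (vec_part x) \<in> W")
    case True
    then show ?thesis by (intro exI[of _ 1]) simp
  next
    case False
    have "vec_part y - T h (vec_part x) \<in> integer_vectors d"
      by (intro additive_subgroup_diff additive_subgroup_integer_vectors act.T_lattice vec_part_closed)
    then show ?thesis
    proof (rule separate_from_subgroup[OF W Wd _ False])
      fix M :: int assume "M > 0" "\<And>h'. h' \<in> W \<Longrightarrow> \<not> vcong M (vec_part y - T h (vec_part x)) h'"
      then show ?thesis by (intro exI[of _ M]) simp
    qed
  qed
  qed
  from choice[OF this] obtain M where M': "\<forall>h. M h > 0 \<and> (vec_part y - T h (vec_part x) \<in> W \<or>
      (\<forall>w\<in>W. \<not> vcong (M h) (vec_part y - T h (vec_part x)) w))" by blast
  then have M: "\<And>h. M h > 0" "\<And>h. vec_part y - T h (vec_part x) \<in> W \<or>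
      (\<forall>w\<in>W. \<not> vcong (M h) (vec_part y - T h (vec_part x)) w)" by blast+
  define m where "m = (\<Prod>h\<in>Hs. M h)"
  have "m > 0" unfolding m_def using M(1) by (intro prod_pos) auto
  then obtain g where g: "g \<in> carrier G" "conj_mod m x y g" "length (fst g) < length (fst x) + length (fst y)"
    using short_conj_mod[OF x y False all] by blast
  have gH: "fst g \<in> Hs" using g by (simp add: Hs_def)
  have Mm: "M (fst g) dvd m" unfolding m_def using fin gH by (rule dvd_prodI)
  have v: "vcong m (T (fst g) (vec_part x) + vec_part g) (T (fst y) (vec_part g) + vec_part y)"
    and f: "fst x \<otimes>\<^bsub>Fn\<^esub> fst g = fst g \<otimes>\<^bsub>Fn\<^esub> fst y"
    using g x y by (simp_all add: conj_mod_iff)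
  have "vcong (M (fst g)) (T (fst g) (vec_part x) + vec_part g) (T (fst y) (vec_part g) + vec_part y)"
    using Mm v by (rule vcong_dvd)
  then have "vcong (M (fst g)) (vec_part g - T (fst y) (vec_part g)) (vec_part y - T (fst g) (vec_part x))"
    unfolding vcong_def by (simp add: algebra_simps)
  then have "vcong (M (fst g)) (vec_part y - T (fst g) (vec_part x)) (vec_part g - T (fst y) (vec_part g))"
    by (rule vcong_sym)
  moreover have "vec_part g - T (fst y) (vec_part g) \<in> W" unfolding W_def using vec_part_closed by blast
  ultimately have "vec_part y - T (fst g) (vec_part x) \<in> W" using M(2) by blast
  then obtain z where z: "z \<in> integer_vectors d" "vec_part y - T (fst g) (vec_part x) = z - T (fst y) z"
    unfolding W_def by blast
  have hc: "elem (fst g) z \<in> carrier G" using g(1) by simp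
  have "T (fst g) (vec_part x) + z = T (fst y) z + vec_part y"
  proof -
    have "T (fst g) (vec_part x) + z = T (fst y) z + (z - T (fst y) z) + T (fst g) (vec_part x)"
      by (simp add: algebra_simps)
    then show ?thesis unfolding z(2)[symmetric] by (simp add: algebra_simps)
  qed
  then have "conj_mod 0 x y (elem (fst g) z)"
    unfolding conj_mod_iff[OF x y hc] fst_elem vec_part_elem[OF z(1)] using f by (simp add: vcong_0)
  then show ?thesis using hc x y by (auto simp: conjugate_in_G_iff)
qed

end

section \<open>Computing in the group\<close>

lemma computable_table:
  assumes "\<And>F. F \<in> set Fs \<Longrightarrow> computable 1 (\<lambda>xs. F (xs ! 0))"
  shows "computable 2 (\<lambda>xs. if xs ! 1 < length Fs then (Fs ! (xs ! 1)) (xs ! 0) else xs ! 0)"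
  using assms
proof (induction Fs rule: rev_induct)
  case Nil
  show ?case by (simp add: computable_nth)
next
  case (snoc F Fs)
  have "computable 2 (\<lambda>xs. if xs ! 1 = length Fs then F (xs ! 0)
      else if xs ! 1 < length Fs then (Fs ! (xs ! 1)) (xs ! 0) else xs ! 0)"
  proof (rule computable_if)
    show "decidable 2 (\<lambda>xs. xs ! 1 = length Fs)"
      by (intro decidable_eq computable_nth computable_const) simp
    have "computable 1 (\<lambda>xs. F (xs ! 0))" by (rule snoc.prems) simp
    then show "computable 2 (\<lambda>xs. F (xs ! 0))" by (rule computable_apply) (simp add: computable_nth)
    show "computable 2 (\<lambda>xs. if xs ! 1 < length Fs then (Fs ! (xs ! 1)) (xs ! 0) else xs ! 0)"
      by (rule snoc.IH, rule snoc.prems) simp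
  qed
  then show ?case by (rule computable_cong) (auto simp: nth_append)
qed

definition letter_code :: "nat \<times> bool \<Rightarrow> nat" where
  "letter_code l = prod_encode (fst l, of_bool (snd l))"

definition letters_code :: "nat gword \<Rightarrow> nat" where
  "letters_code w = list_encode (map letter_code w)"

lemma letter_code_eq [simp]: "letter_code k = letter_code l \<longleftrightarrow> k = l"
  by (auto simp: letter_code_def prod_eq_iff of_bool_def split: if_splits)

lemma letters_code_eq [simp]: "letters_code v = letters_code w \<longleftrightarrow> v = w"
proof -
  have "inj letter_code" by (rule injI) simp
  then show ?thesis by (simp add: letters_code_def list_encode_eq inj_map_eq_map)
qed

text \<open>\<open>cancel_cons\<close> on codes.\<close>

definition push_code :: "nat \<times> bool \<Rightarrow> nat \<Rightarrow> nat" where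
  "push_code a c = (if c \<noteq> 0 \<and> code_head c = letter_code (inv_letter a) then code_tail c
    else Suc (prod_encode (letter_code a, c)))"

lemma push_code: "push_code a (letters_code w) = letters_code (cancel_cons a w)"
proof (cases w)
  case Nil
  then show ?thesis by (simp add: push_code_def letters_code_def)
next
  case (Cons b w')
  have nz: "letters_code w \<noteq> 0" by (simp add: letters_code_def Cons)
  have h: "code_head (letters_code w) = letter_code b"
    unfolding letters_code_def Cons list.map by (rule code_head_list_encode)
  have t: "code_tail (letters_code w) = letters_code w'"
    unfolding letters_code_def Cons list.map code_tail_list_encode by simp
  show ?thesis using nz unfolding push_code_def h t unfolding Cons by (auto simp: letters_code_def)
qed

lemma foldr_push_code: "foldr push_code u (letters_code w) = letters_code (foldr cancel_cons u w)"
  by (induction u) (simp_all add: push_code)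

lemma computable_push_code: "computable k f \<Longrightarrow> computable k (\<lambda>xs. push_code a (f xs))"
  unfolding push_code_def
  by (intro computable_if decidable_conj decidable_not decidable_eq computable_code_head
      computable_code_tail computable_Suc computable_prod_encode computable_const)

lemma computable_foldr_push_code: "computable k f \<Longrightarrow> computable k (\<lambda>xs. foldr push_code u (f xs))"
  by (induction u) (auto intro: computable_push_code)

context free_lattice_action
begin

definition vector_code :: "(nat \<Rightarrow> int) \<Rightarrow> nat" where
  "vector_code v = list_encode (map (\<lambda>i. int_encode (v i)) [0..<d])"

definition coordinate :: "nat \<Rightarrow> nat \<Rightarrow> int" where
  "coordinate i c = int_decode (code_head ((code_tail ^^ i) c))"

lemma coordinate_vector_code: "i < d \<Longrightarrow> coordinate i (vector_code v) = v i"
  by (simp add: coordinate_def vector_code_def code_nth_list_encode)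

lemma int_computable_coordinate: "computable k f \<Longrightarrow> int_computable k (\<lambda>xs. coordinate i (f xs))"
  unfolding coordinate_def by (intro int_computable_int_decode computable_code_nth)

text \<open>The first component is stored as its inverse, since right multiplication then acts at the front
  of the list.\<close>

definition elem_code :: "nat gword \<times> int vec \<Rightarrow> nat" where
  "elem_code g = prod_encode (letters_code (inv\<^bsub>Fn\<^esub> fst g), vector_code (vec_part g))"

text \<open>Right multiplication by the fixed element \<open>k\<close> on codes; its word and its matrix are
  constants of the program.\<close>

definition mult_code :: "nat gword \<times> int vec \<Rightarrow> nat \<Rightarrow> nat" where
  "mult_code k c = prod_encode (foldr push_code (inv_word (fst k)) (fst (prod_decode c)),
     list_encode (map (\<lambda>F. F c) (map (\<lambda>j c. int_encode ((\<Sum>i<d. coordinate i (snd (prod_decode c)) * \<tau> (fst k) $$ (i, j))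
       + vec_part k j)) [0..<d])))"

lemma computable_mult_code: "computable 1 (\<lambda>xs. mult_code k (xs ! 0))"
proof -
  have "computable 1 (\<lambda>xs. int_encode ((\<Sum>i<d. coordinate i (snd (prod_decode (xs ! 0))) * \<tau> (fst k) $$ (i, j))
       + vec_part k j))" for j
    by (intro computable_int_encode int_computable_add int_computable_sum int_computable_mult
        int_computable_const int_computable_coordinate computable_snd computable_nth) auto
  then have "computable 1 (\<lambda>xs. list_encode (map (\<lambda>F. F xs) (map (\<lambda>j xs. int_encode
      ((\<Sum>i<d. coordinate i (snd (prod_decode (xs ! 0))) * \<tau> (fst k) $$ (i, j)) + vec_part k j)) [0..<d])))"
    by (intro computable_list_encode) auto
  then show ?thesis unfolding mult_code_def
    by (intro computable_prod_encode computable_foldr_push_code computable_fst computable_nth)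
      (auto simp: comp_def)
qed

lemma mult_code:
  assumes g: "g \<in> carrier G" and k: "k \<in> carrier G"
  shows "mult_code k (elem_code g) = elem_code (g \<otimes>\<^bsub>G\<^esub> k)"
proof -
  have "inv\<^bsub>Fn\<^esub> fst (g \<otimes>\<^bsub>G\<^esub> k) = inv\<^bsub>Fn\<^esub> fst k \<otimes>\<^bsub>Fn\<^esub> inv\<^bsub>Fn\<^esub> fst g"
    using g k by (simp add: Fn.inv_mult_group)
  also have "\<dots> = reduce (inv_word (fst k) @ inv\<^bsub>Fn\<^esub> fst g)"
    using k by (simp add: free_group_mult free_group_inv)
  also have "\<dots> = foldr cancel_cons (inv_word (fst k)) (inv\<^bsub>Fn\<^esub> fst g)"
    using Fn.inv_closed[OF fst_closed[OF g]] by (simp add: reduce_append reduce_reduced free_group_carrier)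
  finally have w: "letters_code (inv\<^bsub>Fn\<^esub> fst (g \<otimes>\<^bsub>G\<^esub> k)) =
      foldr push_code (inv_word (fst k)) (letters_code (inv\<^bsub>Fn\<^esub> fst g))"
    by (simp only: foldr_push_code)
  have v: "vec_part (g \<otimes>\<^bsub>G\<^esub> k) j = (\<Sum>i<d. coordinate i (vector_code (vec_part g)) * \<tau> (fst k) $$ (i, j)) + vec_part k j"
    if "j < d" for j
    using g k that by (simp add: vec_part_mult T_def coordinate_vector_code)
  have m: "map (\<lambda>j. int_encode (vec_part (g \<otimes>\<^bsub>G\<^esub> k) j)) [0..<d] = map (\<lambda>j. int_encode
      ((\<Sum>i<d. coordinate i (vector_code (vec_part g)) * \<tau> (fst k) $$ (i, j)) + vec_part k j)) [0..<d]"
    using v by (intro map_cong) auto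
  show ?thesis unfolding mult_code_def elem_code_def w vector_code_def[of "vec_part (g \<otimes>\<^bsub>G\<^esub> k)"] m
    by (simp add: comp_def)
qed

text \<open>Every natural number is a letter, and those beyond the length of the table act trivially. So
  every number codes a word.\<close>

definition table_mult :: "(nat gword \<times> int vec) list \<Rightarrow> nat gword \<times> int vec \<Rightarrow> nat \<Rightarrow> nat gword \<times> int vec" where
  "table_mult E g x = (if x < length E then g \<otimes>\<^bsub>G\<^esub> E ! x else g)"

definition run :: "(nat gword \<times> int vec) list \<Rightarrow> nat \<Rightarrow> nat \<Rightarrow> nat" where
  "run E s c = foldl (\<lambda>s x. if x < length (map mult_code E) then (map mult_code E ! x) s else s) s (list_decode c)"

lemma computable_run:
  assumes "computable k f" "computable k c"
  shows "computable k (\<lambda>xs. run E (f xs) (c xs))"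
proof (rule computable_apply2[of "run E", OF _ assms])
  show "computable 2 (\<lambda>xs. run E (xs ! 0) (xs ! 1))"
    unfolding run_def
  proof (intro computable_foldl computable_table)
    fix F assume "F \<in> set (map mult_code E)"
    then obtain k where "F = mult_code k" by auto
    then show "computable 1 (\<lambda>xs. F (xs ! 0))" by (simp only: computable_mult_code)
  qed
qed

lemma nth_closed: "set E \<subseteq> carrier G \<Longrightarrow> x < length E \<Longrightarrow> E ! x \<in> carrier G"
  using nth_mem by blast

lemma table_mult_closed:
  "set E \<subseteq> carrier G \<Longrightarrow> g \<in> carrier G \<Longrightarrow> foldl (table_mult E) g xs \<in> carrier G"
  by (induction xs arbitrary: g) (simp_all add: table_mult_def nth_closed)

lemma table_mult_left:
  assumes "set E \<subseteq> carrier G" "g \<in> carrier G"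
  shows "foldl (table_mult E) g xs = g \<otimes>\<^bsub>G\<^esub> foldl (table_mult E) \<one>\<^bsub>G\<^esub> xs"
proof (induction xs rule: rev_induct)
  case (snoc x xs)
  have "foldl (table_mult E) \<one>\<^bsub>G\<^esub> xs \<in> carrier G" using assms by (intro table_mult_closed) auto
  then show ?case using assms snoc by (simp add: table_mult_def[of E _ x] nth_closed G.m_assoc)
qed (use assms in simp)

lemma run_elem_code:
  assumes "set E \<subseteq> carrier G" "g \<in> carrier G"
  shows "run E (elem_code g) c = elem_code (g \<otimes>\<^bsub>G\<^esub> foldl (table_mult E) \<one>\<^bsub>G\<^esub> (list_decode c))"
proof -
  have "foldl (\<lambda>s x. if x < length (map mult_code E) then (map mult_code E ! x) s else s) (elem_code g) xs =
      elem_code (foldl (table_mult E) g xs)" for xs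
    using assms(2)
  proof (induction xs arbitrary: g)
    case (Cons x xs)
    have "(if x < length (map mult_code E) then (map mult_code E ! x) (elem_code g) else elem_code g) =
        elem_code (table_mult E g x)"
      using assms(1) Cons.prems by (simp add: table_mult_def mult_code nth_closed)
    moreover have "table_mult E g x \<in> carrier G"
      using assms(1) Cons.prems by (simp add: table_mult_def nth_closed)
    ultimately show ?case using Cons.IH by simp
  qed simp
  then show ?thesis using table_mult_left[OF assms] by (simp add: run_def)
qed

definition codes_cong :: "nat \<Rightarrow> nat \<Rightarrow> nat \<Rightarrow> bool" where
  "codes_cong m s t \<longleftrightarrow> fst (prod_decode s) = fst (prod_decode t) \<and>
    (\<forall>j\<in>set [0..<d]. int m dvd coordinate j (snd (prod_decode s)) - coordinate j (snd (prod_decode t)))"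

lemma decidable_list_ball:
  "(\<And>j. j \<in> set js \<Longrightarrow> decidable k (P j)) \<Longrightarrow> decidable k (\<lambda>xs. \<forall>j\<in>set js. P j xs)"
proof (induction js)
  case Nil
  show ?case using computable_const[of k 1] by simp
next
  case (Cons j js)
  have "decidable k (\<lambda>xs. P j xs \<and> (\<forall>j\<in>set js. P j xs))"
    using Cons by (intro decidable_conj) auto
  then show ?case by simp
qed

lemma decidable_codes_cong:
  "computable k m \<Longrightarrow> computable k s \<Longrightarrow> computable k t \<Longrightarrow> decidable k (\<lambda>xs. codes_cong (m xs) (s xs) (t xs))"
  unfolding codes_cong_def
  by (intro decidable_conj decidable_eq decidable_list_ball decidable_int_dvd int_computable_diff
      int_computable_coordinate computable_fst computable_snd)

lemma codes_cong_elem_code: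
  assumes "g \<in> carrier G" "h \<in> carrier G"
  shows "codes_cong m (elem_code g) (elem_code h) \<longleftrightarrow> fst g = fst h \<and> vcong (int m) (vec_part g) (vec_part h)"
proof -
  have "inv\<^bsub>Fn\<^esub> fst g = inv\<^bsub>Fn\<^esub> fst h \<longleftrightarrow> fst g = fst h"
    using assms by (metis Fn.inv_inv fst_closed)
  moreover have "vcong (int m) (vec_part g) (vec_part h) \<longleftrightarrow>
      (\<forall>j\<in>set [0..<d]. int m dvd vec_part g j - vec_part h j)"
    using vec_part_closed[of g] vec_part_closed[of h]
    by (auto simp: vcong_def integer_vectors_def)
  ultimately show ?thesis
    by (simp add: codes_cong_def elem_code_def coordinate_vector_code)
qed

lemma elem_code_eq:
  assumes "g \<in> carrier G" "h \<in> carrier G"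
  shows "elem_code g = elem_code h \<longleftrightarrow> g = h"
proof
  assume eq: "elem_code g = elem_code h"
  have "codes_cong 0 (elem_code g) (elem_code g)" using assms by (simp add: codes_cong_elem_code)
  then have "codes_cong 0 (elem_code g) (elem_code h)" unfolding eq .
  then show "g = h" using assms by (auto simp: codes_cong_elem_code vcong_0 intro: G_eqI)
qed simp

lemma length_le_elem_code:
  assumes "g \<in> carrier G"
  shows "length (fst g) \<le> fst (prod_decode (elem_code g))"
  using length_le_list_encode[of "map letter_code (inv\<^bsub>Fn\<^esub> fst g)"] assms
  by (simp add: elem_code_def letters_code_def length_free_group_inv)

text \<open>These generate the group as a monoid, with control over the length of the words.\<close>

definition standard_elems :: "(nat gword \<times> int vec) list" where
  "standard_elems = map (\<lambda>i. elem [(i, True)] 0) [0..<n] @ map (\<lambda>i. elem [(i, False)] 0) [0..<n] @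
     map (\<lambda>j. elem [] (unit_vector j)) [0..<d] @ map (\<lambda>j. elem [] (- unit_vector j)) [0..<d]"

lemma standard_elems_closed: "set standard_elems \<subseteq> carrier G"
  by (auto simp: standard_elems_def free_group_carrier reduced_def)

definition reachable :: "nat \<Rightarrow> nat gword \<times> int vec \<Rightarrow> bool" where
  "reachable k g \<longleftrightarrow> (\<exists>xs. set xs \<subseteq> {..length standard_elems} \<and> length xs = k \<and>
     foldl (table_mult standard_elems) \<one>\<^bsub>G\<^esub> xs = g)"

lemma reachable_mult:
  assumes "reachable k g" "e \<in> set standard_elems"
  shows "reachable (Suc k) (g \<otimes>\<^bsub>G\<^esub> e)"
proof -
  obtain xs where xs: "set xs \<subseteq> {..length standard_elems}" "length xs = k"
    "foldl (table_mult standard_elems) \<one>\<^bsub>G\<^esub> xs = g"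
    using assms(1) by (auto simp: reachable_def)
  obtain x where x: "x < length standard_elems" "standard_elems ! x = e"
    using assms(2) by (auto simp: in_set_conv_nth)
  have "foldl (table_mult standard_elems) \<one>\<^bsub>G\<^esub> (xs @ [x]) = g \<otimes>\<^bsub>G\<^esub> e"
    using xs x by (simp add: table_mult_def)
  then show ?thesis unfolding reachable_def using xs x by (intro exI[of _ "xs @ [x]"]) auto
qed

lemma zero_integer_vectors [simp]: "0 \<in> integer_vectors d"
  by (rule additive_subgroup_zero[OF additive_subgroup_integer_vectors])

lemma elem_mult_vector:
  assumes "h \<in> carrier Fn" "v \<in> integer_vectors d" "u \<in> integer_vectors d"
  shows "elem h v \<otimes>\<^bsub>G\<^esub> elem [] u = elem h (v + u)"
proof (rule G_eqI)
  have vu: "v + u \<in> integer_vectors d"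
    using assms by (intro additive_subgroup_add additive_subgroup_integer_vectors)
  have "vec_part (elem h v \<otimes>\<^bsub>G\<^esub> elem [] u) = T [] v + u"
    using assms by (simp add: vec_part_mult)
  then show "vec_part (elem h v \<otimes>\<^bsub>G\<^esub> elem [] u) = vec_part (elem h (v + u))"
    unfolding vec_part_elem[OF vu] using T_Nil[OF assms(2)] by simp
  show "fst (elem h v \<otimes>\<^bsub>G\<^esub> elem [] u) = fst (elem h (v + u))"
    using assms mult_Nil by simp
qed (use assms in auto)

lemma reachable_word:
  assumes "h \<in> carrier Fn"
  shows "reachable (length h) (elem h 0)"
proof -
  have "reachable (length w) (elem (reduce w) 0)" if "w \<in> words_over {..<n}" for w
    using that
  proof (induction w rule: rev_induct)
    case Nil
    have "elem [] 0 = \<one>\<^bsub>G\<^esub>" by (rule G_eqI) auto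
    moreover have "reduce [] = ([] :: nat gword)" by (simp add: reduce_def)
    ultimately show ?case unfolding reachable_def by (intro exI[of _ "[]"]) simp
  next
    case (snoc l w)
    have w: "w \<in> words_over {..<n}" and l: "fst l < n" using snoc.prems by auto
    have lF: "[l] \<in> carrier Fn" using l by (simp add: free_group_carrier reduced_def)
    have "elem [l] 0 \<in> set standard_elems"
      using l by (cases l; cases "snd l") (auto simp: standard_elems_def)
    from reachable_mult[OF snoc.IH[OF w] this]
    have "reachable (Suc (length w)) (elem (reduce w) 0 \<otimes>\<^bsub>G\<^esub> elem [l] 0)" .
    moreover have "elem (reduce w) 0 \<otimes>\<^bsub>G\<^esub> elem [l] 0 = elem (reduce (w @ [l])) 0"
    proof (rule G_eqI)
      show "fst (elem (reduce w) 0 \<otimes>\<^bsub>G\<^esub> elem [l] 0) = fst (elem (reduce (w @ [l])) 0)"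
        by (simp add: free_group_mult)
      show "vec_part (elem (reduce w) 0 \<otimes>\<^bsub>G\<^esub> elem [l] 0) = vec_part (elem (reduce (w @ [l])) 0)"
        using lF reduce_in_free_group[OF w] by (simp add: vec_part_mult)
    qed (use lF reduce_in_free_group[OF w] reduce_in_free_group[OF snoc.prems] in auto)
    ultimately show ?case by (simp del: zero_fun_apply)
  qed
  from this[of h] show ?thesis using assms by (simp add: free_group_carrier reduce_reduced)
qed

text \<open>The word of \<open>h\<close> is followed by unit vectors, one coordinate after the other.\<close>

lemma reachable_elem:
  assumes h: "h \<in> carrier Fn" and z: "z \<in> integer_vectors d"
  shows "reachable (length h + (\<Sum>i<d. nat \<bar>z i\<bar>)) (elem h z)"
proof -
  define zj where "zj j = (\<lambda>i. if i < j then z i else 0)" for j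
  have zjc: "zj j \<in> integer_vectors d" for j using z by (auto simp: zj_def integer_vectors_def)
  have "reachable (length h + (\<Sum>i<j. nat \<bar>z i\<bar>)) (elem h (zj j))" if "j \<le> d" for j
    using that
  proof (induction j)
    case 0
    have "zj 0 = 0" by (auto simp: zj_def)
    then show ?case using reachable_word[OF h] by (simp del: zero_fun_apply)
  next
    case (Suc j)
    have j: "j < d" using Suc.prems by simp
    define u where "u = (if 0 \<le> z j then unit_vector j else - unit_vector j)"
    have "unit_vector j \<in> integer_vectors d" "- unit_vector j \<in> integer_vectors d"
      using j by (auto intro: additive_subgroup_minus[OF additive_subgroup_integer_vectors])
    then have u: "u \<in> integer_vectors d" by (simp add: u_def)
    have ue: "elem [] u \<in> set standard_elems" using j by (auto simp: u_def standard_elems_def)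
    have uk: "(\<lambda>i. int k * u i) \<in> integer_vectors d" for k using u by (auto simp: integer_vectors_def)
    have "reachable (length h + (\<Sum>i<j. nat \<bar>z i\<bar>) + k) (elem h (zj j + (\<lambda>i. int k * u i)))" for k
    proof (induction k)
      case 0
      have "zj j + (\<lambda>i. int 0 * u i) = zj j" by auto
      then show ?case using Suc.IH j by simp
    next
      case (Suc k)
      have c: "zj j + (\<lambda>i. int k * u i) \<in> integer_vectors d"
        using zjc uk by (intro additive_subgroup_add additive_subgroup_integer_vectors)
      have "zj j + (\<lambda>i. int (Suc k) * u i) = zj j + (\<lambda>i. int k * u i) + u"
        by (rule ext) (simp add: algebra_simps)
      then show ?case
        using reachable_mult[OF Suc ue] unfolding elem_mult_vector[OF h c u] by (simp only: add_Suc_right)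
    qed
    from this[of "nat \<bar>z j\<bar>"]
    have "reachable (length h + (\<Sum>i<j. nat \<bar>z i\<bar>) + nat \<bar>z j\<bar>) (elem h (zj j + (\<lambda>i. int (nat \<bar>z j\<bar>) * u i)))" .
    moreover have "zj j + (\<lambda>i. int (nat \<bar>z j\<bar>) * u i) = zj (Suc j)"
    proof
      fix i
      show "(zj j + (\<lambda>i. int (nat \<bar>z j\<bar>) * u i)) i = zj (Suc j) i"
        by (cases "i = j") (auto simp: zj_def u_def unit_vector_def)
    qed
    ultimately show ?case by (simp add: add.assoc)
  qed
  from this[of d] have "reachable (length h + (\<Sum>i<d. nat \<bar>z i\<bar>)) (elem h (zj d))" by simp
  moreover have "zj d = z" using z by (auto simp: zj_def integer_vectors_def)
  ultimately show ?thesis by simp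
qed

lemma elem_eta: "g \<in> carrier G \<Longrightarrow> elem (fst g) (vec_part g) = g"
  by (intro G_eqI) auto

lemma generating_list_standard_elems: "generating_list G standard_elems"
proof -
  have "foldl (table_mult standard_elems) \<one>\<^bsub>G\<^esub> xs \<in> generate G (set standard_elems)" for xs
  proof (induction xs rule: rev_induct)
    case (snoc x xs)
    then show ?case unfolding foldl_append foldl.simps table_mult_def[of _ _ x]
      using generate.eng[OF snoc generate.incl[OF nth_mem, of x]] by (cases "x < length standard_elems") auto
  qed (simp add: generate.one)
  moreover have "\<exists>xs. foldl (table_mult standard_elems) \<one>\<^bsub>G\<^esub> xs = g" if "g \<in> carrier G" for g
    using reachable_elem[OF fst_closed[OF that] vec_part_closed[of g]] elem_eta[OF that]
    by (auto simp: reachable_def)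
  ultimately have "carrier G \<subseteq> generate G (set standard_elems)" by blast
  then show ?thesis unfolding generating_list_def
    using standard_elems_closed G.generate_in_carrier[OF standard_elems_closed] by blast
qed

text \<open>A table whose indices are the codes of letters that \<open>word_code\<close> uses; they leave
  gaps, which are filled with the neutral element.\<close>

definition word_table :: "(nat gword \<times> int vec) list \<Rightarrow> (nat gword \<times> int vec) list" where
  "word_table gs = map (\<lambda>c. case prod_decode c of (i, e) \<Rightarrow> if i < length gs then
     (if e = 1 then gs ! i else inv\<^bsub>G\<^esub> (gs ! i)) else \<one>\<^bsub>G\<^esub>) [0..<Suc (prod_encode (length gs, 1))]"

lemma word_table_closed: "set gs \<subseteq> carrier G \<Longrightarrow> set (word_table gs) \<subseteq> carrier G"
  by (force simp: word_table_def nth_closed split: prod.splits)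

lemma word_table_value:
  assumes gs: "set gs \<subseteq> carrier G" and w: "w \<in> words_over {..<length gs}"
  shows "foldl (table_mult (word_table gs)) \<one>\<^bsub>G\<^esub> (list_decode (word_code w)) = word_value G gs w"
proof -
  have "foldl (table_mult (word_table gs)) \<one>\<^bsub>G\<^esub> (map (\<lambda>(i, e). prod_encode (i, of_bool e)) w) = word_value G gs w
      \<and> word_value G gs w \<in> carrier G"
    using w
  proof (induction w)
    case Nil
    then show ?case by (simp add: word_value_def)
  next
    case (Cons l w)
    obtain i e where l: "l = (i, e)" "i < length gs" using Cons.prems by (cases l) auto
    define s where "s = (if e then gs ! i else inv\<^bsub>G\<^esub> (gs ! i))"
    have s: "s \<in> carrier G" using gs l(2) by (simp add: s_def nth_closed)
    have "prod_encode (i, of_bool e) \<le> prod_encode (length gs, 1)"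
      using l(2) by (intro prod_encode_mono) auto
    then have lt: "prod_encode (i, of_bool e) < Suc (prod_encode (length gs, 1))" by simp
    have "word_table gs ! prod_encode (i, of_bool e) = s"
      unfolding word_table_def nth_map_upt using lt l(2) by (simp add: s_def del: upt_Suc)
    then have "table_mult (word_table gs) \<one>\<^bsub>G\<^esub> (prod_encode (i, of_bool e)) = s"
      using lt s by (simp add: table_mult_def word_table_def del: upt_Suc)
    moreover have "word_value G gs (l # w) = s \<otimes>\<^bsub>G\<^esub> word_value G gs w"
      by (simp add: word_value_def l s_def)
    ultimately show ?case
      using Cons s table_mult_left[OF word_table_closed[OF gs] s] by (simp add: l)
  qed
  then show ?thesis by (simp add: word_code_def)
qed

text \<open>Both conjugacy and its failure have certificates: a conjugator, and a modulus for which bounded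
  search finds no conjugator. Hence the search for either of them ends.\<close>

lemma decidable_conjugacy:
  assumes growth: "\<And>\<epsilon>. \<epsilon> > 0 \<Longrightarrow> \<exists>K>0. \<forall>h\<in>carrier Fn. real_of_int (opnorm h) \<le> K * exp (\<epsilon> * real (length h))"
    and gs: "set gs \<subseteq> carrier G"
  shows "decidable_conjugacy_problem_wrt G gs"
proof -
  define E where "E = word_table gs"
  define S where "S = standard_elems"
  have E: "set E \<subseteq> carrier G" unfolding E_def using gs by (rule word_table_closed)
  have S: "set S \<subseteq> carrier G" unfolding S_def by (rule standard_elems_closed)
  define c1 where "c1 = elem_code \<one>\<^bsub>G\<^esub>"
  define xv where "xv u = foldl (table_mult E) \<one>\<^bsub>G\<^esub> (list_decode u)" for u
  define gv where "gv c = foldl (table_mult S) \<one>\<^bsub>G\<^esub> (list_decode c)" for c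
  have xv: "xv u \<in> carrier G" for u unfolding xv_def using E by (intro table_mult_closed) auto
  have gv: "gv c \<in> carrier G" for c unfolding gv_def using S by (intro table_mult_closed) auto
  have runE: "run E (elem_code g) u = elem_code (g \<otimes>\<^bsub>G\<^esub> xv u)" if "g \<in> carrier G" for g u
    unfolding xv_def using E that by (rule run_elem_code)
  have runS: "run S (elem_code g) c = elem_code (g \<otimes>\<^bsub>G\<^esub> gv c)" if "g \<in> carrier G" for g c
    unfolding gv_def using S that by (rule run_elem_code)
  have r1: "run E c1 u = elem_code (xv u)" "run S c1 c = elem_code (gv c)" for u c
    unfolding c1_def using runE[of "\<one>\<^bsub>G\<^esub>" u] runS[of "\<one>\<^bsub>G\<^esub>" c] xv gv by simp_all
  define D1 where "D1 N u v \<longleftrightarrow> run S (run E c1 u) N = run E (run S c1 N) v" for N u v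
  define bnd where "bnd N u v = Suc (code_bound (length S) (fst (prod_decode (run E c1 u)) +
    fst (prod_decode (run E c1 v)) + Suc N ^ d + d * Suc N))" for N u v
  define D2 where "D2 N u v \<longleftrightarrow> (\<forall>c<bnd N u v. \<not> codes_cong (Suc N) (run S (run E c1 u) c) (run E (run S c1 c) v))"
    for N u v
  have D1: "D1 N u v \<longleftrightarrow> xv u \<otimes>\<^bsub>G\<^esub> gv N = gv N \<otimes>\<^bsub>G\<^esub> xv v" for N u v
    unfolding D1_def r1 using xv gv by (simp add: runE runS elem_code_eq)
  have cong: "codes_cong m (run S (run E c1 u) c) (run E (run S c1 c) v) \<longleftrightarrow> conj_mod (int m) (xv u) (xv v) (gv c)"
    for m u v c
    unfolding r1 conj_mod_def using xv gv by (simp add: runE runS codes_cong_elem_code del: fst_mult)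
  have D1_conj: "conjugate_in G (xv u) (xv v)" if "D1 N u v" for N u v
    using that gv[of N] xv by (auto simp: D1 conjugate_in_G)
  have conj_D1: "\<exists>N. D1 N u v" if conj: "conjugate_in G (xv u) (xv v)" for u v
  proof -
    obtain g where g: "g \<in> carrier G" "xv u \<otimes>\<^bsub>G\<^esub> g = g \<otimes>\<^bsub>G\<^esub> xv v" using conj xv by (auto simp: conjugate_in_G)
    obtain xs where "foldl (table_mult S) \<one>\<^bsub>G\<^esub> xs = g"
      using reachable_elem[OF fst_closed[OF g(1)] vec_part_closed[of g]] elem_eta[OF g(1)]
      by (auto simp: reachable_def S_def)
    then have "gv (list_encode xs) = g" by (simp add: gv_def)
    then show ?thesis using g(2) D1 by blast
  qed
  have conj_D2: "\<not> D2 N u v" if conj: "conjugate_in G (xv u) (xv v)" for N u v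
  proof -
    have "bounded_conj_mod (Suc N) (xv u) (xv v)"
      using xv conj by (intro conjugate_imp_bounded_conj_mod) auto
    then obtain h z where hz: "h \<in> carrier Fn" "z \<in> integer_vectors d"
      "length h \<le> length (fst (xv u)) + length (fst (xv v)) + Suc N ^ d"
      "\<And>i. 0 \<le> z i \<and> z i < int (Suc N)" "conj_mod (int (Suc N)) (xv u) (xv v) (elem h z)"
      unfolding bounded_conj_mod_def by blast
    obtain xs where xs: "set xs \<subseteq> {..length S}" "length xs = length h + (\<Sum>i<d. nat \<bar>z i\<bar>)"
      "foldl (table_mult S) \<one>\<^bsub>G\<^esub> xs = elem h z"
      using reachable_elem[OF hz(1,2)] by (auto simp: reachable_def S_def)
    have "nat \<bar>z i\<bar> \<le> Suc N" for i using hz(4)[of i] by linarith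
    then have "(\<Sum>i<d. nat \<bar>z i\<bar>) \<le> (\<Sum>i<d. Suc N)" by (intro sum_mono)
    then have "(\<Sum>i<d. nat \<bar>z i\<bar>) \<le> d * Suc N" by simp
    then have "length xs \<le> fst (prod_decode (run E c1 u)) + fst (prod_decode (run E c1 v)) + Suc N ^ d + d * Suc N"
      using xs(2) hz(3) length_le_elem_code[OF xv[of u]] length_le_elem_code[OF xv[of v]]
      unfolding r1 by linarith
    then have "list_encode xs < bnd N u v"
      unfolding bnd_def less_Suc_eq_le using xs(1) by (rule list_encode_le_code_bound)
    moreover have "gv (list_encode xs) = elem h z" using xs(3) by (simp add: gv_def)
    ultimately show ?thesis unfolding D2_def cong using hz(5) by metis
  qed
  have D2_ex: "\<exists>N. D2 N u v" if nc: "\<not> conjugate_in G (xv u) (xv v)" for u v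
  proof -
    obtain m where m: "m > 0" "\<And>g. g \<in> carrier G \<Longrightarrow> \<not> conj_mod m (xv u) (xv v) g"
      using all_conj_mod_imp_conjugate[OF growth xv xv] nc by blast
    have "int (Suc (nat m - 1)) = m" using m(1) by simp
    then have "D2 (nat m - 1) u v" unfolding D2_def cong using m(2) gv by metis
    then show ?thesis ..
  qed
  define f where "f xs = (LEAST N. D1 N (xs ! 0) (xs ! 1) \<or> D2 N (xs ! 0) (xs ! 1))" for xs
  have dD1: "decidable k (\<lambda>xs. D1 (a xs) (b xs) (c xs))" if "computable k a" "computable k b" "computable k c" for k a b c
    unfolding D1_def by (intro decidable_eq computable_run computable_const that)
  have cf: "computable 2 f" unfolding f_def
  proof (rule computable_Least)
    show "decidable (Suc 2) (\<lambda>ys. D1 (ys ! 0) (tl ys ! 0) (tl ys ! 1) \<or> D2 (ys ! 0) (tl ys ! 0) (tl ys ! 1))"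
      unfolding D2_def bnd_def
      by (intro decidable_disj dD1 decidable_ball decidable_not decidable_codes_cong computable_Suc
          computable_code_bound computable_add computable_fst computable_run computable_power
          computable_mult computable_const computable_nth computable_nth_tl computable_nth_tl_tl) auto
    show "\<exists>N. D1 N (xs ! 0) (xs ! 1) \<or> D2 N (xs ! 0) (xs ! 1)" for xs
      using conj_D1 D2_ex by blast
  qed
  have "decidable 2 (\<lambda>xs. D1 (f xs) (xs ! 0) (xs ! 1))"
    by (intro dD1 cf computable_nth) auto
  then obtain F where F: "recursive 2 F" "\<And>xs. length xs = 2 \<Longrightarrow> F xs = of_bool (D1 (f xs) (xs ! 0) (xs ! 1))"
    unfolding computable_def by blast
  show ?thesis unfolding decidable_conjugacy_problem_wrt_def
  proof (intro exI[of _ F] conjI ballI)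
    fix u v assume u: "u \<in> words_over {..<length gs}" and v: "v \<in> words_over {..<length gs}"
    have val: "xv (word_code u) = word_value G gs u" "xv (word_code v) = word_value G gs v"
      unfolding xv_def E_def using gs u v by (simp_all add: word_table_value)
    let ?xs = "[word_code u, word_code v]"
    have "\<exists>N. D1 N (?xs ! 0) (?xs ! 1) \<or> D2 N (?xs ! 0) (?xs ! 1)" using conj_D1 D2_ex by blast
    then have "D1 (f ?xs) (?xs ! 0) (?xs ! 1) \<or> D2 (f ?xs) (?xs ! 0) (?xs ! 1)"
      unfolding f_def by (rule LeastI_ex)
    then have "D1 (f ?xs) (word_code u) (word_code v) \<longleftrightarrow> conjugate_in G (word_value G gs u) (word_value G gs v)"
      unfolding val[symmetric] using D1_conj conj_D2 by auto
    then show "F ?xs = of_bool (conjugate_in G (word_value G gs u) (word_value G gs v))"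
      by (simp add: F(2))
  qed (rule F(1))
qed

end

theorem theorem9:
  fixes d n :: nat
    and \<tau> :: "nat gword \<Rightarrow> int mat"
  assumes "\<tau> \<in> hom (free_group {..<n}) (GL_int d)"
    and "has_subexponential_Dehn_function (lattice_by_free d n \<tau>)"
  shows "decidable_conjugacy_problem (lattice_by_free d n \<tau>)"
proof -
  interpret free_lattice_action d n \<tau> by unfold_locales (rule assms(1))
  obtain X :: "nat set" and R where P: "finite_presentation G X R" and \<delta>: "subexponential (Dehn_function X R)"
    using assms(2) unfolding has_subexponential_Dehn_function_def by blast
  obtain \<theta> where \<theta>: "presented_group G X R \<theta>"
    using finite_presentation_presented_group[OF G.is_group P] .
  interpret pres: presented_free_lattice_action d n \<tau> X R \<theta>
    by (rule presented_free_lattice_action.intro[OF free_lattice_action_axioms \<theta>])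
  have growth: "\<exists>K>0. \<forall>h\<in>carrier Fn. real_of_int (opnorm h) \<le> K * exp (\<epsilon> * real (length h))"
    if \<epsilon>: "\<epsilon> > 0" for \<epsilon>
  proof (rule pres.opnorm_subexponential[OF \<delta> \<epsilon>])
    fix K assume "K > 0" "\<And>h. h \<in> carrier Fn \<Longrightarrow> real_of_int (opnorm h) \<le> K * exp (\<epsilon> * real (length h))"
    then show ?thesis by (intro exI[of _ K]) simp
  qed
  show ?thesis unfolding decidable_conjugacy_problem_def
  proof (intro conjI allI impI)
    show "\<exists>gs. generating_list G gs" using generating_list_standard_elems by blast
    fix gs assume "generating_list G gs"
    then have "set gs \<subseteq> carrier G" by (simp add: generating_list_def)
    with growth show "decidable_conjugacy_problem_wrt G gs" by (rule decidable_conjugacy)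
  qed
qed

end
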